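(* Let $p$ be a prime number. Identify $W_{(p)}(\mathbb{B})$ with $\mathbb{N}^2\cup\{\infty\}$ via the bijection sending $(x,y)\in\mathbb{N}^2$ to the Witt vector $a$ with $a(d_{i,j})=0\Leftrightarrow(i\ge x\text{ and }j\ge y)$, and sending $\infty$ to the Witt vector $a$ with $a(d_{i,j})=1$ for all $i,j\in\mathbb{N}$. The semiring structure on $\mathbb{N}^2\cup\{\infty\}$ inherited from this bijection satisfies the following properties for all $x,x',y,y'\in\mathbb{N}$: (1) The image of $n\in\mathbb{N}$ under the unique semiring map $\mathbb{N}\to\mathbb{N}^2\cup\{\infty\}$ is $(n,0)$ if $n\le1$ (or rather $n\le2$ if $p=2$), and is $\infty$ otherwise. (2) $(x,0)+(x',0)=\infty$ if $x,x'\ge2$. (3) $(0,y)+(0,y')=(0,\max\{y,y'\})$. (4) $(x,0)+(0,y)=(x,y)$. (5) $\infty+z=\infty$ for all $z\in\mathbb{N}^2\cup\{\infty\}$. (6) $(x,0)(x',0)=\infty$ for $x,x'\ge2$. (7) $(0,y)(0,y')=(0,\min\{y,y'\})$. (8) $(x,0)(0,y)=(0,y)$ if $x\ge1$. (9) $\infty(0,y)=(0,y)$. (10) $\infty(x,0)=\infty$ if $x\ge1$.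
   Context: $\mathbb{N}=\{0,1,\dots\}$; semirings are commutative with $0,1$, homomorphisms preserve $0,1$; $\mathbb{B}=\{0,1\}$ with $1+1=1$. Let $\Lambda_{\mathbb{N}}=\bigoplus_\lambda\mathbb{N}m_\lambda$ be the semiring of symmetric functions in $x_1,x_2,\dots$ with coefficients in $\mathbb{N}$ (with $m_\lambda$ the monomial symmetric functions), a subsemiring of the ring $\Lambda_{\mathbb{Z}}$ of symmetric functions. Let $\psi=\sum_ix_i^p$, $d=\frac{(\sum_ix_i)^p-\sum_ix_i^p}{p}$, and $d_{i,j}=d^{\circ i}\circ\psi^{\circ j}\in\Lambda_{\mathbb{N}}$ for $i,j\in\mathbb{N}$, where $\circ$ is plethysm (so $d_{0,0}=\sum_i x_i$). Let $\Lambda_{\mathbb{N},(p)}\subseteq\Lambda_{\mathbb{N}}$ be the subsemiring generated by all $d_{i,j}$; the relations among the $d_{i,j}$ are generated by $d_{i,j}^p=p\,d_{i+1,j}+d_{i,j+1}$. For a semiring $A$, $W_{(p)}(A)=\mathrm{Hom}_{\mathrm{semiring}}(\Lambda_{\mathbb{N},(p)},A)$. Semiring structure on $W_{(p)}(A)$: the maps $\Delta^+:f(\dots,x_i,\dots)\mapsto f(\dots,x_i\otimes1,1\otimes x_i,\dots)$ and $\Delta^\times:f(\dots,x_i,\dots)\mapsto f(\dots,x_i\otimes x_j,\dots)$ restrict to semiring maps $\Lambda_{\mathbb{N},(p)}\to\Lambda_{\mathbb{N},(p)}\otimes_{\mathbb{N}}\Lambda_{\mathbb{N},(p)}$ (the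 target being viewed inside $\Lambda_{\mathbb{Z}}\otimes\Lambda_{\mathbb{Z}}$). Then $a+b$ and $ab$ are the composites of $\Delta^+$ and $\Delta^\times$ with $f\otimes g\mapsto a(f)b(g)$; the elements $0,1$ are $f\mapsto f(0,0,\dots)$ and $f\mapsto f(1,0,0,\dots)$ (images in $A$). *)

theory Defs
  imports "HOL-Library.Poly_Mapping" "HOL-Library.Multiset" "HOL-Algebra.Ring"
    "HOL-Computational_Algebra.Primes"
begin

alias lookup = Poly_Mapping.lookup
alias keys = Poly_Mapping.keys
alias single = Poly_Mapping.single

section \<open>Formal power series over the integers in an arbitrary set of variables\<close>

text \<open>
  A monomial in variables \<open>'v\<close> is an exponent vector of type \<open>'v \<Rightarrow>\<^sub>0 nat\<close>.  The ring of all formal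
  power series contains the ring of symmetric functions (for \<open>'v = nat\<close>), and it contains its
  tensor square (for \<open>'v = nat + nat\<close>, with \<open>Inl i\<close> in the role of \<open>x\<^sub>i \<otimes> 1\<close> and \<open>Inr i\<close> in the role
  of \<open>1 \<otimes> x\<^sub>i\<close>).
\<close>

typedef 'v pseries = "UNIV :: (('v \<Rightarrow>\<^sub>0 nat) \<Rightarrow> int) set"
  morphisms pcoeff Abs_pseries ..

lemma pcoeff_Abs [simp]: "pcoeff (Abs_pseries f) = f"
  by (simp add: Abs_pseries_inverse)

lemma pseries_eqI: "(\<And>m. pcoeff f m = pcoeff g m) \<Longrightarrow> f = g"
  by (metis ext pcoeff_inject)

abbreviation splits :: "('v \<Rightarrow>\<^sub>0 nat) \<Rightarrow> (('v \<Rightarrow>\<^sub>0 nat) \<times> ('v \<Rightarrow>\<^sub>0 nat)) set" where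
  "splits m \<equiv> {(u, v). u + v = m}"

lemma finite_splits [simp]: "finite (splits (m :: 'a \<Rightarrow>\<^sub>0 nat))"
proof -
  let ?B = "{u. \<exists>v. u + v = m}"
  have "finite (lookup ` ?B)"
  proof (rule finite_subset)
    let ?n = "Max (insert 0 (lookup m ` keys m))"
    show "lookup ` ?B \<subseteq> {f. \<forall>x. (x \<in> keys m \<longrightarrow> f x \<in> {..?n}) \<and> (x \<notin> keys m \<longrightarrow> f x = 0)}"
    proof safe
      fix u v :: "'a \<Rightarrow>\<^sub>0 nat" and x assume "x \<in> keys (u + v)"
      moreover have "lookup u x \<le> lookup (u + v) x" by (simp add: lookup_add)
      ultimately show "lookup u x \<le> Max (insert 0 (lookup (u + v) ` keys (u + v)))"
        by (auto intro!: order.trans[OF _ Max_ge])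
    next
      fix u v :: "'a \<Rightarrow>\<^sub>0 nat" and x assume "x \<notin> keys (u + v)"
      then show "lookup u x = 0" by (simp add: in_keys_iff lookup_add)
    qed
    show "finite {f. \<forall>x. (x \<in> keys m \<longrightarrow> f x \<in> {..?n}) \<and> (x \<notin> keys m \<longrightarrow> f x = 0)}"
      by (rule finite_set_of_finite_funs) auto
  qed
  then have "finite ?B"
    by (rule finite_imageD) (simp add: inj_on_def lookup_inject)
  moreover have "splits m \<subseteq> ?B \<times> ?B"
    by safe (metis add.commute)+
  ultimately show ?thesis
    by (meson finite_SigmaI finite_subset)
qed

instantiation pseries :: (type) comm_ring_1
begin

definition "0 = Abs_pseries (\<lambda>m. 0)"
definition "1 = Abs_pseries (\<lambda>m. if m = 0 then 1 else 0)"
definition "f + g = Abs_pseries (\<lambda>m. pcoeff f m + pcoeff g m)"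
definition "- f = Abs_pseries (\<lambda>m. - pcoeff f m)"
definition "f - g = Abs_pseries (\<lambda>m. pcoeff f m - pcoeff g m)"
definition "f * g = Abs_pseries (\<lambda>m. \<Sum>(u, v)\<in>splits m. pcoeff f u * pcoeff g v)"

instance
proof
  fix f g h :: "'a pseries"
  show "f * g * h = f * (g * h)"
  proof (rule pseries_eqI)
    fix m :: "'a \<Rightarrow>\<^sub>0 nat"
    have "pcoeff (f * g * h) m =
        (\<Sum>(s, w)\<in>splits m. \<Sum>(u, v)\<in>splits s. pcoeff f u * pcoeff g v * pcoeff h w)"
      by (simp add: times_pseries_def sum_distrib_right case_prod_unfold)
    also have "\<dots> = (\<Sum>((s, w), (u, v))\<in>Sigma (splits m) (\<lambda>(s, w). splits s).
        pcoeff f u * pcoeff g v * pcoeff h w)"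
      by (subst sum.Sigma[symmetric]) (auto intro!: sum.cong)
    also have "\<dots> = (\<Sum>((u, s), (v, w))\<in>Sigma (splits m) (\<lambda>(u, s). splits s).
        pcoeff f u * (pcoeff g v * pcoeff h w))"
      by (rule sum.reindex_bij_witness[where
            i = "\<lambda>((u, s), (v, w)). ((u + v, w), (u, v))" and
            j = "\<lambda>((s, w), (u, v)). ((u, v + w), (v, w))"])
        (auto simp: algebra_simps)
    also have "\<dots> = (\<Sum>(u, s)\<in>splits m. \<Sum>(v, w)\<in>splits s. pcoeff f u * (pcoeff g v * pcoeff h w))"
      by (subst sum.Sigma[symmetric]) (auto intro!: sum.cong)
    also have "\<dots> = pcoeff (f * (g * h)) m"
      by (simp add: times_pseries_def sum_distrib_left case_prod_unfold)
    finally show "pcoeff (f * g * h) m = pcoeff (f * (g * h)) m" .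
  qed
  show "f * g = g * f"
  proof (rule pseries_eqI)
    fix m :: "'a \<Rightarrow>\<^sub>0 nat"
    show "pcoeff (f * g) m = pcoeff (g * f) m"
      unfolding times_pseries_def pcoeff_Abs
      by (rule sum.reindex_bij_witness[where i = prod.swap and j = prod.swap])
        (auto simp: add.commute)
  qed
  show "1 * f = f"
  proof (rule pseries_eqI)
    fix m :: "'a \<Rightarrow>\<^sub>0 nat"
    have "pcoeff (1 * f) m =
        (\<Sum>p\<in>splits m. if p = (0, m) then pcoeff f m else 0)"
      unfolding times_pseries_def one_pseries_def pcoeff_Abs by (rule sum.cong) (auto split: if_splits)
    then show "pcoeff (1 * f) m = pcoeff f m"
      by (simp add: sum.delta)
  qed
  show "(f + g) * h = f * h + g * h"
    by (rule pseries_eqI)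
      (simp add: times_pseries_def plus_pseries_def case_prod_unfold distrib_right sum.distrib)
  show "(0 :: 'a pseries) \<noteq> 1"
  proof
    assume "(0 :: 'a pseries) = 1"
    then have "pcoeff (0 :: 'a pseries) 0 = pcoeff 1 0" by simp
    then show False by (simp add: zero_pseries_def one_pseries_def)
  qed
qed (auto intro!: pseries_eqI
       simp: plus_pseries_def zero_pseries_def uminus_pseries_def minus_pseries_def)

end


section \<open>Substitution and plethysm\<close>

definition exponents :: "('v \<Rightarrow>\<^sub>0 nat) \<Rightarrow> nat multiset" where
  "exponents e = image_mset (lookup e) (mset_set (keys e))"

text \<open>
  A symmetric function can be evaluated in any family of variables: the coefficient of a monomial
  depends only on its multiset of exponents, which always is that of some monomial in
  \<open>x\<^sub>0, x\<^sub>1, \<dots>\<close>.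
\<close>

definition sym_coeff :: "nat pseries \<Rightarrow> ('i \<Rightarrow>\<^sub>0 nat) \<Rightarrow> int" where
  "sym_coeff f e = pcoeff f (SOME u. exponents u = exponents e)"

text \<open>
  \<open>subst I t f\<close> is the result \<open>f(\<dots>, t i, \<dots>)\<close> of putting the family of monomials \<open>t i\<close>, \<open>i \<in> I\<close>,
  into the symmetric function \<open>f\<close>.  The sum is over the monomials \<open>e\<close> of \<open>f\<close>, written in variables
  indexed by \<open>I\<close>, which become \<open>m\<close>.  It is finite when \<open>f\<close> has bounded degree and only finitely
  many \<open>t i\<close> divide any given monomial.
\<close>

definition subst :: "'i set \<Rightarrow> ('i \<Rightarrow> ('v \<Rightarrow>\<^sub>0 nat)) \<Rightarrow> nat pseries \<Rightarrow> 'v pseries" where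
  "subst I t f = Abs_pseries (\<lambda>m.
     \<Sum>e | keys e \<subseteq> I \<and> (\<forall>v. lookup m v = (\<Sum>i\<in>keys e. lookup e i * lookup (t i) v))
           \<and> sym_coeff f e \<noteq> 0. sym_coeff f e)"

text \<open>
  For \<open>g\<close> with coefficients in the natural numbers, \<open>f \<circ> g = f(y\<^sub>1, y\<^sub>2, \<dots>)\<close> where \<open>y\<^sub>1, y\<^sub>2, \<dots>\<close> are
  the monomials of \<open>g\<close>, each repeated according to its coefficient.
\<close>

definition plethysm :: "nat pseries \<Rightarrow> nat pseries \<Rightarrow> nat pseries" where
  "plethysm f g = subst {(m, k). k < nat (pcoeff g m)} fst f"

definition power_sum :: "nat \<Rightarrow> nat pseries" where
  "power_sum n = Abs_pseries (\<lambda>m. if \<exists>i. m = single i n then 1 else 0)"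

primrec plethysm_power :: "nat pseries \<Rightarrow> nat \<Rightarrow> nat pseries" where
  "plethysm_power f 0 = power_sum 1"
| "plethysm_power f (Suc n) = plethysm f (plethysm_power f n)"


section \<open>The p-typical symmetric functions\<close>

abbreviation psi :: "nat \<Rightarrow> nat pseries" where
  "psi p \<equiv> power_sum p"

text \<open>
  All series built here are symmetric, of bounded degree and have natural number coefficients, so
  \<open>Lambda_p\<close> below, generated inside the ring of all power series, is the subsemiring of the
  semiring of symmetric functions with natural number coefficients generated by the \<open>d\<^sub>i\<^sub>,\<^sub>j\<close>.
\<close>

text \<open>For prime \<open>p\<close> the division by \<open>p\<close> is exact.\<close>

definition delta :: "nat \<Rightarrow> nat pseries" where
  "delta p = Abs_pseries (\<lambda>m. pcoeff (power_sum 1 ^ p - psi p) m div int p)"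

definition d :: "nat \<Rightarrow> nat \<Rightarrow> nat \<Rightarrow> nat pseries" where
  "d p i j = plethysm (plethysm_power (delta p) i) (plethysm_power (psi p) j)"

inductive_set Lambda_p :: "nat \<Rightarrow> nat pseries set" for p :: nat where
  zero: "0 \<in> Lambda_p p"
| one: "1 \<in> Lambda_p p"
| gen: "d p i j \<in> Lambda_p p"
| add: "f \<in> Lambda_p p \<Longrightarrow> g \<in> Lambda_p p \<Longrightarrow> f + g \<in> Lambda_p p"
| mult: "f \<in> Lambda_p p \<Longrightarrow> g \<in> Lambda_p p \<Longrightarrow> f * g \<in> Lambda_p p"


section \<open>Semirings as records, and their homomorphisms\<close>

definition semiring_on :: "'a set \<Rightarrow> 'a::comm_semiring_1 ring" where
  "semiring_on S = \<lparr>carrier = S, monoid.mult = (*), one = 1, zero = 0, add = (+)\<rparr>"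

definition comm_semiring :: "('a, 'm) ring_scheme \<Rightarrow> bool" where
  "comm_semiring R \<longleftrightarrow> Ring.semiring R \<and> Group.comm_monoid R"

text \<open>The library's \<^const>\<open>ring_hom\<close> does not ask for preservation of zero.\<close>

definition semiring_hom :: "('a, 'm) ring_scheme \<Rightarrow> ('b, 'n) ring_scheme \<Rightarrow> ('a \<Rightarrow> 'b) set" where
  "semiring_hom R S = {h \<in> ring_hom R S. h \<zero>\<^bsub>R\<^esub> = \<zero>\<^bsub>S\<^esub>}"


section \<open>The semiring of p-typical Witt vectors\<close>

text \<open>Homomorphisms are made \<^const>\<open>extensional\<close>, so that they are determined by their values on
  \<^term>\<open>Lambda_p p\<close>.\<close>

definition W :: "nat \<Rightarrow> (nat pseries \<Rightarrow> 'a::comm_semiring_1) set" where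
  "W p = semiring_hom (semiring_on (Lambda_p p)) (semiring_on UNIV) \<inter> extensional (Lambda_p p)"

definition tensor :: "nat pseries \<Rightarrow> nat pseries \<Rightarrow> (nat + nat) pseries" where
  "tensor f g = subst UNIV (\<lambda>i. single (Inl i) 1) f
              * subst UNIV (\<lambda>i. single (Inr i) 1) g"

definition Delta_plus :: "nat pseries \<Rightarrow> (nat + nat) pseries" where
  "Delta_plus f = subst UNIV (\<lambda>v. single v 1) f"

definition Delta_times :: "nat pseries \<Rightarrow> (nat + nat) pseries" where
  "Delta_times f =
     subst UNIV (\<lambda>(i, j). single (Inl i) 1 + single (Inr j) 1) f"

text \<open>
  The additive map \<open>f \<otimes> g \<mapsto> a f * b g\<close> on the tensor square of \<^term>\<open>Lambda_p p\<close>, whose elements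
  are the finite sums of \<open>f \<otimes> g\<close> with \<open>f\<close> and \<open>g\<close> in \<^term>\<open>Lambda_p p\<close>.
\<close>

definition tensor_eval ::
  "nat \<Rightarrow> (nat pseries \<Rightarrow> 'a::comm_semiring_1) \<Rightarrow> (nat pseries \<Rightarrow> 'a) \<Rightarrow> (nat + nat) pseries \<Rightarrow> 'a" where
  "tensor_eval p a b F = (THE c. \<exists>fgs. set fgs \<subseteq> Lambda_p p \<times> Lambda_p p
      \<and> F = (\<Sum>(f, g)\<leftarrow>fgs. tensor f g) \<and> c = (\<Sum>(f, g)\<leftarrow>fgs. a f * b g))"

text \<open>
  In \<open>zero\<close> and \<open>one\<close> below, the integers are the natural numbers \<open>f(0, 0, \<dots>)\<close> and
  \<open>f(1, 0, 0, \<dots>)\<close>, the latter being the sum of the coefficients of the powers of \<open>x\<^sub>0\<close>.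
\<close>

definition witt_semiring :: "nat \<Rightarrow> (nat pseries \<Rightarrow> 'a::comm_semiring_1) ring" where
  "witt_semiring p = \<lparr>carrier = W p,
     monoid.mult = (\<lambda>a b. \<lambda>f\<in>Lambda_p p. tensor_eval p a b (Delta_times f)),
     one = (\<lambda>f\<in>Lambda_p p. of_nat (nat
              (\<Sum>k | pcoeff f (single 0 k) \<noteq> 0. pcoeff f (single 0 k)))),
     zero = (\<lambda>f\<in>Lambda_p p. of_nat (nat (pcoeff f 0))),
     add = (\<lambda>a b. \<lambda>f\<in>Lambda_p p. tensor_eval p a b (Delta_plus f))\<rparr>"


section \<open>Boolean Witt vectors\<close>

datatype boolean = B0 | B1

instantiation boolean :: comm_semiring_1
begin

definition "0 = B0"
definition "1 = B1"
fun plus_boolean where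
  "B0 + b = b"
| "B1 + b = B1"
fun times_boolean where
  "B0 * b = B0"
| "B1 * b = (b :: boolean)"

instance
proof
  fix a b c :: boolean
  show "a + b + c = a + (b + c)" by (cases a; cases b; cases c) auto
  show "a + b = b + a" by (cases a; cases b) auto
  show "a * b * c = a * (b * c)" by (cases a; cases b; cases c) auto
  show "a * b = b * a" by (cases a; cases b) auto
  show "(a + b) * c = a * c + b * c" by (cases a; cases b; cases c) auto
qed (auto simp: zero_boolean_def one_boolean_def, (case_tac a; simp)+)

end

datatype coord = Pt nat nat | Infty

primrec witt_of :: "nat \<Rightarrow> coord \<Rightarrow> (nat pseries \<Rightarrow> boolean)" where
  "witt_of p (Pt x y) = (THE a. a \<in> W p \<and> (\<forall>i j. a (d p i j) = 0 \<longleftrightarrow> i \<ge> x \<and> j \<ge> y))"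
| "witt_of p Infty = (THE a. a \<in> W p \<and> (\<forall>i j. a (d p i j) = 1))"

text \<open>The semiring structure transported from the Witt vectors along \<^term>\<open>witt_of p\<close>.\<close>

definition coord_semiring :: "nat \<Rightarrow> coord ring" where
  "coord_semiring p = (let \<phi> = witt_of p; \<phi>' = the_inv_into UNIV \<phi>; R = witt_semiring p in
     \<lparr>carrier = UNIV,
      monoid.mult = (\<lambda>u v. \<phi>' (\<phi> u \<otimes>\<^bsub>R\<^esub> \<phi> v)),
      one = \<phi>' \<one>\<^bsub>R\<^esub>,
      zero = \<phi>' \<zero>\<^bsub>R\<^esub>,
      add = (\<lambda>u v. \<phi>' (\<phi> u \<oplus>\<^bsub>R\<^esub> \<phi> v))\<rparr>)"

end

theory Submission
  imports Defs "HOL-Combinatorics.Permutations" "HOL-Computational_Algebra.Polynomial"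
begin

text \<open>
The argument has three layers: a presentation of the semiring generated by the \<open>d\<^sub>i\<^sub>,\<^sub>j\<close> and of its
tensor square, the action of the two coproducts on the generators, and a positivity argument over the
Booleans.

The relations \<open>d\<^sub>i\<^sub>,\<^sub>j\<^sup>p = p d\<^sub>i\<^sub>+\<^sub>1\<^sub>,\<^sub>j + d\<^sub>i\<^sub>,\<^sub>j\<^sub>+\<^sub>1\<close> (\<open>d_rel\<close>) rewrite every monomial in the generators as a sum of
reduced ones, in which each generator occurs fewer than \<open>p\<close> times.  The lexicographically leading
monomial of \<open>d\<^sub>i\<^sub>,\<^sub>j\<close> involves \<open>x\<^sub>0, \<dots>, x\<^sub>i\<close> only and has exponent \<open>p\<^sup>j\<close> at \<open>x\<^sub>i\<close> (\<open>lead_d\<close>).  As base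
\<open>p\<close> expansions are unique, distinct reduced monomials have distinct leading monomials, so they are
linearly independent.  The same holds in the tensor square, where the generators are \<open>d\<^sub>i\<^sub>,\<^sub>j \<otimes> 1\<close> and
\<open>1 \<otimes> d\<^sub>i\<^sub>,\<^sub>j\<close>.  Hence a homomorphism to any semiring is the same as a solution of the relations there
(\<open>leading_generators\<close>), and \<open>f \<otimes> g \<mapsto> a f * b g\<close> is well defined (\<open>tensor_eval_eq\<close>).

Over the Booleans the relations say that \<open>s\<^sub>i\<^sub>,\<^sub>j = 0\<close> exactly if \<open>s\<^sub>i\<^sub>+\<^sub>1\<^sub>,\<^sub>j = s\<^sub>i\<^sub>,\<^sub>j\<^sub>+\<^sub>1 = 0\<close>.  The zero set of a
solution is therefore empty or a translated quadrant \<open>(x, y) + \<nat>\<^sup>2\<close> (\<open>boolean_solution_pattern\<close>).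

Both coproducts commute with \<open>\<psi>\<close>, the substitution \<open>x\<^sub>i \<mapsto> x\<^sub>i\<^sup>p\<close>, and hence with \<open>\<delta> F = (F\<^sup>p - \<psi> F) / p\<close>,
under which the tensor square of the semiring is stable.  So \<open>d\<^sub>i\<^sub>,\<^sub>j\<close> is sent to
\<open>\<psi>\<^sup>j \<delta>\<^sup>i (z + w)\<close> by addition and to \<open>\<psi>\<^sup>j \<delta>\<^sup>i (z w)\<close> by multiplication, with \<open>z = d\<^sub>0\<^sub>,\<^sub>0 \<otimes> 1\<close> and
\<open>w = 1 \<otimes> d\<^sub>0\<^sub>,\<^sub>0\<close>.  The formulas for \<open>\<delta>\<close> of a sum and of a product have nonnegative coefficients, so that
terms found in one iterate produce terms in the next.  This gives lower bounds for sums and products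
of Witt vectors; in particular \<open>\<infinity>\<close> arises as soon as some iterate contains two terms with nonzero values,
one of which also has a \<open>\<delta>\<close> with nonzero value (\<open>delta_sequence_positive\<close>), or, for \<open>p > 2\<close>, just two
terms with nonzero values (\<open>delta_sequence_positive_odd\<close>).  Upper bounds come from the
unit laws \<open>a + 0 = a\<close> and \<open>a 1 = a\<close> applied to the columns \<open>j \<ge> y\<close>, in which \<open>(0, y)\<close> agrees with \<open>0\<close>
and \<open>(1, y)\<close> with \<open>1\<close>.  Together the bounds determine both operations on \<open>\<nat>\<^sup>2 \<union> {\<infinity>}\<close>
(\<open>plus_pattern\<close>, \<open>times_pattern\<close>), and the semiring laws become a finite case distinction.
\<close>


section \<open>Coefficients\<close>

lemma pcoeff_simps [simp]:
  "pcoeff 0 m = 0" "pcoeff (f + g) m = pcoeff f m + pcoeff g m"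
  "pcoeff (- f) m = - pcoeff f m" "pcoeff (f - g) m = pcoeff f m - pcoeff g m"
  by (simp_all add: zero_pseries_def plus_pseries_def uminus_pseries_def minus_pseries_def)

lemma pcoeff_one: "pcoeff 1 m = (if m = 0 then 1 else 0)"
  by (simp add: one_pseries_def)

lemma pcoeff_mult: "pcoeff (f * g) m = (\<Sum>(u, v)\<in>splits m. pcoeff f u * pcoeff g v)"
  by (simp add: times_pseries_def)

lemma pcoeff_sum: "pcoeff (\<Sum>x\<in>A. f x) m = (\<Sum>x\<in>A. pcoeff (f x) m)"
  by (induction A rule: infinite_finite_induct) auto

lemma pcoeff_of_nat_mult [simp]: "pcoeff (of_nat n * f) m = int n * pcoeff f m"
  by (induction n) (auto simp: algebra_simps)

lemma of_nat_mult_left_cancel_pseries: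
  fixes f g :: "'v pseries"
  assumes "of_nat n * f = of_nat n * g" "n > 0"
  shows "f = g"
proof (rule pseries_eqI)
  fix m
  from assms(1) have "int n * pcoeff f m = int n * pcoeff g m"
    by (metis pcoeff_of_nat_mult)
  with \<open>n > 0\<close> show "pcoeff f m = pcoeff g m" by simp
qed

lemma finite_divisors: "finite {u :: 'v \<Rightarrow>\<^sub>0 nat. \<exists>v. u + v = m}"
proof -
  have "{u. \<exists>v. u + v = m} = fst ` splits m" by force
  then show ?thesis by simp
qed

lemma add_eq_0_monomial [simp]: "(u :: 'v \<Rightarrow>\<^sub>0 nat) + v = 0 \<longleftrightarrow> u = 0 \<and> v = 0"
  by (auto simp: poly_mapping_eq_iff fun_eq_iff lookup_add)

lemma pcoeff_mult_0: "pcoeff (f * g) 0 = pcoeff f 0 * pcoeff g 0"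
proof -
  have "splits (0 :: 'a \<Rightarrow>\<^sub>0 nat) = {(0, 0)}" by auto
  then show ?thesis by (simp add: pcoeff_mult)
qed

lemma pcoeff_power_0: "pcoeff (f ^ n) 0 = pcoeff f 0 ^ n"
  by (induction n) (auto simp: pcoeff_mult_0 pcoeff_one)

definition nonneg :: "'v pseries \<Rightarrow> bool" where
  "nonneg f \<longleftrightarrow> (\<forall>m. pcoeff f m \<ge> 0)"

lemma nonneg_add: "nonneg f \<Longrightarrow> nonneg g \<Longrightarrow> nonneg (f + g)"
  by (auto simp: nonneg_def)

lemma nonneg_mult: "nonneg f \<Longrightarrow> nonneg g \<Longrightarrow> nonneg (f * g)"
  by (auto simp: nonneg_def pcoeff_mult intro!: sum_nonneg)

lemma nonneg_0: "nonneg 0" and nonneg_1: "nonneg 1"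
  by (auto simp: nonneg_def pcoeff_one)

lemma nonneg_power: "nonneg f \<Longrightarrow> nonneg (f ^ n)"
  by (induction n) (auto intro: nonneg_mult nonneg_1)


section \<open>Substituting monomials for variables\<close>

text \<open>
The monomial that the monomial \<open>e\<close> becomes when every variable \<open>i\<close> is replaced by the monomial \<open>t i\<close>.
\<close>

definition combine :: "('i \<Rightarrow> ('v \<Rightarrow>\<^sub>0 nat)) \<Rightarrow> ('i \<Rightarrow>\<^sub>0 nat) \<Rightarrow> ('v \<Rightarrow>\<^sub>0 nat)" where
  "combine t e = Abs_poly_mapping (\<lambda>v. \<Sum>i\<in>keys e. lookup e i * lookup (t i) v)"

lemma lookup_combine: "lookup (combine t e) v = (\<Sum>i\<in>keys e. lookup e i * lookup (t i) v)"
proof -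
  have "{v. (\<Sum>i\<in>keys e. lookup e i * lookup (t i) v) \<noteq> 0} \<subseteq> (\<Union>i\<in>keys e. keys (t i))"
    by (auto simp: in_keys_iff)
  then have "finite {v. (\<Sum>i\<in>keys e. lookup e i * lookup (t i) v) \<noteq> 0}"
    by (rule finite_subset) simp
  then show ?thesis by (simp add: combine_def)
qed

lemma lookup_combine_superset:
  assumes "finite A" "keys e \<subseteq> A"
  shows "lookup (combine t e) v = (\<Sum>i\<in>A. lookup e i * lookup (t i) v)"
  unfolding lookup_combine
  by (rule sum.mono_neutral_left) (use assms in \<open>auto simp: in_keys_iff\<close>)

lemma combine_0 [simp]: "combine t 0 = 0"
  by (simp add: poly_mapping_eq_iff fun_eq_iff lookup_combine)

lemma combine_add: "combine t (e + e') = combine t e + combine t e'"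
proof (rule poly_mapping_eqI)
  fix v
  let ?A = "keys e \<union> keys e'"
  show "lookup (combine t (e + e')) v = lookup (combine t e + combine t e') v"
    by (simp add: lookup_add lookup_combine_superset[of ?A] keys_add sum.distrib distrib_right)
qed

lemma lookup_combine_single [simp]: "lookup (combine t (single i n)) v = n * lookup (t i) v"
  by (simp add: lookup_combine)

lemma combine_combine: "combine s (combine t e) = combine (\<lambda>i. combine s (t i)) e"
proof (rule poly_mapping_eqI)
  fix v
  let ?A = "keys (combine t e) \<union> (\<Union>i\<in>keys e. keys (t i))"
  have "lookup (combine s (combine t e)) v
      = (\<Sum>j\<in>?A. (\<Sum>i\<in>keys e. lookup e i * lookup (t i) j) * lookup (s j) v)"
    by (subst lookup_combine_superset[of ?A]) (auto simp: lookup_combine)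
  also have "\<dots> = (\<Sum>i\<in>keys e. \<Sum>j\<in>?A. lookup e i * (lookup (t i) j * lookup (s j) v))"
    by (simp add: sum_distrib_right mult.assoc) (rule sum.swap)
  also have "\<dots> = (\<Sum>i\<in>keys e. lookup e i * (\<Sum>j\<in>?A. lookup (t i) j * lookup (s j) v))"
    by (simp add: sum_distrib_left)
  also have "\<dots> = lookup (combine (\<lambda>i. combine s (t i)) e) v"
    unfolding lookup_combine[of "\<lambda>i. combine s (t i)"]
    by (rule sum.cong[OF refl]) (subst lookup_combine_superset[of ?A], auto)
  finally show "lookup (combine s (combine t e)) v = \<dots>" .
qed

abbreviation fibre :: "'i set \<Rightarrow> ('i \<Rightarrow> ('v \<Rightarrow>\<^sub>0 nat)) \<Rightarrow> ('v \<Rightarrow>\<^sub>0 nat) \<Rightarrow> ('i \<Rightarrow>\<^sub>0 nat) set" where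
  "fibre I t m \<equiv> {e. keys e \<subseteq> I \<and> combine t e = m}"

definition admissible :: "'i set \<Rightarrow> ('i \<Rightarrow> ('v \<Rightarrow>\<^sub>0 nat)) \<Rightarrow> bool" where
  "admissible I t \<longleftrightarrow> (\<forall>m. finite (fibre I t m))"

text \<open>
Substitution of monomials, for arbitrary series.  It covers renaming of variables, the Frobenius
substitution \<open>x\<^sub>i \<mapsto> x\<^sub>i\<^sup>n\<close>, and (after a renaming) evaluation of symmetric functions.  Finiteness of the
fibres is all that makes it a ring homomorphism.
\<close>

definition msub :: "'i set \<Rightarrow> ('i \<Rightarrow> ('v \<Rightarrow>\<^sub>0 nat)) \<Rightarrow> 'i pseries \<Rightarrow> 'v pseries" where
  "msub I t F = Abs_pseries (\<lambda>m. \<Sum>e\<in>fibre I t m. pcoeff F e)"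

lemma pcoeff_msub: "pcoeff (msub I t F) m = (\<Sum>e\<in>fibre I t m. pcoeff F e)"
  by (simp add: msub_def)

text \<open>
A monomial \<open>m\<close> bounds the exponents of every \<open>e\<close> above it, because each nontrivial \<open>t i\<close> contributes
at least \<open>lookup e i\<close> to the degree of \<open>m\<close>; and only the finitely many \<open>t i\<close> that divide \<open>m\<close> can occur.
\<close>

lemma admissibleI:
  assumes "\<And>i. i \<in> I \<Longrightarrow> t i \<noteq> 0" and "\<And>m. finite {i\<in>I. \<exists>v. t i + v = m}"
  shows "admissible I t"
  unfolding admissible_def
proof
  fix m
  let ?A = "{i\<in>I. \<exists>v. t i + v = m}"
  define N where "N = (\<Sum>v\<in>keys m. lookup m v)"
  have divides: "i \<in> ?A" "lookup e i \<le> N" if "e \<in> fibre I t m" "i \<in> keys e" for e i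
  proof -
    have e: "e = single i 1 + (e - single i 1)"
      using that(2) by (auto simp: poly_mapping_eq_iff fun_eq_iff lookup_add lookup_minus
          lookup_single when_def in_keys_iff)
    have "combine t (single i 1) = t i"
      by (simp add: poly_mapping_eq_iff fun_eq_iff)
    then have "m = t i + combine t (e - single i 1)"
      using that(1) by (subst (asm) e) (auto simp: combine_add)
    then show "i \<in> ?A" using that by auto
    have "t i \<noteq> 0" using that assms(1) by blast
    then obtain v where v: "lookup (t i) v \<noteq> 0"
      by (auto simp: poly_mapping_eq_iff fun_eq_iff)
    have "lookup e i \<le> lookup e i * lookup (t i) v" using v by simp
    also have "\<dots> \<le> (\<Sum>i\<in>keys e. lookup e i * lookup (t i) v)"
      by (rule member_le_sum[OF that(2)]) auto
    also have "\<dots> = lookup m v" using that(1) by (auto simp: lookup_combine)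
    also have "\<dots> \<le> N"
    proof (cases "v \<in> keys m")
      case True
      then show ?thesis unfolding N_def by (rule member_le_sum) auto
    qed (simp add: in_keys_iff)
    finally show "lookup e i \<le> N" .
  qed
  have "lookup ` fibre I t m \<subseteq> {f. \<forall>x. (x \<in> ?A \<longrightarrow> f x \<in> {..N}) \<and> (x \<notin> ?A \<longrightarrow> f x = 0)}"
  proof (rule image_subsetI)
    fix e assume e: "e \<in> fibre I t m"
    have "lookup e x \<le> N" for x
      using divides(2)[OF e, of x] by (cases "x \<in> keys e") (auto simp: in_keys_iff)
    moreover have "lookup e x = 0" if "x \<notin> ?A" for x
      using divides(1)[OF e, of x] that by (auto simp: in_keys_iff)
    ultimately show "lookup e \<in> {f. \<forall>x. (x \<in> ?A \<longrightarrow> f x \<in> {..N}) \<and> (x \<notin> ?A \<longrightarrow> f x = 0)}"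
      by blast
  qed
  moreover have "finite {f. \<forall>x. (x \<in> ?A \<longrightarrow> f x \<in> {..N}) \<and> (x \<notin> ?A \<longrightarrow> f x = 0)}"
    by (rule finite_set_of_finite_funs) (use assms(2) in auto)
  ultimately have "finite (lookup ` fibre I t m)" by (rule finite_subset)
  then show "finite (fibre I t m)"
    by (rule finite_imageD) (simp add: inj_on_def lookup_inject)
qed

lemma msub_add: "msub I t (F + G) = msub I t F + msub I t G"
  by (rule pseries_eqI) (simp add: pcoeff_msub sum.distrib)

lemma msub_0 [simp]: "msub I t 0 = 0"
  by (rule pseries_eqI) (simp add: pcoeff_msub)

lemma nonneg_msub: "nonneg F \<Longrightarrow> nonneg (msub I t F)"
  by (auto simp: nonneg_def pcoeff_msub intro!: sum_nonneg)

lemma msub_mult: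
  assumes "admissible I t"
  shows "msub I t (F * G) = msub I t F * msub I t G"
proof (rule pseries_eqI)
  fix m
  have fin: "finite (fibre I t m)" for m using assms by (simp add: admissible_def)
  have "pcoeff (msub I t (F * G)) m
      = (\<Sum>(e, (u, v))\<in>Sigma (fibre I t m) splits. pcoeff F u * pcoeff G v)"
    by (simp add: pcoeff_msub pcoeff_mult sum.Sigma[OF fin])
  also have "\<dots> = (\<Sum>((a, b), (u, v))\<in>Sigma (splits m) (\<lambda>(a, b). fibre I t a \<times> fibre I t b).
      pcoeff F u * pcoeff G v)"
    by (rule sum.reindex_bij_witness[where
          i = "\<lambda>((a, b), (u, v)). (u + v, (u, v))" and
          j = "\<lambda>(e, (u, v)). ((combine t u, combine t v), (u, v))"])
      (auto simp: combine_add in_keys_iff lookup_add subset_iff)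
  also have "\<dots> = (\<Sum>(a, b)\<in>splits m. \<Sum>(u, v)\<in>fibre I t a \<times> fibre I t b. pcoeff F u * pcoeff G v)"
    by (subst sum.Sigma[symmetric]) (auto intro!: sum.cong simp: fin)
  also have "\<dots> = pcoeff (msub I t F * msub I t G) m"
    by (simp add: pcoeff_mult pcoeff_msub sum_product sum.cartesian_product)
  finally show "pcoeff (msub I t (F * G)) m = \<dots>" .
qed

lemma fibre_0:
  assumes "\<And>i. i \<in> I \<Longrightarrow> t i \<noteq> 0"
  shows "fibre I t 0 = {0}"
proof -
  have "e = 0" if e: "keys e \<subseteq> I" "combine t e = 0" for e
  proof (rule ccontr)
    assume "e \<noteq> 0"
    then obtain i where i: "lookup e i \<noteq> 0" by (auto simp: poly_mapping_eq_iff fun_eq_iff)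
    then have "i \<in> keys e" by (simp add: in_keys_iff)
    with e assms have "t i \<noteq> 0" by blast
    then obtain v where "lookup (t i) v \<noteq> 0" by (auto simp: poly_mapping_eq_iff fun_eq_iff)
    moreover have "lookup (combine t e) v = 0" by (simp add: e)
    ultimately show False using i \<open>i \<in> keys e\<close> by (auto simp: lookup_combine)
  qed
  then show ?thesis by auto
qed

text \<open>
If some \<open>t i\<close> were trivial, all powers of the variable \<open>i\<close> would lie over the trivial monomial.
\<close>

lemma fibre_0_admissible:
  assumes "admissible I t"
  shows "fibre I t 0 = {0}"
proof (rule fibre_0, rule notI)
  fix i assume i: "i \<in> I" "t i = 0"
  have "(\<lambda>n. single i n) ` UNIV \<subseteq> fibre I t 0"
    using i by (auto simp: poly_mapping_eq_iff fun_eq_iff split: if_splits)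
  moreover have "inj (\<lambda>n::nat. single i n)" by simp
  ultimately have "infinite (fibre I t 0)"
    using finite_imageD infinite_UNIV_nat infinite_super by blast
  with assms show False by (simp add: admissible_def)
qed

lemma msub_1: "admissible I t \<Longrightarrow> msub I t 1 = 1"
proof (rule pseries_eqI)
  fix m assume adm: "admissible I t"
  show "pcoeff (msub I t 1) m = pcoeff 1 m"
  proof (cases "m = 0")
    case True
    then show ?thesis using fibre_0_admissible[OF adm] by (simp add: pcoeff_msub pcoeff_one)
  next
    case False
    then have "0 \<notin> fibre I t m" by auto
    then have "(\<Sum>e\<in>fibre I t m. pcoeff 1 e) = 0"
      by (intro sum.neutral) (auto simp: pcoeff_one)
    then show ?thesis using False by (simp add: pcoeff_msub pcoeff_one)
  qed
qed

lemma msub_power: "admissible I t \<Longrightarrow> msub I t (F ^ n) = msub I t F ^ n"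
  by (induction n) (auto simp: msub_1 msub_mult)

lemma msub_of_nat_mult: "msub I t (of_nat n * F) = of_nat n * msub I t F"
  by (rule pseries_eqI) (simp add: pcoeff_msub sum_distrib_left)

lemma msub_msub:
  assumes "admissible J s" "admissible I t" "\<And>i. i \<in> I \<Longrightarrow> keys (t i) \<subseteq> J"
  shows "msub J s (msub I t F) = msub I (\<lambda>i. combine s (t i)) F"
proof (rule pseries_eqI)
  fix m
  have J: "keys (combine t e) \<subseteq> J" if "keys e \<subseteq> I" for e
  proof
    fix v assume "v \<in> keys (combine t e)"
    then obtain i where "i \<in> keys e" "v \<in> keys (t i)"
      by (auto simp: in_keys_iff lookup_combine)
    with that assms(3) show "v \<in> J" by blast
  qed
  have "pcoeff (msub J s (msub I t F)) m = (\<Sum>e'\<in>fibre J s m. \<Sum>e\<in>fibre I t e'. pcoeff F e)"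
    by (simp add: pcoeff_msub)
  also have "\<dots> = (\<Sum>e\<in>(\<Union>e'\<in>fibre J s m. fibre I t e'). pcoeff F e)"
    by (rule sum.UNION_disjoint[symmetric]) (use assms in \<open>auto simp: admissible_def\<close>)
  also have "(\<Union>e'\<in>fibre J s m. fibre I t e') = fibre I (\<lambda>i. combine s (t i)) m"
    using J by (auto simp: combine_combine)
  finally show "pcoeff (msub J s (msub I t F)) m = pcoeff (msub I (\<lambda>i. combine s (t i)) F) m"
    by (simp add: pcoeff_msub)
qed


section \<open>Symmetric series\<close>

abbreviation rename :: "('i \<Rightarrow> 'v) \<Rightarrow> ('i \<Rightarrow>\<^sub>0 nat) \<Rightarrow> ('v \<Rightarrow>\<^sub>0 nat)" where
  "rename \<beta> \<equiv> combine (\<lambda>i. single (\<beta> i) 1)"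

lemma combine_cong: "(\<And>i. i \<in> keys e \<Longrightarrow> s i = t i) \<Longrightarrow> combine s e = combine t e"
  by (auto simp: poly_mapping_eq_iff fun_eq_iff lookup_combine)

lemma combine_single [simp]: "combine t (single i 1) = t i"
  by (simp add: poly_mapping_eq_iff fun_eq_iff)

lemma lookup_combine_inj:
  assumes "inj_on \<beta> (insert i (keys e))"
  shows "lookup (combine (\<lambda>i. single (\<beta> i) c) e) (\<beta> i) = lookup e i * c"
proof -
  have "lookup (combine (\<lambda>i. single (\<beta> i) c) e) (\<beta> i) = (\<Sum>k\<in>keys e. if i = k then lookup e k * c else 0)"
    unfolding lookup_combine
    by (rule sum.cong) (use assms in \<open>auto simp: lookup_single when_def inj_on_def\<close>)
  then show ?thesis by (simp add: in_keys_iff)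
qed

lemma rename_id: "combine (\<lambda>i. single i 1) e = e"
  using lookup_combine_inj[of "\<lambda>i. i" _ e 1] by (simp add: poly_mapping_eq_iff fun_eq_iff)

lemma lookup_combine_notin:
  assumes "v \<notin> \<beta> ` keys e"
  shows "lookup (combine (\<lambda>i. single (\<beta> i) c) e) v = 0"
  unfolding lookup_combine
  by (rule sum.neutral) (use assms in \<open>auto simp: lookup_single when_def\<close>)

lemma keys_combine_inj:
  assumes "inj_on \<beta> (keys e)" "c > 0"
  shows "keys (combine (\<lambda>i. single (\<beta> i) c) e) = \<beta> ` keys e"
proof
  show "keys (combine (\<lambda>i. single (\<beta> i) c) e) \<subseteq> \<beta> ` keys e"
    using lookup_combine_notin[of _ \<beta> e c] by (auto simp: in_keys_iff)
  show "\<beta> ` keys e \<subseteq> keys (combine (\<lambda>i. single (\<beta> i) c) e)"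
  proof
    fix v assume "v \<in> \<beta> ` keys e"
    then obtain i where i: "i \<in> keys e" "v = \<beta> i" by blast
    then have "insert i (keys e) = keys e" by auto
    with i assms lookup_combine_inj[of \<beta> i e c]
    show "v \<in> keys (combine (\<lambda>i. single (\<beta> i) c) e)" by (auto simp: in_keys_iff)
  qed
qed

lemma exponents_rename:
  assumes "inj_on \<beta> (keys e)"
  shows "exponents (rename \<beta> e) = exponents e"
proof -
  have "exponents (rename \<beta> e) = image_mset (lookup (rename \<beta> e)) (image_mset \<beta> (mset_set (keys e)))"
    using assms by (simp add: exponents_def keys_combine_inj image_mset_mset_set)
  also have "\<dots> = exponents e"
    unfolding exponents_def multiset.map_comp
    by (rule image_mset_cong) (use assms in \<open>auto simp: lookup_combine_inj insert_absorb\<close>)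
  finally show ?thesis .
qed

lemma exponents_eq_imp_rename:
  assumes "exponents u = exponents e"
  obtains \<beta> where "bij_betw \<beta> (keys e) (keys u)" "u = rename \<beta> e"
proof -
  have "card (keys e) = card (keys u)"
    using arg_cong[OF assms, of size] by (simp add: exponents_def)
  then obtain h where h: "bij_betw h (keys e) (keys u)"
    using finite_same_card_bij[of "keys e" "keys u"] by auto
  then have "mset_set (keys u) = image_mset h (mset_set (keys e))"
    by (simp add: bij_betw_def image_mset_mset_set)
  then have "image_mset (lookup e) (mset_set (keys e))
      = image_mset (lookup u \<circ> h) (mset_set (keys e))"
    using assms by (simp add: exponents_def multiset.map_comp)
  then obtain q where q: "q permutes keys e" "\<forall>x\<in>keys e. lookup e x = (lookup u \<circ> h) (q x)"
    using image_mset_eq_implies_permutes[OF finite_keys] by blast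
  define \<beta> where "\<beta> = h \<circ> q"
  have \<beta>: "bij_betw \<beta> (keys e) (keys u)" "\<And>i. i \<in> keys e \<Longrightarrow> lookup e i = lookup u (\<beta> i)"
    using q h by (auto simp: \<beta>_def intro: bij_betw_trans permutes_imp_bij)
  have "u = rename \<beta> e"
  proof (rule poly_mapping_eqI)
    fix v
    show "lookup u v = lookup (rename \<beta> e) v"
    proof (cases "v \<in> keys u")
      case True
      then obtain i where i: "i \<in> keys e" "v = \<beta> i" using \<beta>(1) by (auto simp: bij_betw_def)
      then show ?thesis
        using \<beta> lookup_combine_inj[of \<beta> i e 1] by (simp add: bij_betw_def insert_absorb)
    next
      case False
      then have "v \<notin> \<beta> ` keys e" using \<beta>(1) by (auto simp: bij_betw_def)
      then show ?thesis using False by (simp add: lookup_combine_notin in_keys_iff)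
    qed
  qed
  with \<beta>(1) show ?thesis by (rule that)
qed

lemma exponents_exists: "\<exists>u :: nat \<Rightarrow>\<^sub>0 nat. exponents u = exponents e"
proof -
  obtain \<beta> :: "'a \<Rightarrow> nat" where "inj_on \<beta> (keys e)"
    using finite_imp_inj_to_nat_seg[OF finite_keys[of e]] by blast
  then show ?thesis using exponents_rename by blast
qed

definition symmetric :: "nat pseries \<Rightarrow> bool" where
  "symmetric f \<longleftrightarrow> (\<forall>u v. exponents u = exponents v \<longrightarrow> pcoeff f u = pcoeff f v)"

lemma symmetricD: "symmetric f \<Longrightarrow> exponents u = exponents v \<Longrightarrow> pcoeff f u = pcoeff f v"
  unfolding symmetric_def by blast

lemma sym_coeff_eq:
  assumes "symmetric f" "exponents u = exponents e"
  shows "sym_coeff f e = pcoeff f u"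
proof -
  have "exponents (SOME u :: nat \<Rightarrow>\<^sub>0 nat. exponents u = exponents e) = exponents e"
    by (rule someI) (rule assms(2))
  then show ?thesis
    unfolding sym_coeff_def by (intro symmetricD[OF assms(1)]) (simp only: assms(2))
qed

lemma sym_coeff_nat: "symmetric f \<Longrightarrow> sym_coeff f e = pcoeff f e"
  by (rule sym_coeff_eq) auto

lemma sym_coeff_simps [simp]:
  "sym_coeff 0 e = 0" "sym_coeff (f + g) e = sym_coeff f e + sym_coeff g e"
  by (simp_all add: sym_coeff_def)

lemma exponents_eq_empty: "exponents u = {#} \<longleftrightarrow> u = 0"
  by (auto simp: exponents_def mset_set_empty_iff poly_mapping_eq_iff fun_eq_iff in_keys_iff)

lemma sym_coeff_1: "sym_coeff 1 e = (if e = 0 then 1 else 0)"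
proof -
  have "exponents (SOME u :: nat \<Rightarrow>\<^sub>0 nat. exponents u = exponents e) = exponents e"
    by (rule someI_ex) (rule exponents_exists)
  then show ?thesis
    unfolding sym_coeff_def pcoeff_one exponents_eq_empty[symmetric] by simp
qed

lemma rename_inv_into:
  assumes "inj_on \<beta> A" "keys a \<subseteq> A"
  shows "rename (inv_into A \<beta>) (rename \<beta> a) = a"
proof -
  have "rename (inv_into A \<beta>) (rename \<beta> a) = combine (\<lambda>i. single i 1) a"
    unfolding combine_combine combine_single
    by (rule combine_cong) (use assms in \<open>auto simp: inv_into_f_f\<close>)
  then show ?thesis by (simp only: rename_id)
qed

lemma rename_inv_into':
  assumes "keys b \<subseteq> \<beta> ` A"
  shows "rename \<beta> (rename (inv_into A \<beta>) b) = b"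
proof -
  have "rename \<beta> (rename (inv_into A \<beta>) b) = combine (\<lambda>i. single i 1) b"
    unfolding combine_combine combine_single
    by (rule combine_cong) (use assms in \<open>auto simp: f_inv_into_f subset_iff\<close>)
  then show ?thesis by (simp only: rename_id)
qed

lemma keys_add_nat: "keys (a + b :: 'v \<Rightarrow>\<^sub>0 nat) = keys a \<union> keys b"
  by (auto simp: in_keys_iff lookup_add)

text \<open>
A renaming that matches \<open>e\<close> with \<open>u\<close> also matches the factorizations of \<open>e\<close> with those of \<open>u\<close>.  Hence the
convolution formula for the coefficients of a product of symmetric functions can be written in any
variables.  This is the reason why evaluation of symmetric functions respects products.
\<close>

lemma pcoeff_mult_symmetric:
  fixes e :: "'i \<Rightarrow>\<^sub>0 nat" and u :: "nat \<Rightarrow>\<^sub>0 nat"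
  assumes "symmetric f" "symmetric g" "exponents u = exponents e"
  shows "pcoeff (f * g) u = (\<Sum>(a, b)\<in>splits e. sym_coeff f a * sym_coeff g b)"
proof -
  obtain \<beta> where \<beta>: "bij_betw \<beta> (keys e) (keys u)" "u = rename \<beta> e"
    using exponents_eq_imp_rename[OF assms(3)] .
  have inj: "inj_on \<beta> (keys e)" using \<beta>(1) by (simp add: bij_betw_def)
  let ?\<gamma> = "inv_into (keys e) \<beta>"
  have keys_u: "keys u = \<beta> ` keys e" using \<beta>(1) by (simp add: bij_betw_def)
  have ru: "rename ?\<gamma> u = e" using rename_inv_into[OF inj, of e] \<beta>(2) by simp
  have exp: "exponents (rename ?\<gamma> x) = exponents x" if "keys x \<subseteq> keys u" for x
    using that keys_u by (intro exponents_rename inj_on_subset[OF inj_on_inv_into]) auto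
  show ?thesis
    unfolding pcoeff_mult
  proof (rule sum.reindex_bij_witness[where i = "\<lambda>(a, b). (rename \<beta> a, rename \<beta> b)"
        and j = "\<lambda>(a, b). (rename ?\<gamma> a, rename ?\<gamma> b)"], goal_cases)
    case (1 x)
    then obtain a b where x: "x = (a, b)" "a + b = u" by auto
    then have "keys a \<subseteq> \<beta> ` keys e" "keys b \<subseteq> \<beta> ` keys e"
      using keys_add_nat[of a b] keys_u by auto
    then show ?case using rename_inv_into'[of _ \<beta> "keys e"] x by simp
  next
    case (2 x)
    then obtain a b where x: "x = (a, b)" "a + b = u" by auto
    then show ?case using ru by (simp flip: combine_add)
  next
    case (3 x)
    then obtain a b where x: "x = (a, b)" "a + b = e" by auto
    then have "keys a \<subseteq> keys e" "keys b \<subseteq> keys e" using keys_add_nat[of a b] by auto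
    then show ?case
      using rename_inv_into[OF inj, of a] rename_inv_into[OF inj, of b] by (simp only: x prod.case)
  next
    case (4 x)
    then obtain a b where x: "x = (a, b)" "a + b = e" by auto
    then show ?case using \<beta>(2) by (simp flip: combine_add)
  next
    case (5 x)
    then obtain a b where x: "x = (a, b)" "a + b = u" by auto
    then have "keys a \<subseteq> keys u" "keys b \<subseteq> keys u" using keys_add_nat[of a b] by auto
    then show ?case
      using x sym_coeff_eq[OF assms(1) exp[symmetric]] sym_coeff_eq[OF assms(2) exp[symmetric]]
      by simp
  qed
qed

lemma symmetric_mult: "symmetric f \<Longrightarrow> symmetric g \<Longrightarrow> symmetric (f * g)"
  unfolding symmetric_def[of "f * g"]
proof (intro allI impI)
  assume sym: "symmetric f" "symmetric g"
  fix u v :: "nat \<Rightarrow>\<^sub>0 nat"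
  assume "exponents u = exponents v"
  then show "pcoeff (f * g) u = pcoeff (f * g) v"
    using pcoeff_mult_symmetric[OF sym, of u v] pcoeff_mult_symmetric[OF sym, of v v] by simp
qed

lemma sym_coeff_mult:
  assumes "symmetric f" "symmetric g"
  shows "sym_coeff (f * g) e = (\<Sum>(a, b)\<in>splits e. sym_coeff f a * sym_coeff g b)"
proof -
  obtain u :: "nat \<Rightarrow>\<^sub>0 nat" where u: "exponents u = exponents e" using exponents_exists by blast
  show ?thesis
    using sym_coeff_eq[OF symmetric_mult[OF assms] u] pcoeff_mult_symmetric[OF assms u] by simp
qed

lemma symmetric_0: "symmetric 0"
  by (simp add: symmetric_def)

lemma symmetric_add: "symmetric f \<Longrightarrow> symmetric g \<Longrightarrow> symmetric (f + g)"
  unfolding symmetric_def pcoeff_simps by metis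

lemma symmetric_diff: "symmetric f \<Longrightarrow> symmetric g \<Longrightarrow> symmetric (f - g)"
  unfolding symmetric_def pcoeff_simps by metis

lemma symmetric_1: "symmetric 1"
  unfolding symmetric_def pcoeff_one exponents_eq_empty[symmetric] by simp

lemma symmetric_power: "symmetric f \<Longrightarrow> symmetric (f ^ n)"
  by (induction n) (auto intro: symmetric_mult symmetric_1)

lemma symmetric_of_nat_cancel: "symmetric (of_nat n * f) \<Longrightarrow> n > 0 \<Longrightarrow> symmetric f"
  unfolding symmetric_def pcoeff_of_nat_mult by (metis mult_cancel_left of_nat_eq_0_iff neq0_conv)

definition in_vars :: "nat pseries \<Rightarrow> 'i pseries" where
  "in_vars f = Abs_pseries (sym_coeff f)"

lemma pcoeff_in_vars [simp]: "pcoeff (in_vars f) = sym_coeff f"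
  by (simp add: in_vars_def)

lemma in_vars_simps:
  "in_vars 0 = 0" "in_vars 1 = 1" "in_vars (f + g) = in_vars f + in_vars g"
  by (rule pseries_eqI, simp add: sym_coeff_1 pcoeff_one)+

lemma in_vars_mult: "symmetric f \<Longrightarrow> symmetric g \<Longrightarrow> in_vars (f * g) = in_vars f * in_vars g"
  by (rule pseries_eqI) (simp add: sym_coeff_mult pcoeff_mult)


lemma in_vars_nat: "symmetric f \<Longrightarrow> in_vars f = f"
  by (rule pseries_eqI) (simp add: sym_coeff_nat)

lemma subst_eq_msub:
  assumes "admissible I t"
  shows "subst I t f = msub I t (in_vars f)"
proof (rule pseries_eqI)
  fix m
  have "(\<forall>v. lookup m v = (\<Sum>i\<in>keys e. lookup e i * lookup (t i) v)) \<longleftrightarrow> combine t e = m" for e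
    by (simp only: poly_mapping_eq_iff fun_eq_iff lookup_combine eq_commute[of "lookup m _"])
  then have "pcoeff (subst I t f) m = (\<Sum>e | e \<in> fibre I t m \<and> sym_coeff f e \<noteq> 0. sym_coeff f e)"
    by (simp add: subst_def conj_assoc)
  also have "\<dots> = (\<Sum>e\<in>fibre I t m. sym_coeff f e)"
    by (rule sum.mono_neutral_left) (use assms in \<open>auto simp: admissible_def\<close>)
  finally show "pcoeff (subst I t f) m = pcoeff (msub I t (in_vars f)) m"
    by (simp add: pcoeff_msub)
qed

lemma subst_nat: "admissible I t \<Longrightarrow> symmetric f \<Longrightarrow> subst I t f = msub I t f"
  by (simp add: subst_eq_msub in_vars_nat)

lemma
  assumes adm: "admissible I t"
  shows subst_0: "subst I t 0 = 0"
    and subst_1: "subst I t 1 = 1"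
    and subst_add: "subst I t (f + g) = subst I t f + subst I t g"
    and subst_mult: "symmetric f \<Longrightarrow> symmetric g \<Longrightarrow> subst I t (f * g) = subst I t f * subst I t g"
  using adm
  by (simp_all add: subst_eq_msub msub_add msub_mult msub_1 in_vars_simps in_vars_mult)

lemma subst_power:
  "admissible I t \<Longrightarrow> symmetric f \<Longrightarrow> subst I t (f ^ n) = subst I t f ^ n"
  by (induction n) (auto simp: subst_1 subst_mult symmetric_power)

lemma subst_of_nat_mult:
  "admissible I t \<Longrightarrow> subst I t (of_nat n * f) = of_nat n * subst I t f"
  by (induction n) (auto simp: subst_0 subst_add distrib_right)

lemma admissible_single:
  assumes "inj \<beta>" "c > 0"
  shows "admissible UNIV (\<lambda>i. single (\<beta> i) c)"
proof (rule admissibleI)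
  fix m :: "'b \<Rightarrow>\<^sub>0 nat"
  have "{i. \<exists>v. single (\<beta> i) c + v = m} \<subseteq> \<beta> -` keys m"
    using assms(2) by (auto simp: in_keys_iff lookup_add)
  then show "finite {i \<in> UNIV. \<exists>v. single (\<beta> i) c + v = m}"
    using finite_subset[OF _ finite_vimageI[OF finite_keys assms(1)]] by simp
qed (use assms in \<open>auto simp: poly_mapping_eq_iff fun_eq_iff lookup_single when_def\<close>)

abbreviation Psi :: "nat \<Rightarrow> 'v pseries \<Rightarrow> 'v pseries" where
  "Psi n \<equiv> msub UNIV (\<lambda>i. single i n)"

lemma admissible_Psi: "n > 0 \<Longrightarrow> admissible UNIV (\<lambda>i. single i n)"
  using admissible_single[of "\<lambda>i. i" n] by simp

text \<open>
Renaming of variables commutes with raising all variables to the power \<open>n\<close>.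
\<close>

lemma symmetric_Psi:
  assumes "symmetric f" "n > 0"
  shows "symmetric (Psi n f)"
  unfolding symmetric_def
proof (intro allI impI)
  fix u v :: "nat \<Rightarrow>\<^sub>0 nat"
  assume "exponents u = exponents v"
  from exponents_eq_imp_rename[OF this]
  obtain \<beta> where \<beta>: "bij_betw \<beta> (keys v) (keys u)" "u = rename \<beta> v" .
  let ?\<gamma> = "inv_into (keys v) \<beta>"
  have inj: "inj_on \<beta> (keys v)" and keys_u: "keys u = \<beta> ` keys v"
    using \<beta>(1) by (auto simp: bij_betw_def)
  have comm: "combine (\<lambda>i. single i n) (rename \<delta> e) = rename \<delta> (combine (\<lambda>i. single i n) e)"
    for \<delta> :: "nat \<Rightarrow> nat" and e
    by (auto simp: combine_combine poly_mapping_eq_iff fun_eq_iff lookup_single when_def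
        intro!: combine_cong arg_cong[where f = "\<lambda>t. lookup (combine t e) _"])
  have keys: "keys (combine (\<lambda>i. single i n) e) = keys e" for e :: "nat \<Rightarrow>\<^sub>0 nat"
    using keys_combine_inj[of "\<lambda>i. i" e n] assms(2) by simp
  have ru: "rename ?\<gamma> u = v" using rename_inv_into[OF inj, of v] \<beta>(2) by simp
  show "pcoeff (Psi n f) u = pcoeff (Psi n f) v"
    unfolding pcoeff_msub
  proof (rule sum.reindex_bij_witness[where i = "rename \<beta>" and j = "rename ?\<gamma>"], goal_cases)
    case (1 a)
    then show ?case using keys[of a] keys_u by (intro rename_inv_into') auto
  next
    case (2 a)
    then show ?case using ru by (auto simp: comm[unfolded One_nat_def])
  next
    case (3 b)
    then show ?case using keys[of b] by (intro rename_inv_into[OF inj]) auto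
  next
    case (4 b)
    then show ?case using \<beta>(2) by (auto simp: comm[unfolded One_nat_def])
  next
    case (5 a)
    then have "keys a \<subseteq> \<beta> ` keys v" using keys[of a] keys_u by auto
    then have "exponents (rename ?\<gamma> a) = exponents a"
      by (intro exponents_rename inj_on_subset[OF inj_on_inv_into]) auto
    then show ?case by (rule symmetricD[OF assms(1)])
  qed
qed


section \<open>Power sums\<close>

definition ind :: "('v \<Rightarrow>\<^sub>0 nat) set \<Rightarrow> 'v pseries" where
  "ind A = Abs_pseries (\<lambda>m. if m \<in> A then 1 else 0)"

lemma pcoeff_ind: "pcoeff (ind A) m = (if m \<in> A then 1 else 0)"
  by (simp add: ind_def)

lemma power_sum_eq_ind: "power_sum n = ind (range (\<lambda>i. single i n))"
  by (rule pseries_eqI) (auto simp: power_sum_def pcoeff_ind)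

lemma ind_disjoint_Un: "A \<inter> B = {} \<Longrightarrow> ind (A \<union> B) = ind A + ind B"
  by (rule pseries_eqI) (auto simp: pcoeff_ind)

lemma ind_mult:
  assumes "inj_on (\<lambda>(a, b). a + b) (A \<times> B)"
  shows "ind A * ind B = ind ((\<lambda>(a, b). a + b) ` (A \<times> B))"
proof (rule pseries_eqI)
  fix m
  have "pcoeff (ind A * ind B) m = (\<Sum>x\<in>splits m. if x \<in> A \<times> B then 1 else 0)"
    unfolding pcoeff_mult pcoeff_ind by (rule sum.cong) (auto split: if_splits)
  also have "\<dots> = int (card (splits m \<inter> A \<times> B))"
    by (subst sum.If_cases) auto
  also have "\<dots> = pcoeff (ind ((\<lambda>(a, b). a + b) ` (A \<times> B))) m"
  proof (cases "m \<in> (\<lambda>(a, b). a + b) ` (A \<times> B)")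
    case True
    then obtain a b where ab: "a \<in> A" "b \<in> B" "m = a + b" by auto
    then have "splits m \<inter> A \<times> B = {(a, b)}"
      using assms by (auto simp: inj_on_def)
    then show ?thesis using True by (simp add: pcoeff_ind)
  next
    case False
    then have "splits m \<inter> A \<times> B = {}" by auto
    then show ?thesis using False by (simp add: pcoeff_ind)
  qed
  finally show "pcoeff (ind A * ind B) m = \<dots>" .
qed

lemma exponents_single: "n > 0 \<Longrightarrow> exponents u = {#n#} \<longleftrightarrow> (\<exists>i. u = single i n)"
proof
  assume n: "n > 0" and u: "exponents u = {#n#}"
  have "size (exponents u) = card (keys u)" by (simp add: exponents_def)
  with u have "card (keys u) = 1" by simp
  then obtain i where i: "keys u = {i}" by (auto simp: card_1_singleton_iff)
  with u have "lookup u i = n" by (simp add: exponents_def)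
  then have "u = single i n"
    using i by (auto simp: poly_mapping_eq_iff fun_eq_iff lookup_single when_def in_keys_iff)
  then show "\<exists>i. u = single i n" ..
qed (auto simp: exponents_def)

lemma symmetric_power_sum:
  assumes "n > 0"
  shows "symmetric (power_sum n)"
  using exponents_single[OF assms, where 'a = nat]
  unfolding symmetric_def power_sum_def pcoeff_Abs by metis

lemma sym_coeff_power_sum:
  assumes "n > 0"
  shows "sym_coeff (power_sum n) e = (if \<exists>i. e = single i n then 1 else 0)"
proof -
  obtain u :: "nat \<Rightarrow>\<^sub>0 nat" where u: "exponents u = exponents e" using exponents_exists by blast
  have "sym_coeff (power_sum n) e = pcoeff (power_sum n) u"
    by (rule sym_coeff_eq[OF symmetric_power_sum[OF assms] u])
  then show ?thesis
    using exponents_single[OF assms, of u] exponents_single[OF assms, of e] u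
    by (simp add: power_sum_def)
qed

lemma pcoeff_subst_power_sum:
  assumes "admissible I t" "n > 0"
  shows "pcoeff (subst I t (power_sum n)) m = int (card {i\<in>I. combine t (single i n) = m})"
proof -
  have fin: "finite (fibre I t m)" using assms(1) by (simp add: admissible_def)
  have "pcoeff (subst I t (power_sum n)) m = int (card {e \<in> fibre I t m. \<exists>i. e = single i n})"
    using fin by (simp add: subst_eq_msub[OF assms(1)] pcoeff_msub sym_coeff_power_sum[OF assms(2)]
        sum.If_cases Int_def)
  also have "{e \<in> fibre I t m. \<exists>i. e = single i n} = (\<lambda>i. single i n) ` {i\<in>I. combine t (single i n) = m}"
    using assms(2) by auto
  also have "card \<dots> = card {i\<in>I. combine t (single i n) = m}"
    by (rule card_image) (use assms(2) in \<open>auto simp: inj_on_def poly_mapping_eq_iff fun_eq_iff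
        lookup_single when_def split: if_splits\<close>)
  finally show ?thesis .
qed

lemma single_eq_iff: "n > 0 \<Longrightarrow> single i n = single j n \<longleftrightarrow> i = (j :: 'v)" for n :: nat
  by (auto simp: poly_mapping_eq_iff fun_eq_iff lookup_single when_def split: if_splits)

lemma combine_single_single: "combine (\<lambda>i. single (\<beta> i) c) (single i n) = single (\<beta> i) (n * c)"
  by (auto simp: poly_mapping_eq_iff fun_eq_iff lookup_single when_def)

lemma subst_single_power_sum:
  assumes "inj \<beta>" "c > 0" "n > 0"
  shows "subst UNIV (\<lambda>i. single (\<beta> i) c) (power_sum n) = ind (range (\<lambda>i. single (\<beta> i) (n * c)))"
proof (rule pseries_eqI)
  fix m
  have "{i. single (\<beta> i) (n * c) = m} = (if m \<in> range (\<lambda>i. single (\<beta> i) (n * c))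
      then {THE i. single (\<beta> i) (n * c) = m} else {})"
    using assms by (auto simp: single_eq_iff inj_eq)
  then have "card {i. single (\<beta> i) (n * c) = m} = (if m \<in> range (\<lambda>i. single (\<beta> i) (n * c)) then 1 else 0)"
    by simp
  then show "pcoeff (subst UNIV (\<lambda>i. single (\<beta> i) c) (power_sum n)) m
      = pcoeff (ind (range (\<lambda>i. single (\<beta> i) (n * c)))) m"
    using assms
    by (simp add: pcoeff_subst_power_sum admissible_single combine_single_single pcoeff_ind)
qed

lemma Psi_power_sum: "q > 0 \<Longrightarrow> n > 0 \<Longrightarrow> Psi q (power_sum n) = power_sum (q * n)"
  using subst_single_power_sum[of "\<lambda>i::nat. i" q n] subst_nat[OF admissible_Psi symmetric_power_sum, of q n]
  by (simp add: power_sum_eq_ind[of "n * q"] mult.commute)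

lemma pcoeff_Psi_0: "n > 0 \<Longrightarrow> pcoeff (Psi n f) 0 = pcoeff f 0"
  by (simp only: pcoeff_msub fibre_0_admissible[OF admissible_Psi]) simp

lemma Psi_1: "Psi 1 f = f"
  by (rule pseries_eqI) (simp add: pcoeff_msub rename_id[unfolded One_nat_def])

lemma pcoeff_power_sum_0: "n > 0 \<Longrightarrow> pcoeff (power_sum n) 0 = 0"
  by (auto simp: power_sum_def poly_mapping_eq_iff fun_eq_iff lookup_single when_def)

lemma nonneg_power_sum: "nonneg (power_sum n)"
  by (simp add: nonneg_def power_sum_def)


section \<open>Plethysm\<close>

lemma admissible_plethysm:
  assumes "pcoeff g 0 = 0"
  shows "admissible {(m, k). k < nat (pcoeff g m)} fst"
proof (rule admissibleI)
  show "fst i \<noteq> 0" if "i \<in> {(m, k). k < nat (pcoeff g m)}" for i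
    using that assms by auto
  fix m
  have "{i \<in> {(m, k). k < nat (pcoeff g m)}. \<exists>v. fst i + v = m}
      = Sigma {u. \<exists>v. u + v = m} (\<lambda>u. {..<nat (pcoeff g u)})"
    by auto
  then show "finite {i \<in> {(m, k). k < nat (pcoeff g m)}. \<exists>v. fst i + v = m}"
    using finite_divisors[of m] by simp
qed

text \<open>
Every monomial of \<open>g\<close> is raised to the power \<open>n\<close>, and its multiplicity is unchanged.
\<close>

lemma plethysm_power_sum:
  assumes "nonneg g" "pcoeff g 0 = 0" "n > 0"
  shows "plethysm (power_sum n) g = Psi n g"
proof (rule pseries_eqI)
  fix m
  let ?I = "{(m, k). k < nat (pcoeff g m)}"
  have n: "combine fst (single (u, k) n) = combine (\<lambda>i. single i n) u" for u :: "nat \<Rightarrow>\<^sub>0 nat" and k :: nat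
  proof (rule poly_mapping_eqI)
    fix v
    show "lookup (combine fst (single (u, k) n)) v = lookup (combine (\<lambda>i. single i n) u) v"
      using lookup_combine_inj[of "\<lambda>i. i" v u n] by simp
  qed
  have "{i\<in>?I. combine fst (single i n) = m}
      = Sigma (fibre UNIV (\<lambda>i. single i n) m) (\<lambda>u. {..<nat (pcoeff g u)})"
    by (auto simp: n)
  moreover have "finite (fibre UNIV (\<lambda>i. single i n) m)"
    by (rule admissible_Psi[OF assms(3), unfolded admissible_def, rule_format])
  ultimately show "pcoeff (plethysm (power_sum n) g) m = pcoeff (Psi n g) m"
    using assms(1) by (simp add: plethysm_def pcoeff_subst_power_sum[OF admissible_plethysm assms(3)]
        assms(2) pcoeff_msub nonneg_def)
qed

lemma nonneg_plethysm:
  assumes "nonneg f"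
  shows "nonneg (plethysm f g)"
  using assms by (auto simp: nonneg_def plethysm_def subst_def sym_coeff_def intro!: sum_nonneg)


section \<open>Exactness of the division in the definition of delta\<close>

lemma freshman:
  fixes a b :: "'a::comm_ring_1"
  assumes "prime p"
  shows "(a + b) ^ p = a ^ p + b ^ p + of_nat p * (\<Sum>k\<in>{0<..<p}. of_nat ((p choose k) div p) * a ^ k * b ^ (p - k))"
proof -
  have p: "p > 0" using assms prime_gt_0_nat by blast
  have "{..p} = insert 0 (insert p {0<..<p})" using p by auto
  then have "(a + b) ^ p = a ^ p + b ^ p + (\<Sum>k\<in>{0<..<p}. of_nat (p choose k) * a ^ k * b ^ (p - k))"
    using p by (simp add: binomial_ring)
  also have "(\<Sum>k\<in>{0<..<p}. of_nat (p choose k) * a ^ k * b ^ (p - k))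
      = (\<Sum>k\<in>{0<..<p}. of_nat p * (of_nat ((p choose k) div p) * a ^ k * b ^ (p - k)))"
  proof (rule sum.cong[OF refl])
    fix k assume "k \<in> {0<..<p}"
    then have "p dvd (p choose k)" using assms by (intro dvd_choose_prime) auto
    then have "p choose k = p * ((p choose k) div p)" by (rule dvd_mult_div_cancel[symmetric])
    then have "(of_nat (p choose k) :: 'a) = of_nat p * of_nat ((p choose k) div p)"
      by (subst of_nat_mult[symmetric]) (rule arg_cong)
    then show "of_nat (p choose k) * a ^ k * b ^ (p - k)
        = of_nat p * (of_nat ((p choose k) div p) * a ^ k * b ^ (p - k))"
      by (simp add: mult.assoc)
  qed
  finally show ?thesis by (simp add: sum_distrib_left)
qed

lemma ind_single_power: "n > 0 \<Longrightarrow> ind {single i 1} ^ n = ind {single i n}"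
proof (induction n rule: nat_induct_non_zero)
  case (Suc n)
  have "ind {single i 1} * ind {single i n} = ind {single i (Suc n)}"
    by (subst ind_mult) (auto simp flip: single_add)
  with Suc show ?case by simp
qed simp

text \<open>
The Frobenius congruence modulo \<open>p\<close>, with the first \<open>N\<close> variables split off one by one and the rest of the
power sum kept as one summand.
\<close>

lemma power_sum_prime_power:
  assumes "prime p"
  shows "\<exists>h. power_sum 1 ^ p = (\<Sum>i<N. ind {single i p}) + ind ((\<lambda>i. single i 1) ` {N..}) ^ p + of_nat p * h"
proof (induction N)
  case 0
  have "{0::nat..} = UNIV" by auto
  then show ?case by (auto simp: power_sum_eq_ind intro: exI[of _ 0])
next
  case (Suc N)
  then obtain h where h: "power_sum 1 ^ p = (\<Sum>i<N. ind {single i p})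
      + ind ((\<lambda>i. single i 1) ` {N..}) ^ p + of_nat p * h" by blast
  have "{N..} = {N} \<union> {Suc N..}" by auto
  then have "(\<lambda>i. single i (1::nat)) ` {N..} = {single N 1} \<union> (\<lambda>i. single i 1) ` {Suc N..}"
    by (simp only: image_Un image_insert image_empty)
  also have "ind \<dots> = ind {single N 1} + ind ((\<lambda>i. single i 1) ` {Suc N..})"
    by (rule ind_disjoint_Un) (auto simp: single_eq_iff)
  finally obtain h' where "ind ((\<lambda>i. single i 1) ` {N..}) ^ p
      = ind {single N p} + ind ((\<lambda>i. single i 1) ` {Suc N..}) ^ p + of_nat p * h'"
    using freshman[OF assms, of "ind {single N 1}"] ind_single_power[of p N] prime_gt_0_nat[OF assms]
    by auto
  with h have "power_sum 1 ^ p = (\<Sum>i<Suc N. ind {single i p})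
      + ind ((\<lambda>i. single i 1) ` {Suc N..}) ^ p + of_nat p * (h + h')"
    by (simp add: algebra_simps)
  then show ?case by blast
qed

text \<open>
A given monomial involves finitely many variables, so the tail of the Frobenius congruence
does not contribute to its coefficient.
\<close>

lemma prime_dvd_power_sum_power_diff:
  assumes "prime p"
  shows "int p dvd pcoeff (power_sum 1 ^ p - power_sum p) m"
proof -
  have p: "p > 0" using assms prime_gt_0_nat by blast
  obtain N where N: "keys m \<subseteq> {..<N}"
    using finite_nat_set_iff_bounded[of "keys m"] by auto
  let ?r = "ind ((\<lambda>i. single i (1::nat)) ` {N..})"
  obtain h where h: "power_sum 1 ^ p = (\<Sum>i<N. ind {single i p}) + ?r ^ p + of_nat p * h"
    using power_sum_prime_power[OF assms, of N] by blast
  \<comment> \<open>Every monomial of the tail contains a variable that does not divide \<open>m\<close>.\<close>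
  have "pcoeff ?r u = 0" if "u + v = m" for u v
    using N that by (auto simp: pcoeff_ind image_iff keys_add_nat)
  then have "pcoeff (?r * ?r ^ (p - 1)) m = 0"
    unfolding pcoeff_mult by (intro sum.neutral) auto
  then have r: "pcoeff (?r ^ p) m = 0" using p by (cases p) auto
  have "pcoeff (power_sum p) m = (\<Sum>i<N. pcoeff (ind {single i p}) m)"
  proof (cases "\<exists>i. m = single i p")
    case True
    then obtain i where i: "m = single i p" by blast
    then have "i < N" using N p by simp
    have "(\<Sum>j<N. pcoeff (ind {single j p}) m) = (\<Sum>j<N. if j = i then 1 else 0)"
      using p by (intro sum.cong) (auto simp: pcoeff_ind i single_eq_iff)
    then show ?thesis using \<open>i < N\<close> i by (auto simp: power_sum_def)
  qed (auto simp: power_sum_def pcoeff_ind)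
  then show ?thesis unfolding h using r by (simp add: pcoeff_sum)
qed

lemma delta_eq:
  assumes "prime p"
  shows "of_nat p * delta p + power_sum p = power_sum 1 ^ p"
  by (rule pseries_eqI)
    (use prime_dvd_power_sum_power_diff[OF assms] in \<open>simp add: delta_def\<close>)

lemma nonneg_power_diff:
  assumes "nonneg a" "nonneg b"
  shows "nonneg ((a + b) ^ n - a ^ n)"
proof (induction n)
  case (Suc n)
  have "(a + b) ^ Suc n - a ^ Suc n = a * ((a + b) ^ n - a ^ n) + b * (a + b) ^ n"
    by (simp add: algebra_simps)
  with Suc assms show ?case
    by (simp add: nonneg_add nonneg_mult nonneg_power)
qed (simp add: nonneg_def)

lemma nonneg_delta:
  assumes "prime p"
  shows "nonneg (delta p)"
proof -
  have p: "p > 0" using assms prime_gt_0_nat by blast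
  have "pcoeff (power_sum 1 ^ p - power_sum p) m \<ge> 0" for m
  proof (cases "\<exists>i. m = single i p")
    case True
    then obtain i where i: "m = single i p" by blast
    have "range (\<lambda>i. single i (1::nat)) = {single i 1} \<union> (\<lambda>i. single i 1) ` (- {i})" by auto
    then have eq: "power_sum 1 = ind {single i 1} + ind ((\<lambda>i. single i 1) ` (- {i}))"
      unfolding power_sum_eq_ind by (simp only:) (rule ind_disjoint_Un, auto simp: single_eq_iff)
    have "nonneg (power_sum 1 ^ p - ind {single i 1} ^ p)"
      unfolding eq by (rule nonneg_power_diff) (auto simp: nonneg_def pcoeff_ind)
    then have "pcoeff (power_sum 1 ^ p) m \<ge> pcoeff (ind {single i 1} ^ p) m"
      by (simp add: nonneg_def)
    then show ?thesis using i ind_single_power[OF p, of i] by (auto simp: pcoeff_ind power_sum_def)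
  next
    case False
    then show ?thesis
      using nonneg_power[OF nonneg_power_sum, of 1 p] by (simp add: nonneg_def power_sum_def[of p])
  qed
  then show ?thesis by (simp add: nonneg_def delta_def pos_imp_zdiv_nonneg_iff p del: pcoeff_simps)
qed


section \<open>The relations between the generators\<close>

context
  fixes p :: nat
  assumes prime_p: "prime p"
begin

lemma p_pos: "p > 0"
  using prime_p prime_gt_0_nat by blast

lemma delta_properties:
  shows symmetric_delta: "symmetric (delta p)" and pcoeff_delta_0: "pcoeff (delta p) 0 = 0"
proof -
  have eq: "of_nat p * delta p = power_sum 1 ^ p - power_sum p"
    using delta_eq[OF prime_p] by (simp add: algebra_simps)
  have "symmetric (of_nat p * delta p)"
    unfolding eq by (intro symmetric_diff symmetric_power symmetric_power_sum) (auto simp: p_pos)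
  then show "symmetric (delta p)" using p_pos by (rule symmetric_of_nat_cancel)
  have "int p * pcoeff (delta p) 0 = 0"
    using arg_cong[OF eq, of "\<lambda>f. pcoeff f 0"] p_pos
    by (simp add: pcoeff_power_0 pcoeff_power_sum_0)
  then show "pcoeff (delta p) 0 = 0" using p_pos by simp
qed

lemma plethysm_delta:
  assumes "nonneg g" "pcoeff g 0 = 0"
  shows "of_nat p * plethysm (delta p) g + Psi p g = g ^ p"
proof -
  note adm = admissible_plethysm[OF assms(2)]
  have "of_nat p * plethysm (delta p) g + plethysm (power_sum p) g = plethysm (power_sum 1 ^ p) g"
    unfolding plethysm_def delta_eq[OF prime_p, symmetric]
    by (simp add: subst_add[OF adm] subst_of_nat_mult[OF adm])
  also have "\<dots> = plethysm (power_sum 1) g ^ p"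
    unfolding plethysm_def by (rule subst_power[OF adm symmetric_power_sum]) simp
  finally show ?thesis
    using plethysm_power_sum[OF assms] p_pos by (simp add: Psi_1[unfolded One_nat_def])
qed

abbreviation delta_power :: "nat \<Rightarrow> nat pseries" where
  "delta_power i \<equiv> plethysm_power (delta p) i"

lemma delta_power_nonneg: "nonneg (delta_power i)"
  by (cases i) (auto intro: nonneg_plethysm nonneg_delta nonneg_power_sum prime_p)

lemma delta_power_0: "pcoeff (delta_power i) 0 = 0"
proof (induction i)
  case (Suc i)
  have "Psi p (delta_power i) = delta_power i ^ p - of_nat p * delta_power (Suc i)"
    using plethysm_delta[OF delta_power_nonneg Suc] by (simp add: algebra_simps)
  from arg_cong[OF this, of "\<lambda>f. pcoeff f 0"] show ?case
    using Suc p_pos by (simp add: pcoeff_Psi_0 pcoeff_power_0 zero_power)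
qed (simp add: pcoeff_power_sum_0)

lemma delta_power_Suc: "of_nat p * delta_power (Suc i) + Psi p (delta_power i) = delta_power i ^ p"
  using plethysm_delta[OF delta_power_nonneg delta_power_0] by simp

lemma symmetric_delta_power: "symmetric (delta_power i)"
proof (induction i)
  case (Suc i)
  have eq: "of_nat p * delta_power (Suc i) = delta_power i ^ p - Psi p (delta_power i)"
    using delta_power_Suc[of i] by (simp add: algebra_simps)
  have "symmetric (of_nat p * delta_power (Suc i))"
    unfolding eq using Suc by (intro symmetric_diff symmetric_power symmetric_Psi p_pos)
  then show ?case using p_pos by (rule symmetric_of_nat_cancel)
qed (simp add: symmetric_power_sum)

lemma symmetric_Psi_iterate: "symmetric ((Psi p ^^ j) (delta_power i))"
  by (induction j) (auto intro: symmetric_delta_power symmetric_Psi p_pos)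

lemma Psi_iterate_rel:
  "of_nat p * (Psi p ^^ j) (delta_power (Suc i)) + (Psi p ^^ Suc j) (delta_power i)
    = (Psi p ^^ j) (delta_power i) ^ p"
proof (induction j)
  case 0
  then show ?case using delta_power_Suc by simp
next
  case (Suc j)
  show ?case
    using arg_cong[OF Suc, of "Psi p"]
    by (simp add: msub_add msub_of_nat_mult msub_power[OF admissible_Psi[OF p_pos]])
qed

lemma Psi_iterate_power_sum: "n > 0 \<Longrightarrow> (Psi p ^^ j) (power_sum n) = power_sum (p ^ j * n)"
  by (induction j) (simp_all add: Psi_power_sum p_pos mult.assoc)

lemma plethysm_power_psi: "plethysm_power (psi p) j = power_sum (p ^ j)"
  by (induction j)
    (simp_all add: plethysm_power_sum nonneg_power_sum pcoeff_power_sum_0 p_pos Psi_power_sum)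

text \<open>
Plethysm with a power sum from the right and the Frobenius substitution are two ring homomorphisms on
symmetric functions that agree on power sums.  The iterates of \<open>delta\<close> are determined by power sums
through the relations, because multiplication by \<open>p\<close> is injective; so both give the same result on them.
\<close>

lemma d_eq: "d p i j = (Psi p ^^ j) (delta_power i)"
proof -
  define \<Phi> where "\<Phi> f = plethysm f (power_sum (p ^ j))" for f
  have pj: "p ^ j > 0" using p_pos by simp
  note adm = admissible_plethysm[OF pcoeff_power_sum_0[OF pj]]
  have "\<Phi> ((Psi p ^^ k) (delta_power i)) = (Psi p ^^ (j + k)) (delta_power i)" for k
  proof (induction i arbitrary: k)
    case 0
    have "p ^ k > 0" using p_pos by simp
    then show ?case
      by (simp add: \<Phi>_def Psi_iterate_power_sum[of 1, unfolded One_nat_def] plethysm_power_sum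
          nonneg_power_sum pcoeff_power_sum_0[OF pj] Psi_power_sum p_pos mult.commute power_add)
  next
    case (Suc i)
    have "of_nat p * \<Phi> ((Psi p ^^ k) (delta_power (Suc i))) + \<Phi> ((Psi p ^^ Suc k) (delta_power i))
        = \<Phi> ((Psi p ^^ k) (delta_power i)) ^ p"
      unfolding \<Phi>_def plethysm_def
      by (simp add: Psi_iterate_rel[symmetric] subst_add[OF adm] subst_of_nat_mult[OF adm]
          subst_power[OF adm symmetric_Psi_iterate, symmetric])
    also have "\<dots> = of_nat p * (Psi p ^^ (j + k)) (delta_power (Suc i)) + (Psi p ^^ (j + Suc k)) (delta_power i)"
      by (simp only: Suc.IH Psi_iterate_rel add_Suc_right)
    finally have "of_nat p * \<Phi> ((Psi p ^^ k) (delta_power (Suc i)))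
        = of_nat p * (Psi p ^^ (j + k)) (delta_power (Suc i))"
      by (simp only: Suc.IH add_right_cancel)
    then show ?case using p_pos by (rule of_nat_mult_left_cancel_pseries)
  qed
  from this[of 0] show ?thesis by (simp add: d_def plethysm_power_psi \<Phi>_def)
qed

lemma d_0: "d p 0 j = power_sum (p ^ j)"
  using Psi_iterate_power_sum[of 1 j] by (simp add: d_eq)

lemma d_rel: "d p i j ^ p = of_nat p * d p (Suc i) j + d p i (Suc j)"
  using Psi_iterate_rel[of j i] by (simp add: d_eq)

lemma Psi_d: "Psi p (d p i j) = d p i (Suc j)"
  by (simp add: d_eq)

lemma symmetric_d: "symmetric (d p i j)"
  by (simp add: d_eq symmetric_Psi_iterate)

lemma nonneg_d: "nonneg (d p i j)"
  unfolding d_eq by (induction j) (auto intro: delta_power_nonneg nonneg_msub)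

lemma pcoeff_d_0: "pcoeff (d p i j) 0 = 0"
  unfolding d_eq
proof (induction j)
  case (Suc j)
  then show ?case by (simp add: pcoeff_Psi_0 p_pos)
qed (simp add: delta_power_0)

end


section \<open>Leading monomials\<close>

text \<open>
Monomials are ordered lexicographically, the smallest variable being the most significant one.
\<close>

definition lead :: "'v::linorder pseries \<Rightarrow> ('v \<Rightarrow>\<^sub>0 nat) \<Rightarrow> bool" where
  "lead F m \<longleftrightarrow> pcoeff F m = 1 \<and> (\<forall>m'. pcoeff F m' \<noteq> 0 \<longrightarrow> m' \<le> m)"

lemma lead_mult:
  assumes "lead F m" "lead G n"
  shows "lead (F * G) (m + n)"
proof -
  have top: "u = m \<and> v = n" if "pcoeff F u \<noteq> 0" "pcoeff G v \<noteq> 0" "m + n \<le> u + v" for u v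
  proof -
    have le: "u \<le> m" "v \<le> n" using that assms by (auto simp: lead_def)
    have "\<not> u < m" "\<not> v < n"
      using that(3) le add_less_le_mono[of u m v n] add_le_less_mono[of u m v n] by (auto simp: not_le[symmetric])
    then show ?thesis using le by auto
  qed
  have "pcoeff (F * G) (m + n)
      = (\<Sum>x\<in>splits (m + n). if x = (m, n) then pcoeff F m * pcoeff G n else 0)"
    unfolding pcoeff_mult
  proof (rule sum.cong[OF refl])
    fix x assume "x \<in> splits (m + n)"
    then obtain u v where x: "x = (u, v)" "u + v = m + n" by auto
    then show "(case x of (u, v) \<Rightarrow> pcoeff F u * pcoeff G v)
        = (if x = (m, n) then pcoeff F m * pcoeff G n else 0)"
      using top[of u v] by (cases "pcoeff F u = 0 \<or> pcoeff G v = 0") auto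
  qed
  also have "\<dots> = 1" using assms by (simp add: lead_def)
  finally have one: "pcoeff (F * G) (m + n) = 1" .
  have "m' \<le> m + n" if nz: "pcoeff (F * G) m' \<noteq> 0" for m'
  proof -
    from nz obtain x where "x \<in> splits m'" "(case x of (u, v) \<Rightarrow> pcoeff F u * pcoeff G v) \<noteq> 0"
      unfolding pcoeff_mult by (rule sum.not_neutral_contains_not_neutral)
    then obtain u v where uv: "u + v = m'" "pcoeff F u \<noteq> 0" "pcoeff G v \<noteq> 0" by auto
    then have "u \<le> m" "v \<le> n" using assms by (auto simp: lead_def)
    then show ?thesis using uv(1) by (auto intro: add_mono)
  qed
  with one show ?thesis by (simp add: lead_def)
qed

lemma lead_ind: "lead (ind {m}) m"
  by (auto simp: lead_def pcoeff_ind split: if_splits)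

lemma msub_ind:
  assumes "admissible UNIV t"
  shows "msub UNIV t (ind {e}) = ind {combine t e}"
proof (rule pseries_eqI)
  fix m
  have "pcoeff (msub UNIV t (ind {e})) m = (\<Sum>e'\<in>fibre UNIV t m. if e' = e then 1 else 0)"
    by (simp add: pcoeff_msub pcoeff_ind)
  also have "\<dots> = (if combine t e = m then 1 else 0)"
    using assms by (subst sum.delta) (auto simp: admissible_def)
  finally show "pcoeff (msub UNIV t (ind {e})) m = pcoeff (ind {combine t e}) m"
    by (auto simp: pcoeff_ind)
qed

lemma Psi_ind_single: "n > 0 \<Longrightarrow> Psi n (ind {single i k}) = ind {single i (k * n)}"
  using combine_single_single[of "\<lambda>i. i" n i k] by (simp add: msub_ind admissible_Psi)

lemma ind_0: "ind {0} = 1"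
  by (rule pseries_eqI) (simp add: pcoeff_ind pcoeff_one)

lemma less_monomial_iff:
  "(m :: 'v::linorder \<Rightarrow>\<^sub>0 nat) < m' \<longleftrightarrow>
    (\<exists>k. lookup m k < lookup m' k \<and> (\<forall>k'<k. lookup m k' = lookup m' k'))"
  by (simp add: less_poly_mapping.rep_eq less_fun_def)

lemma combine_strict_mono:
  fixes \<beta> :: "'i::linorder \<Rightarrow> 'v::linorder" and m m' :: "'i \<Rightarrow>\<^sub>0 nat"
  assumes \<beta>: "strict_mono \<beta>" and c: "c > 0" and "m < m'"
  shows "combine (\<lambda>i. single (\<beta> i) c) m < combine (\<lambda>i. single (\<beta> i) c) m'"
proof -
  have inj: "inj \<beta>" using \<beta> by (rule strict_mono_imp_inj_on)
  have at: "lookup (combine (\<lambda>i. single (\<beta> i) c) e) (\<beta> i) = lookup e i * c" for e i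
    by (rule lookup_combine_inj[OF inj_on_subset[OF inj]]) simp
  obtain k where k: "lookup m k < lookup m' k" "\<forall>k'<k. lookup m k' = lookup m' k'"
    using assms(3) by (auto simp: less_monomial_iff)
  have "lookup (combine (\<lambda>i. single (\<beta> i) c) m) v = lookup (combine (\<lambda>i. single (\<beta> i) c) m') v"
    if "v < \<beta> k" for v
  proof (cases "v \<in> range \<beta>")
    case True
    then obtain k' where k': "v = \<beta> k'" by blast
    then have "k' < k" using that strict_mono_less[OF \<beta>] by blast
    then show ?thesis using k k' at by simp
  next
    case False
    then show ?thesis by (subst (1 2) lookup_combine_notin) auto
  qed
  moreover have "lookup (combine (\<lambda>i. single (\<beta> i) c) m) (\<beta> k) < lookup (combine (\<lambda>i. single (\<beta> i) c) m') (\<beta> k)"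
    using k c by (simp add: at)
  ultimately show ?thesis unfolding less_monomial_iff by blast
qed

lemma lead_msub:
  fixes \<beta> :: "'i::linorder \<Rightarrow> 'v::linorder"
  assumes \<beta>: "strict_mono \<beta>" and c: "c > 0" and F: "lead F m"
  shows "lead (msub UNIV (\<lambda>i. single (\<beta> i) c) F) (combine (\<lambda>i. single (\<beta> i) c) m)"
proof -
  let ?t = "\<lambda>i. single (\<beta> i) c"
  note mono = combine_strict_mono[OF \<beta> c]
  have "e = m" if "combine ?t e = combine ?t m" for e
    using mono[of e m] mono[of m e] that by (cases e m rule: linorder_cases) auto
  then have "fibre UNIV ?t (combine ?t m) = {m}" by auto
  then have "pcoeff (msub UNIV ?t F) (combine ?t m) = 1"
    using F by (simp add: pcoeff_msub lead_def)
  moreover have "m' \<le> combine ?t m" if nz: "pcoeff (msub UNIV ?t F) m' \<noteq> 0" for m'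
  proof -
    from nz obtain e where e: "e \<in> fibre UNIV ?t m'" "pcoeff F e \<noteq> 0"
      unfolding pcoeff_msub by (rule sum.not_neutral_contains_not_neutral)
    then have "e \<le> m" using F by (simp add: lead_def)
    then show ?thesis using e mono[of e m] by (auto simp: le_less)
  qed
  ultimately show ?thesis by (simp add: lead_def)
qed


section \<open>The degree in the first variable\<close>

definition xdeg_less :: "nat \<Rightarrow> nat pseries \<Rightarrow> bool" where
  "xdeg_less n F \<longleftrightarrow> (\<forall>m. pcoeff F m \<noteq> 0 \<longrightarrow> lookup m 0 < n)"

lemma xdeg_less_mono: "xdeg_less a F \<Longrightarrow> a \<le> b \<Longrightarrow> xdeg_less b F"
  by (fastforce simp: xdeg_less_def)

lemma xdeg_less_add: "xdeg_less n F \<Longrightarrow> xdeg_less n G \<Longrightarrow> xdeg_less n (F + G)"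
  unfolding xdeg_less_def pcoeff_simps by (metis add.right_neutral)

lemma xdeg_less_diff: "xdeg_less n F \<Longrightarrow> xdeg_less n G \<Longrightarrow> xdeg_less n (F - G)"
  unfolding xdeg_less_def pcoeff_simps by (metis diff_zero)

lemma xdeg_less_0: "xdeg_less n 0"
  by (simp add: xdeg_less_def)

lemma xdeg_less_sum: "(\<And>x. x \<in> A \<Longrightarrow> xdeg_less n (f x)) \<Longrightarrow> xdeg_less n (\<Sum>x\<in>A. f x)"
  by (induction A rule: infinite_finite_induct) (auto intro: xdeg_less_add xdeg_less_0)

lemma xdeg_less_of_nat_mult: "xdeg_less n F \<Longrightarrow> xdeg_less n (of_nat k * F)"
  by (simp add: xdeg_less_def)

lemma xdeg_less_of_nat_cancel: "xdeg_less n (of_nat k * F) \<Longrightarrow> k > 0 \<Longrightarrow> xdeg_less n F"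
  by (simp add: xdeg_less_def)

lemma xdeg_less_mult:
  assumes "xdeg_less (Suc a) F" "xdeg_less (Suc b) G"
  shows "xdeg_less (Suc (a + b)) (F * G)"
  unfolding xdeg_less_def
proof (intro allI impI)
  fix m assume "pcoeff (F * G) m \<noteq> 0"
  then obtain x where "x \<in> splits m" "(case x of (u, v) \<Rightarrow> pcoeff F u * pcoeff G v) \<noteq> 0"
    unfolding pcoeff_mult by (rule sum.not_neutral_contains_not_neutral)
  then obtain u v where "u + v = m" "pcoeff F u \<noteq> 0" "pcoeff G v \<noteq> 0" by auto
  then have "lookup u 0 < Suc a" "lookup v 0 < Suc b" "lookup m 0 = lookup u 0 + lookup v 0"
    using assms by (auto simp: xdeg_less_def lookup_add)
  then show "lookup m 0 < Suc (a + b)" by simp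
qed

lemma xdeg_less_1: "xdeg_less (Suc 0) 1"
  by (simp add: xdeg_less_def pcoeff_one)

lemma xdeg_less_power: "xdeg_less (Suc a) F \<Longrightarrow> xdeg_less (Suc (a * k)) (F ^ k)"
  by (induction k) (auto intro: xdeg_less_1 dest: xdeg_less_mult)

lemma xdeg_less_Psi:
  assumes "xdeg_less (Suc a) F"
  shows "xdeg_less (Suc (a * n)) (Psi n F)"
  unfolding xdeg_less_def
proof (intro allI impI)
  fix m assume "pcoeff (Psi n F) m \<noteq> 0"
  then obtain e where e: "e \<in> fibre UNIV (\<lambda>i. single i n) m" "pcoeff F e \<noteq> 0"
    unfolding pcoeff_msub by (rule sum.not_neutral_contains_not_neutral)
  then have "lookup e 0 < Suc a" using assms by (simp add: xdeg_less_def)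
  moreover have "lookup m 0 = lookup e 0 * n"
    using e(1) lookup_combine_inj[of "\<lambda>i. i" 0 e n] by auto
  ultimately show "lookup m 0 < Suc (a * n)" by (simp add: less_Suc_eq_le)
qed

abbreviation shift :: "nat pseries \<Rightarrow> nat pseries" where
  "shift \<equiv> msub UNIV (\<lambda>i. single (Suc i) 1)"

lemma admissible_shift: "admissible UNIV (\<lambda>i. single (Suc i) 1)"
  using admissible_single[of Suc 1] by simp

lemma lookup_shift_0: "lookup (combine (\<lambda>i. single (Suc i) 1) e) 0 = 0"
  by (rule lookup_combine_notin) auto

lemma lookup_shift_Suc: "lookup (combine (\<lambda>i. single (Suc i) 1) e) (Suc n) = lookup e n"
  by (subst lookup_combine_inj) auto

lemma xdeg_less_shift: "xdeg_less (Suc 0) (shift F)"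
  unfolding xdeg_less_def
proof (intro allI impI)
  fix m assume "pcoeff (shift F) m \<noteq> 0"
  then obtain e where "e \<in> fibre UNIV (\<lambda>i. single (Suc i) 1) m"
    unfolding pcoeff_msub by (rule sum.not_neutral_contains_not_neutral)
  then show "lookup m 0 < Suc 0" using lookup_shift_0[of e] by auto
qed

lemma Psi_shift: "n > 0 \<Longrightarrow> Psi n (shift F) = shift (Psi n F)"
proof -
  assume n: "n > 0"
  have "combine (\<lambda>i. single i n) (single (Suc j) 1) = single (Suc j) n"
    "combine (\<lambda>i. single (Suc i) (1::nat)) (single j n) = single (Suc j) n" for j :: nat
    using combine_single_single[of "\<lambda>i. i" n "Suc j" 1] combine_single_single[of Suc 1 j n] by auto
  then show ?thesis
    using n by (simp add: msub_msub admissible_Psi admissible_shift[unfolded One_nat_def])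
qed

text \<open>
If \<open>F\<close> has top coefficient \<open>C(x\<^sub>1, x\<^sub>2, \<dots>)\<close> as a polynomial in \<open>x\<^sub>0\<close>, the leading monomial of \<open>F\<close> is
found recursively from that of \<open>C\<close>.
\<close>

lemma lead_add_lower:
  assumes C: "lead C m" and G: "xdeg_less n G"
  shows "lead (ind {single 0 n} * shift C + G) (single 0 n + combine (\<lambda>i. single (Suc i) 1) m)"
proof -
  let ?m = "single 0 n + combine (\<lambda>i. single (Suc i) 1) m"
  have "strict_mono Suc" by (simp add: strict_mono_def)
  then have L: "lead (ind {single 0 n} * shift C) ?m"
    by (intro lead_mult lead_ind lead_msub C) simp_all
  have m0: "lookup ?m 0 = n" using lookup_shift_0[of m] by (simp add: lookup_add)
  have lower: "m' < ?m" if "pcoeff G m' \<noteq> 0" for m'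
    unfolding less_monomial_iff by (rule exI[of _ 0]) (use G that m0 in \<open>auto simp: xdeg_less_def\<close>)
  have "pcoeff G ?m = 0" using lower[of ?m] by blast
  moreover have "m' \<le> ?m" if "pcoeff (ind {single 0 n} * shift C + G) m' \<noteq> 0" for m'
    using that lower[of m'] L by (cases "pcoeff G m' = 0") (auto simp: lead_def)
  ultimately show ?thesis using L by (auto simp: lead_def)
qed

text \<open>
Split the sum of all variables as \<open>x\<^sub>0 + r\<close>.  In \<open>((x\<^sub>0 + r)\<^sup>p - x\<^sub>0\<^sup>p - \<psi> r) / p\<close> the power \<open>x\<^sub>0\<^sup>p\<close> cancels,
and the next power of \<open>x\<^sub>0\<close> has coefficient \<open>r\<close>.
\<close>

lemma delta_power_1_expansion:
  assumes p: "prime p"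
  shows "\<exists>G. xdeg_less (p - 1) G \<and>
    plethysm_power (delta p) 1 = ind {single 0 (p - 1)} * shift (power_sum 1) + G"
proof -
  let ?X = "ind {single (0::nat) 1} :: nat pseries"
  define r where "r = shift (power_sum 1)"
  let ?g = "plethysm_power (delta p) 1"
  let ?c = "\<lambda>k. of_nat ((p choose k) div p) * ?X ^ k * r ^ (p - k)"
  have p2: "p \<ge> 2" using p prime_ge_2_nat by blast
  then have p0: "p > 0" by simp
  have r: "r = ind (range (\<lambda>i. single (Suc i) 1))"
    unfolding r_def using subst_single_power_sum[of Suc 1 1] subst_nat[OF admissible_shift symmetric_power_sum[of 1]]
    by simp
  have "range (\<lambda>i. single i 1) = {single 0 1} \<union> range (\<lambda>i. single (Suc i) (1::nat))"
    by (auto simp: image_iff) (metis not0_implies_Suc)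
  then have split: "power_sum 1 = ?X + r"
    unfolding power_sum_eq_ind[of 1] r
    by (simp only:) (rule ind_disjoint_Un, auto simp: single_eq_iff)
  have X: "Psi p ?X = ?X ^ p"
    by (simp only: Psi_ind_single[OF p0] ind_single_power[OF p0] mult_1)
  have g: "of_nat p * ?g + Psi p (power_sum 1) = power_sum 1 ^ p"
    using delta_power_Suc[OF p, of 0] by simp
  have "of_nat p * shift ?g + Psi p r = shift (of_nat p * ?g + Psi p (power_sum 1))"
    by (simp only: msub_add msub_of_nat_mult Psi_shift[OF p0] r_def)
  also have "\<dots> = r ^ p"
    unfolding g r_def by (rule msub_power[OF admissible_shift])
  finally have "of_nat p * shift ?g + Psi p r = r ^ p" .
  moreover have "of_nat p * ?g + Psi p (?X + r) = ?X ^ p + r ^ p + of_nat p * (\<Sum>k\<in>{0<..<p}. ?c k)"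
    using g unfolding split freshman[OF p] .
  moreover have "b = a + c" if "a + r = q" "b + (x + r) = x + q + c" for a b c x r q :: "nat pseries"
  proof -
    from that(2) have "b = x + q + c - (x + r)" by (metis add_diff_cancel_right')
    then show ?thesis unfolding that(1)[symmetric] by simp
  qed
  ultimately have "of_nat p * ?g = of_nat p * (shift ?g + (\<Sum>k\<in>{0<..<p}. ?c k))"
    unfolding msub_add X distrib_left by blast
  then have g_eq: "?g = shift ?g + (\<Sum>k\<in>{0<..<p}. ?c k)"
    using p0 by (rule of_nat_mult_left_cancel_pseries)
  have "{0<..<p} = insert (p - 1) {0<..<p - 1}" using p2 by auto
  then have "(\<Sum>k\<in>{0<..<p}. ?c k) = ?c (p - 1) + (\<Sum>k\<in>{0<..<p - 1}. ?c k)" by simp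
  moreover have "?c (p - 1) = ind {single 0 (p - 1)} * r"
  proof -
    have "p choose (p - 1) = p" using binomial_symmetric[of 1 p] p2 by simp
    then show ?thesis using p2 ind_single_power[of "p - 1" "0::nat"] by simp
  qed
  ultimately have "?g = ind {single 0 (p - 1)} * r + (shift ?g + (\<Sum>k\<in>{0<..<p - 1}. ?c k))"
    using g_eq by (simp add: algebra_simps)
  moreover have "xdeg_less (p - 1) (shift ?g + (\<Sum>k\<in>{0<..<p - 1}. ?c k))"
  proof (intro xdeg_less_add xdeg_less_sum)
    show "xdeg_less (p - 1) (shift ?g)" using p2 by (intro xdeg_less_mono[OF xdeg_less_shift]) auto
    fix k assume k: "k \<in> {0<..<p - 1}"
    have "xdeg_less (Suc 1) ?X"
      by (auto simp: xdeg_less_def pcoeff_ind split: if_splits)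
    from xdeg_less_mult[OF xdeg_less_power[OF this] xdeg_less_power[OF xdeg_less_shift], of _ _ "power_sum 1", folded r_def]
    have "xdeg_less (Suc k) (?X ^ k * r ^ (p - k))" by simp
    then have "xdeg_less (p - 1) (?X ^ k * r ^ (p - k))" by (rule xdeg_less_mono) (use k in auto)
    then show "xdeg_less (p - 1) (?c k)"
      unfolding mult.assoc by (rule xdeg_less_of_nat_mult)
  qed
  ultimately show ?thesis unfolding r_def by blast
qed

text \<open>
If \<open>g = x\<^sub>0\<^sup>N h + G\<close> with \<open>h\<close> free of \<open>x\<^sub>0\<close> and \<open>G\<close> of lower degree in \<open>x\<^sub>0\<close>, then
\<open>(g\<^sup>p - \<psi> g) / p = x\<^sub>0\<^sup>N\<^sup>p (h\<^sup>p - \<psi> h) / p + \<dots>\<close>.  So for \<open>N > 0\<close> the top coefficient in \<open>x\<^sub>0\<close> undergoes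
the same operation, and it stays one iteration behind.
\<close>

lemma delta_power_expansion:
  assumes p: "prime p"
  shows "\<exists>G. xdeg_less (p ^ i * (p - 1)) G \<and>
    plethysm_power (delta p) (Suc i)
      = ind {single 0 (p ^ i * (p - 1))} * shift (plethysm_power (delta p) i) + G"
proof (induction i)
  case 0
  then show ?case using delta_power_1_expansion[OF p] by simp
next
  case (Suc i)
  let ?g = "plethysm_power (delta p)"
  have p2: "p \<ge> 2" using p prime_ge_2_nat by blast
  then have p0: "p > 0" by simp
  have "p ^ i * (p - 1) > 0" using p2 by simp
  then obtain n where n: "p ^ i * (p - 1) = Suc n" using gr0_implies_Suc by blast
  obtain G where G: "xdeg_less (Suc n) G" "?g (Suc i) = ind {single 0 (Suc n)} * shift (?g i) + G"
    using Suc unfolding n by blast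
  let ?A = "ind {single 0 (Suc n)} * shift (?g i)"
  let ?c = "\<lambda>k. of_nat ((p choose k) div p) * ?A ^ k * G ^ (p - k)"
  have Np: "p ^ Suc i * (p - 1) = Suc n * p" unfolding n[symmetric] by simp
  let ?N = "Suc n * p"
  have Xp: "ind {single (0::nat) (Suc n)} ^ p = ind {single 0 ?N}"
    using ind_single_power[of "Suc n" "0::nat"] ind_single_power[of ?N "0::nat"] p0
    by (simp only: power_mult) simp
  have "Psi p ?A = ind {single 0 ?N} * shift (Psi p (?g i))"
    by (simp only: Psi_ind_single[OF p0] msub_mult[OF admissible_Psi[OF p0]] Psi_shift[OF p0])
  moreover have "?A ^ p = ind {single 0 ?N} * shift (?g i ^ p)"
    by (simp only: power_mult_distrib Xp msub_power[OF admissible_shift])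
  ultimately have A: "?A ^ p = of_nat p * (ind {single 0 ?N} * shift (?g (Suc i))) + Psi p ?A"
    unfolding delta_power_Suc[OF p, symmetric]
    by (simp only: msub_add msub_of_nat_mult distrib_left mult.left_commute)
  have "of_nat p * ?g (Suc (Suc i)) + Psi p (?A + G) = (?A + G) ^ p"
    using delta_power_Suc[OF p, of "Suc i"] unfolding G(2) .
  then have eq: "of_nat p * (?g (Suc (Suc i)) - ind {single 0 ?N} * shift (?g (Suc i)))
      = G ^ p - Psi p G + of_nat p * (\<Sum>k\<in>{0<..<p}. ?c k)"
    unfolding freshman[OF p] A msub_add by (simp add: algebra_simps)
  have "xdeg_less ?N (G ^ p - Psi p G + of_nat p * (\<Sum>k\<in>{0<..<p}. ?c k))"
  proof (intro xdeg_less_add xdeg_less_diff xdeg_less_of_nat_mult xdeg_less_sum)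
    show "xdeg_less ?N (G ^ p)"
      by (rule xdeg_less_mono[OF xdeg_less_power[OF G(1)]]) (use p0 in auto)
    show "xdeg_less ?N (Psi p G)"
      by (rule xdeg_less_mono[OF xdeg_less_Psi[OF G(1)]]) (use p0 in auto)
    fix k assume k: "k \<in> {0<..<p}"
    have "xdeg_less (Suc (Suc n)) (ind {single 0 (Suc n)})"
      by (auto simp: xdeg_less_def pcoeff_ind split: if_splits)
    from xdeg_less_mult[OF this xdeg_less_shift] have "xdeg_less (Suc (Suc n)) ?A" by simp
    from xdeg_less_mult[OF xdeg_less_power[OF this] xdeg_less_power[OF G(1)]]
    have "xdeg_less (Suc (Suc n * k + n * (p - k))) (?A ^ k * G ^ (p - k))" .
    moreover have "Suc (Suc n * k + n * (p - k)) \<le> ?N"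
    proof -
      have "p = k + (p - k)" using k by simp
      then have "?N = Suc n * k + n * (p - k) + (p - k)" by (metis add.assoc add.commute distrib_left mult_Suc)
      then show ?thesis using k by simp
    qed
    ultimately have "xdeg_less ?N (?A ^ k * G ^ (p - k))" by (rule xdeg_less_mono)
    then show "xdeg_less ?N (?c k)" unfolding mult.assoc by (rule xdeg_less_of_nat_mult)
  qed
  then have "xdeg_less ?N (?g (Suc (Suc i)) - ind {single 0 ?N} * shift (?g (Suc i)))"
    unfolding eq[symmetric] using p0 by (rule xdeg_less_of_nat_cancel)
  then show ?case unfolding Np by (intro exI[of _ "?g (Suc (Suc i)) - _"]) auto
qed

lemma lead_delta_power:
  assumes p: "prime p"
  shows "\<exists>m. lead (plethysm_power (delta p) i) m \<and> lookup m i = 1 \<and> (\<forall>n>i. lookup m n = 0)"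
proof (induction i)
  case 0
  have le: "single i (1::nat) \<le> single 0 1" for i :: nat
  proof (cases "i = 0")
    case False
    then have "single i (1::nat) < single 0 1"
      unfolding less_monomial_iff by (intro exI[of _ 0]) (auto simp: lookup_single)
    then show ?thesis by simp
  qed auto
  then have "lead (power_sum 1) (single 0 1)"
    by (auto simp: lead_def power_sum_def)
  then show ?case by (auto simp: lookup_single)
next
  case (Suc i)
  then obtain m where m: "lead (plethysm_power (delta p) i) m" "lookup m i = 1" "\<forall>n>i. lookup m n = 0"
    by blast
  obtain G where "xdeg_less (p ^ i * (p - 1)) G"
    and eq: "plethysm_power (delta p) (Suc i)
      = ind {single 0 (p ^ i * (p - 1))} * shift (plethysm_power (delta p) i) + G"
    using delta_power_expansion[OF p, of i] by blast
  from lead_add_lower[OF m(1) this(1)]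
  have "lead (plethysm_power (delta p) (Suc i))
      (single 0 (p ^ i * (p - 1)) + combine (\<lambda>i. single (Suc i) 1) m)"
    unfolding eq .
  moreover have "lookup (single 0 (p ^ i * (p - 1)) + combine (\<lambda>i. single (Suc i) 1) m) (Suc n) = lookup m n" for n
    using lookup_shift_Suc[of m n] by (simp add: lookup_add lookup_single)
  ultimately show ?case
    using m by (intro exI[of _ "single 0 (p ^ i * (p - 1)) + combine (\<lambda>i. single (Suc i) 1) m"])
      (auto simp only: Suc_less_eq2)
qed

lemma lead_d:
  assumes p: "prime p"
  shows "\<exists>m. lead (d p i j) m \<and> lookup m i = p ^ j \<and> (\<forall>n>i. lookup m n = 0)"
proof (induction j)
  case 0
  then show ?case using lead_delta_power[OF p, of i] by (simp add: d_eq[OF p])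
next
  case (Suc j)
  then obtain m where m: "lead (d p i j) m" "lookup m i = p ^ j" "\<forall>n>i. lookup m n = 0" by blast
  have "lead (d p i (Suc j)) (combine (\<lambda>i. single i p) m)"
    using lead_msub[of "\<lambda>i. i" p, OF _ _ m(1)] Psi_d[OF p, of i j] p_pos[OF p]
    by (simp add: strict_mono_def)
  moreover have "lookup (combine (\<lambda>i. single i p) m) n = lookup m n * p" for n
    using lookup_combine_inj[of "\<lambda>i. i" n m p] by simp
  ultimately show ?case using m by (intro exI[of _ "combine (\<lambda>i. single i p) m"]) auto
qed


section \<open>Reduced words\<close>

inductive_set generated :: "('k \<Rightarrow> nat \<Rightarrow> 'a::comm_semiring_1) \<Rightarrow> 'a set" for G where
  zero: "0 \<in> generated G"
| one: "1 \<in> generated G"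
| gen: "G k j \<in> generated G"
| add: "x \<in> generated G \<Longrightarrow> y \<in> generated G \<Longrightarrow> x + y \<in> generated G"
| mult: "x \<in> generated G \<Longrightarrow> y \<in> generated G \<Longrightarrow> x * y \<in> generated G"

text \<open>
The relations between generators \<open>s k j\<close>, where \<open>j\<close> counts the applications of the Frobenius substitution
and \<open>nxt\<close> passes from \<open>k\<close> to the index of the next application of \<open>delta\<close>.
\<close>

definition relations :: "nat \<Rightarrow> ('k \<Rightarrow> 'k) \<Rightarrow> ('k \<Rightarrow> nat \<Rightarrow> 'a::comm_semiring_1) \<Rightarrow> bool" where
  "relations p nxt s \<longleftrightarrow> (\<forall>k j. s k j ^ p = of_nat p * s (nxt k) j + s k (Suc j))"

text \<open>
Polynomials in the generators with natural number coefficients are multisets of words, and words are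
multisets of generators.
\<close>

definition word_value :: "('k \<Rightarrow> nat \<Rightarrow> 'a::comm_semiring_1) \<Rightarrow> ('k \<times> nat) multiset \<Rightarrow> 'a" where
  "word_value s M = prod_mset (image_mset (\<lambda>(k, j). s k j) M)"

definition poly_value ::
  "('k \<Rightarrow> nat \<Rightarrow> 'a::comm_semiring_1) \<Rightarrow> ('k \<times> nat) multiset multiset \<Rightarrow> 'a" where
  "poly_value s P = sum_mset (image_mset (word_value s) P)"

definition reduced :: "nat \<Rightarrow> ('k \<times> nat) multiset \<Rightarrow> bool" where
  "reduced p M \<longleftrightarrow> (\<forall>x. count M x < p)"

definition poly_times ::
  "('k \<times> nat) multiset multiset \<Rightarrow> ('k \<times> nat) multiset multiset \<Rightarrow> ('k \<times> nat) multiset multiset" where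
  "poly_times P Q = sum_mset (image_mset (\<lambda>A. image_mset ((+) A) Q) P)"

lemma word_value_simps [simp]:
  "word_value s {#} = 1"
  "word_value s (add_mset (k, j) M) = s k j * word_value s M"
  "word_value s (M + N) = word_value s M * word_value s N"
  by (simp_all add: word_value_def)

lemma word_value_replicate: "word_value s (replicate_mset n (k, j)) = s k j ^ n"
  by (induction n) simp_all

lemma poly_value_simps [simp]:
  "poly_value s {#} = 0"
  "poly_value s (add_mset M P) = word_value s M + poly_value s P"
  "poly_value s (P + Q) = poly_value s P + poly_value s Q"
  by (simp_all add: poly_value_def)

lemma poly_value_repeat: "poly_value s (repeat_mset n P) = of_nat n * poly_value s P"
  by (induction n) (simp_all add: distrib_right)

lemma poly_value_shift: "poly_value s (image_mset ((+) A) Q) = word_value s A * poly_value s Q"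
  by (induction Q) (simp_all add: distrib_left)

lemma poly_value_times: "poly_value s (poly_times P Q) = poly_value s P * poly_value s Q"
  by (induction P) (simp_all add: poly_times_def poly_value_shift distrib_right)

text \<open>
Replacing a \<open>p\<close>-th power by means of the relation makes words shorter.  The same reduction works for two
solutions at once; this is how the values of a second solution are compared with actual power series.
\<close>

lemma word_normal_form:
  assumes p: "p \<ge> 2" and s: "relations p nxt s" and s': "relations p nxt s'"
  shows "\<exists>P. (\<forall>M\<in>#P. reduced p M) \<and> word_value s M = poly_value s P \<and> word_value s' M = poly_value s' P"
proof (induction "size M" arbitrary: M rule: less_induct)
  case less
  show ?case
  proof (cases "reduced p M")
    case True
    then show ?thesis by (intro exI[of _ "{#M#}"]) simp
  next
    case False
    then obtain k j where "p \<le> count M (k, j)" by (auto simp: reduced_def not_less)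
    then have "replicate_mset p (k, j) \<subseteq># M" by (simp add: count_le_replicate_mset_subset_eq)
    then obtain N where M: "M = replicate_mset p (k, j) + N" by (auto simp: subset_mset.le_iff_add)
    have small: "size (add_mset x N) < size M" for x using p by (simp add: M)
    obtain P where P: "\<forall>M\<in>#P. reduced p M"
      "word_value s (add_mset (nxt k, j) N) = poly_value s P"
      "word_value s' (add_mset (nxt k, j) N) = poly_value s' P"
      using less[OF small] by blast
    obtain Q where Q: "\<forall>M\<in>#Q. reduced p M"
      "word_value s (add_mset (k, Suc j) N) = poly_value s Q"
      "word_value s' (add_mset (k, Suc j) N) = poly_value s' Q"
      using less[OF small] by blast
    have step: "word_value t M = of_nat p * word_value t (add_mset (nxt k, j) N)
        + word_value t (add_mset (k, Suc j) N)" if "relations p nxt t" for t :: "_ \<Rightarrow> _ \<Rightarrow> 'z::comm_semiring_1"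
      using that by (simp add: M word_value_replicate relations_def distrib_right mult.assoc)
    have "M' \<in># repeat_mset p P \<Longrightarrow> M' \<in># P" for M'
      by (metis count_greater_zero_iff count_repeat_mset mult_0_right not_gr_zero)
    then show ?thesis
      using P Q step[OF s] step[OF s']
      by (intro exI[of _ "repeat_mset p P + Q"]) (auto simp: poly_value_repeat)
  qed
qed

lemma poly_normal_form:
  assumes "p \<ge> 2" "relations p nxt s" "relations p nxt s'"
  shows "\<exists>Q. (\<forall>M\<in>#Q. reduced p M) \<and> poly_value s P = poly_value s Q \<and> poly_value s' P = poly_value s' Q"
proof (induction P)
  case empty
  then show ?case by (intro exI[of _ "{#}"]) simp
next
  case (add M P)
  then obtain Q where "\<forall>M\<in>#Q. reduced p M" "poly_value s P = poly_value s Q" "poly_value s' P = poly_value s' Q"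
    by blast
  moreover obtain Q' where "\<forall>M\<in>#Q'. reduced p M" "word_value s M = poly_value s Q'" "word_value s' M = poly_value s' Q'"
    using word_normal_form[OF assms, of M] by blast
  ultimately show ?case by (intro exI[of _ "Q' + Q"]) auto
qed

lemma digits_unique:
  fixes f g :: "nat \<Rightarrow> nat"
  assumes "(\<Sum>j<n. f j * p ^ j) = (\<Sum>j<n. g j * p ^ j)" "\<And>j. f j < p" "\<And>j. g j < p" "j < n"
  shows "f j = g j"
  using assms
proof (induction n arbitrary: f g j)
  case (Suc n)
  have split: "(\<Sum>j<Suc n. h j * p ^ j) = h 0 + p * (\<Sum>j<n. h (Suc j) * p ^ j)" for h :: "nat \<Rightarrow> nat"
    by (subst sum.lessThan_Suc_shift) (simp add: sum_distrib_left mult_ac)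
  have eq: "f 0 + p * (\<Sum>j<n. f (Suc j) * p ^ j) = g 0 + p * (\<Sum>j<n. g (Suc j) * p ^ j)"
    using Suc.prems(1) unfolding split .
  \<comment> \<open>The lowest digit is the residue modulo \<open>p\<close>.\<close>
  from arg_cong[OF eq, of "\<lambda>x. x mod p"] have f0: "f 0 = g 0" using Suc.prems(2,3) by simp
  have "p > 0" using Suc.prems(2)[of 0] by simp
  then have "(\<Sum>j<n. f (Suc j) * p ^ j) = (\<Sum>j<n. g (Suc j) * p ^ j)"
    using eq f0 by simp
  from Suc.IH[OF this] show ?case using f0 Suc.prems by (cases j) auto
qed simp


section \<open>Homomorphisms out of a semiring with independent reduced words\<close>

text \<open>
The leading monomials \<open>L k j\<close> are triangular in \<open>k\<close>.  At the largest index \<open>k\<close> that occurs in a word, only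
the generators \<open>gen k j\<close> contribute to the exponent, and they contribute the base \<open>p\<close> number whose
digits are their multiplicities.
\<close>

locale leading_generators =
  fixes p :: nat and nxt :: "'k::linorder \<Rightarrow> 'k" and gen :: "'k \<Rightarrow> nat \<Rightarrow> 'k pseries"
    and L :: "'k \<Rightarrow> nat \<Rightarrow> ('k \<Rightarrow>\<^sub>0 nat)"
  assumes p2: "p \<ge> 2" and relations_gen: "relations p nxt gen"
    and lead_gen: "lead (gen k j) (L k j)"
    and L_diag: "lookup (L k j) k = p ^ j" and L_above: "v > k \<Longrightarrow> lookup (L k j) v = 0"
begin

definition weight :: "('k \<times> nat) multiset \<Rightarrow> ('k \<Rightarrow>\<^sub>0 nat)" where
  "weight M = sum_mset (image_mset (\<lambda>(k, j). L k j) M)"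

lemma weight_simps [simp]:
  "weight {#} = 0" "weight (add_mset (k, j) M) = L k j + weight M" "weight (M + N) = weight M + weight N"
  by (simp_all add: weight_def)

lemma lead_word_value: "lead (word_value gen M) (weight M)"
proof (induction M)
  case empty
  then show ?case using lead_ind[of 0] by (simp add: ind_0)
next
  case (add x M)
  then show ?case by (cases x) (simp add: lead_mult lead_gen)
qed

lemma lookup_weight:
  assumes "\<And>x. x \<in># M \<Longrightarrow> fst x \<le> k \<and> snd x < n"
  shows "lookup (weight M) k = (\<Sum>j<n. count M (k, j) * p ^ j)"
  using assms
proof (induction M)
  case (add x M)
  obtain k' j' where x: "x = (k', j')" by fastforce
  have IH: "lookup (weight M) k = (\<Sum>j<n. count M (k, j) * p ^ j)" using add by auto
  show ?case
  proof (cases "k' = k")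
    case True
    have "(\<Sum>j<n. count (add_mset x M) (k, j) * p ^ j)
        = (\<Sum>j<n. count M (k, j) * p ^ j + (if j = j' then p ^ j else 0))"
      by (rule sum.cong) (auto simp: x True)
    then show ?thesis using True add.prems[of x] IH by (simp add: x lookup_add L_diag sum.distrib)
  next
    case False
    then have "k' < k" using add.prems[of x] by (auto simp: x)
    then show ?thesis using False IH by (simp add: x lookup_add L_above)
  qed
qed simp

text \<open>
After cancelling the common part of the two words, both have the same digits at the largest index that
occurs, although they share no letter there.
\<close>

lemma weight_inj:
  assumes M: "reduced p M" and N: "reduced p N" and eq: "weight M = weight N"
  shows "M = N"
proof (rule ccontr)
  assume ne: "M \<noteq> N"
  let ?P = "M - N" and ?Q = "N - M"
  have "M = ?P + (M \<inter># N)" "N = ?Q + (M \<inter># N)"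
    by (auto simp: multiset_eq_iff)
  with eq have "weight (?P + (M \<inter># N)) = weight (?Q + (M \<inter># N))" by simp
  then have eq': "weight ?P = weight ?Q" by simp
  define S where "S = set_mset (?P + ?Q)"
  have "S \<noteq> {}"
  proof
    assume "S = {}"
    then have "?P = {#}" "?Q = {#}" by (auto simp: S_def)
    then show False using ne by (metis Diff_eq_empty_iff_mset subset_mset.antisym)
  qed
  define k where "k = Max (fst ` S)"
  obtain n where n: "snd ` S \<subseteq> {..<n}"
    using finite_nat_set_iff_bounded[of "snd ` S"] by (auto simp: S_def)
  have le: "fst x \<le> k \<and> snd x < n" if "x \<in> S" for x
    using that n by (auto simp: k_def S_def intro!: Max_ge)
  have "(\<Sum>j<n. count ?P (k, j) * p ^ j) = (\<Sum>j<n. count ?Q (k, j) * p ^ j)"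
    using lookup_weight[of ?P k n] lookup_weight[of ?Q k n] le eq' by (simp add: S_def)
  moreover have "count ?P x < p" "count ?Q x < p" for x
    using M N unfolding reduced_def count_diff by (blast intro: less_imp_diff_less)+
  ultimately have same: "count ?P (k, j) = count ?Q (k, j)" if "j < n" for j
    using digits_unique[where n = n and p = p and j = j
        and f = "\<lambda>j. count ?P (k, j)" and g = "\<lambda>j. count ?Q (k, j)"] that by blast
  have "k \<in> fst ` S" unfolding k_def using \<open>S \<noteq> {}\<close> by (intro Max_in) (auto simp: S_def)
  then obtain j where j: "(k, j) \<in> S" by auto
  with le have "j < n" by fastforce
  from same[OF this] j show False by (auto simp: S_def simp flip: count_greater_zero_iff)
qed

lemma pcoeff_poly_value:
  assumes "finite A" "set_mset P \<subseteq> A"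
  shows "pcoeff (poly_value gen P) m = (\<Sum>M\<in>A. int (count P M) * pcoeff (word_value gen M) m)"
  using assms(2)
proof (induction P)
  case (add M P)
  have "(\<Sum>N\<in>A. int (count (add_mset M P) N) * pcoeff (word_value gen N) m)
      = (\<Sum>N\<in>A. (if N = M then pcoeff (word_value gen M) m else 0)
          + int (count P N) * pcoeff (word_value gen N) m)"
    by (rule sum.cong) (auto simp: distrib_right)
  then show ?case using add assms(1) by (simp add: sum.distrib)
qed simp

text \<open>
Among the words with different multiplicities in \<open>P\<close> and \<open>Q\<close>, the one with the largest leading monomial
contributes to the coefficient of that monomial in the difference, and no other does.
\<close>

lemma reduced_words_independent:
  assumes P: "\<forall>M\<in>#P. reduced p M" and Q: "\<forall>M\<in>#Q. reduced p M"
    and eq: "poly_value gen P = poly_value gen Q"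
  shows "P = Q"
proof (rule ccontr)
  assume "P \<noteq> Q"
  define A where "A = set_mset P \<union> set_mset Q"
  define S where "S = {M\<in>A. count P M \<noteq> count Q M}"
  have fin: "finite A" "finite S" by (auto simp: A_def S_def)
  have "S \<noteq> {}"
    using \<open>P \<noteq> Q\<close> by (auto simp: S_def A_def multiset_eq_iff not_in_iff) (metis count_inI)
  then obtain M where M: "M \<in> S" "weight M = Max (weight ` S)"
    using Max_in[of "weight ` S"] fin by fastforce
  let ?m = "weight M"
  have zero: "pcoeff (word_value gen N) ?m = 0" if "N \<in> S" "N \<noteq> M" for N
  proof -
    have "reduced p N" "reduced p M" using that M P Q by (auto simp: S_def A_def)
    then have "weight N \<noteq> ?m" using weight_inj that(2) by blast
    moreover have "weight N \<le> ?m" unfolding M(2) using that fin by (intro Max_ge) auto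
    ultimately show ?thesis using lead_word_value[of N] by (auto simp: lead_def)
  qed
  have "0 = pcoeff (poly_value gen P) ?m - pcoeff (poly_value gen Q) ?m" using eq by simp
  also have "\<dots> = (\<Sum>N\<in>A. (int (count P N) - int (count Q N)) * pcoeff (word_value gen N) ?m)"
    using fin by (simp add: pcoeff_poly_value[of A] A_def sum_subtractf left_diff_distrib)
  also have "\<dots> = (\<Sum>N\<in>{M}. (int (count P N) - int (count Q N)) * pcoeff (word_value gen N) ?m)"
    using fin M zero by (intro sum.mono_neutral_right) (auto simp: S_def)
  also have "\<dots> = int (count P M) - int (count Q M)"
    using lead_word_value[of M] by (simp add: lead_def)
  finally show False using M(1) by (simp add: S_def)
qed

lemma poly_value_determined:
  assumes "relations p nxt s" "poly_value gen P = poly_value gen Q"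
  shows "poly_value s P = poly_value s Q"
proof -
  obtain P' where P': "\<forall>M\<in>#P'. reduced p M" "poly_value gen P = poly_value gen P'" "poly_value s P = poly_value s P'"
    using poly_normal_form[OF p2 relations_gen assms(1)] by blast
  obtain Q' where Q': "\<forall>M\<in>#Q'. reduced p M" "poly_value gen Q = poly_value gen Q'" "poly_value s Q = poly_value s Q'"
    using poly_normal_form[OF p2 relations_gen assms(1)] by blast
  have "P' = Q'" using reduced_words_independent[OF P'(1) Q'(1)] P' Q' assms(2) by simp
  then show ?thesis using P' Q' by simp
qed

abbreviation R :: "'k pseries set" where
  "R \<equiv> generated gen"

lemma poly_value_surj: "F \<in> R \<Longrightarrow> \<exists>P. F = poly_value gen P"
proof (induction rule: generated.induct)
  case zero
  show ?case by (intro exI[of _ "{#}"]) simp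
next
  case one
  show ?case by (intro exI[of _ "{#{#}#}"]) simp
next
  case (gen k j)
  show ?case by (intro exI[of _ "{#{#(k, j)#}#}"]) simp
next
  case (add x y)
  then show ?case by (metis poly_value_simps(3))
next
  case (mult x y)
  then show ?case by (metis poly_value_times)
qed

text \<open>
The homomorphism that sends the generators to a solution \<open>s\<close> of the relations.
\<close>

definition evaluate :: "('k \<Rightarrow> nat \<Rightarrow> 'a::comm_semiring_1) \<Rightarrow> 'k pseries \<Rightarrow> 'a" where
  "evaluate s F = poly_value s (SOME P. F = poly_value gen P)"

context
  fixes s :: "'k \<Rightarrow> nat \<Rightarrow> 'a::comm_semiring_1"
  assumes s: "relations p nxt s"
begin

lemma evaluate_poly_value: "evaluate s (poly_value gen P) = poly_value s P"
  unfolding evaluate_def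
  by (rule poly_value_determined[OF s])
    (use someI[of "\<lambda>Q. poly_value gen P = poly_value gen Q" P] in simp)

lemma evaluate_0: "evaluate s 0 = 0"
  using evaluate_poly_value[of "{#}"] by simp

lemma evaluate_1: "evaluate s 1 = 1"
  using evaluate_poly_value[of "{#{#}#}"] by simp

lemma evaluate_gen: "evaluate s (gen k j) = s k j"
  using evaluate_poly_value[of "{#{#(k, j)#}#}"] by simp

lemma evaluate_add: "F \<in> R \<Longrightarrow> G \<in> R \<Longrightarrow> evaluate s (F + G) = evaluate s F + evaluate s G"
  using poly_value_surj[of F] poly_value_surj[of G]
  by (metis evaluate_poly_value poly_value_simps(3))

lemma evaluate_mult: "F \<in> R \<Longrightarrow> G \<in> R \<Longrightarrow> evaluate s (F * G) = evaluate s F * evaluate s G"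
  using poly_value_surj[of F] poly_value_surj[of G]
  by (metis evaluate_poly_value poly_value_times)

end

end


section \<open>The tensor square\<close>

text \<open>
With all \<open>Inl i\<close> below all \<open>Inr j\<close>, the leading monomials of the generators of the tensor square are
triangular: those of \<open>d\<^sub>i\<^sub>,\<^sub>j \<otimes> 1\<close> involve \<open>Inl\<close> variables only, and those of \<open>1 \<otimes> d\<^sub>i\<^sub>,\<^sub>j\<close> involve \<open>Inr\<close>
variables only.
\<close>

instantiation sum :: (linorder, linorder) linorder
begin

fun less_eq_sum :: "'a + 'b \<Rightarrow> 'a + 'b \<Rightarrow> bool" where
  "Inl a \<le> Inl b \<longleftrightarrow> a \<le> b"
| "Inl a \<le> Inr b \<longleftrightarrow> True"
| "Inr a \<le> Inl b \<longleftrightarrow> False"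
| "Inr a \<le> Inr b \<longleftrightarrow> a \<le> b"

definition less_sum :: "'a + 'b \<Rightarrow> 'a + 'b \<Rightarrow> bool" where
  "x < y \<longleftrightarrow> x \<le> y \<and> \<not> y \<le> (x :: 'a + 'b)"

instance
proof
  fix x y z :: "'a + 'b"
  show "x < y \<longleftrightarrow> x \<le> y \<and> \<not> y \<le> x" by (rule less_sum_def)
  show "x \<le> x" by (cases x) auto
  show "x \<le> y \<Longrightarrow> y \<le> z \<Longrightarrow> x \<le> z" by (cases x; cases y; cases z) auto
  show "x \<le> y \<Longrightarrow> y \<le> x \<Longrightarrow> x = y" by (cases x; cases y) auto
  show "x \<le> y \<or> y \<le> x" by (cases x; cases y) auto
qed

end

abbreviation left :: "nat pseries \<Rightarrow> (nat + nat) pseries" where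
  "left \<equiv> msub UNIV (\<lambda>i. single (Inl i) 1)"

abbreviation right :: "nat pseries \<Rightarrow> (nat + nat) pseries" where
  "right \<equiv> msub UNIV (\<lambda>i. single (Inr i) 1)"

lemma admissible_left: "admissible UNIV (\<lambda>i :: nat. single (Inl i :: nat + nat) 1)"
  and admissible_right: "admissible UNIV (\<lambda>i :: nat. single (Inr i :: nat + nat) 1)"
  by (rule admissible_single; simp)+

lemma Psi_left: "n > 0 \<Longrightarrow> Psi n (left f) = left (Psi n f)"
  and Psi_right: "n > 0 \<Longrightarrow> Psi n (right f) = right (Psi n f)"
proof -
  assume n: "n > 0"
  have eq: "combine (\<lambda>i. single i n) (single (\<beta> j) 1) = single (\<beta> j) n"
    "combine (\<lambda>i. single (\<beta> i) (1::nat)) (single j n) = single (\<beta> j) n" for j :: nat and \<beta> :: "nat \<Rightarrow> nat + nat"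
    using combine_single_single[of "\<lambda>i. i" n "\<beta> j" 1] combine_single_single[of \<beta> 1 j n] by auto
  show "Psi n (left f) = left (Psi n f)"
    by (simp only: msub_msub[OF admissible_Psi[OF n] admissible_left]
        msub_msub[OF admissible_left admissible_Psi[OF n]] eq subset_UNIV)
  show "Psi n (right f) = right (Psi n f)"
    by (simp only: msub_msub[OF admissible_Psi[OF n] admissible_right]
        msub_msub[OF admissible_right admissible_Psi[OF n]] eq subset_UNIV)
qed

definition pair :: "(nat \<Rightarrow> nat \<Rightarrow> 'a) \<Rightarrow> (nat \<Rightarrow> nat \<Rightarrow> 'a) \<Rightarrow> nat + nat \<Rightarrow> nat \<Rightarrow> 'a" where
  "pair a b k j = (case k of Inl i \<Rightarrow> a i j | Inr i \<Rightarrow> b i j)"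

lemma pair_simps [simp]: "pair a b (Inl i) j = a i j" "pair a b (Inr i) j = b i j"
  by (simp_all add: pair_def)

lemma relations_pair:
  "relations p Suc a \<Longrightarrow> relations p Suc b \<Longrightarrow> relations p (map_sum Suc Suc) (pair a b)"
  by (auto simp: relations_def pair_def split: sum.splits)

definition tgen :: "nat \<Rightarrow> nat + nat \<Rightarrow> nat \<Rightarrow> (nat + nat) pseries" where
  "tgen p = pair (\<lambda>i j. left (d p i j)) (\<lambda>i j. right (d p i j))"

definition tlead :: "nat \<Rightarrow> nat + nat \<Rightarrow> nat \<Rightarrow> ((nat + nat) \<Rightarrow>\<^sub>0 nat)" where
  "tlead p k j = (SOME m. lead (tgen p k j) m \<and> lookup m k = p ^ j \<and> (\<forall>v>k. lookup m v = 0))"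

lemma lead_embedded_d:
  fixes \<beta> :: "nat \<Rightarrow> nat + nat"
  assumes p: "prime p" and \<beta>: "strict_mono \<beta>"
  shows "\<exists>m. lead (msub UNIV (\<lambda>i. single (\<beta> i) 1) (d p i j)) m
    \<and> lookup m (\<beta> i) = p ^ j \<and> (\<forall>v>\<beta> i. lookup m v = 0)"
proof -
  obtain m where m: "lead (d p i j) m" "lookup m i = p ^ j" "\<forall>n>i. lookup m n = 0"
    using lead_d[OF p] by blast
  let ?m = "combine (\<lambda>i. single (\<beta> i) 1) m"
  have at: "lookup ?m (\<beta> n) = lookup m n" for n
    using strict_mono_imp_inj_on[OF \<beta>] by (subst lookup_combine_inj) (auto intro: inj_on_subset simp: inj_eq)
  have "lookup ?m v = 0" if "v > \<beta> i" for v
  proof (cases "v \<in> range \<beta>")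
    case True
    then show ?thesis using that m(3) at strict_mono_less[OF \<beta>] by auto
  qed (auto intro: lookup_combine_notin)
  then show ?thesis using lead_msub[OF \<beta> _ m(1), of 1] m(2) at by auto
qed

lemma tlead_exists:
  assumes p: "prime p"
  shows "\<exists>m. lead (tgen p k j) m \<and> lookup m k = p ^ j \<and> (\<forall>v>k. lookup m v = 0)"
proof -
  have "strict_mono (Inl :: nat \<Rightarrow> nat + nat)" "strict_mono (Inr :: nat \<Rightarrow> nat + nat)"
    by (auto simp: strict_mono_def less_sum_def)
  from this[THEN lead_embedded_d[OF p]] show ?thesis
    by (cases k) (simp_all only: tgen_def pair_simps)
qed

lemma relations_d: "prime p \<Longrightarrow> relations p Suc (d p)"
  by (auto simp: relations_def d_rel)

lemma relations_tgen:
  assumes p: "prime p"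
  shows "relations p (map_sum Suc Suc) (tgen p)"
  unfolding tgen_def
proof (rule relations_pair)
  show "relations p Suc (\<lambda>i j. left (d p i j))"
    unfolding relations_def
    by (simp only: msub_power[OF admissible_left, symmetric] d_rel[OF p] msub_add msub_of_nat_mult) simp
  show "relations p Suc (\<lambda>i j. right (d p i j))"
    unfolding relations_def
    by (simp only: msub_power[OF admissible_right, symmetric] d_rel[OF p] msub_add msub_of_nat_mult) simp
qed

lemma leading_generators_tgen:
  assumes p: "prime p"
  shows "leading_generators p (map_sum Suc Suc) (tgen p) (tlead p)"
proof
  fix k v :: "nat + nat" and j
  have *: "lead (tgen p k j) (tlead p k j) \<and> lookup (tlead p k j) k = p ^ j
      \<and> (\<forall>v>k. lookup (tlead p k j) v = 0)" for k
    unfolding tlead_def by (rule someI_ex[OF tlead_exists[OF p]])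
  show "2 \<le> p" using p by (rule prime_ge_2_nat)
  show "relations p (map_sum Suc Suc) (tgen p)" using p by (rule relations_tgen)
  show "lead (tgen p k j) (tlead p k j)" "lookup (tlead p k j) k = p ^ j"
    "k < v \<Longrightarrow> lookup (tlead p k j) v = 0"
    using *[of k] by auto
qed

abbreviation R2 :: "nat \<Rightarrow> (nat + nat) pseries set" where
  "R2 p \<equiv> generated (tgen p)"

text \<open>
The homomorphism \<open>f \<otimes> g \<mapsto> a f * b g\<close>, in terms of the values of \<open>a\<close> and \<open>b\<close> on the generators.
\<close>

definition eval2 ::
  "nat \<Rightarrow> (nat \<Rightarrow> nat \<Rightarrow> 'a::comm_semiring_1) \<Rightarrow> (nat \<Rightarrow> nat \<Rightarrow> 'a) \<Rightarrow> (nat + nat) pseries \<Rightarrow> 'a" where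
  "eval2 p a b = leading_generators.evaluate (tgen p) (pair a b)"

lemma generated_power: "x \<in> generated G \<Longrightarrow> x ^ n \<in> generated G"
  by (induction n) (auto intro: generated.one generated.mult)

lemma generated_of_nat_mult: "x \<in> generated G \<Longrightarrow> of_nat n * x \<in> generated G"
  by (induction n) (auto simp: distrib_right intro: generated.zero generated.add)

lemma generated_of_nat: "of_nat n \<in> generated G"
  using generated_of_nat_mult[OF generated.one, of n] by simp

lemma generated_sum: "(\<And>x. x \<in> A \<Longrightarrow> f x \<in> generated G) \<Longrightarrow> (\<Sum>x\<in>A. f x) \<in> generated G"
  by (induction A rule: infinite_finite_induct) (auto intro: generated.zero generated.add)

lemma left_d_in_R2: "left (d p i j) \<in> R2 p"
  using generated.gen[of "tgen p" "Inl i" j] by (simp add: tgen_def)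

lemma right_d_in_R2: "right (d p i j) \<in> R2 p"
  using generated.gen[of "tgen p" "Inr i" j] by (simp add: tgen_def)

context
  fixes p :: nat and a b :: "nat \<Rightarrow> nat \<Rightarrow> 'a::comm_semiring_1"
  assumes p: "prime p" and a: "relations p Suc a" and b: "relations p Suc b"
begin

interpretation leading_generators p "map_sum Suc Suc" "tgen p" "tlead p"
  using p by (rule leading_generators_tgen)

lemma eval2_0: "eval2 p a b 0 = 0"
  and eval2_1: "eval2 p a b 1 = 1"
  and eval2_add: "F \<in> R2 p \<Longrightarrow> G \<in> R2 p \<Longrightarrow> eval2 p a b (F + G) = eval2 p a b F + eval2 p a b G"
  and eval2_mult: "F \<in> R2 p \<Longrightarrow> G \<in> R2 p \<Longrightarrow> eval2 p a b (F * G) = eval2 p a b F * eval2 p a b G"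
  and eval2_tgen: "eval2 p a b (tgen p k j) = pair a b k j"
  unfolding eval2_def
  using evaluate_0 evaluate_1 evaluate_add evaluate_mult evaluate_gen relations_pair[OF a b] by auto

lemma eval2_left: "eval2 p a b (left (d p i j)) = a i j"
  using eval2_tgen[of "Inl i" j] by (simp add: tgen_def)

lemma eval2_right: "eval2 p a b (right (d p i j)) = b i j"
  using eval2_tgen[of "Inr i" j] by (simp add: tgen_def)

lemma eval2_power: "F \<in> R2 p \<Longrightarrow> eval2 p a b (F ^ n) = eval2 p a b F ^ n"
  by (induction n) (simp_all add: eval2_1 eval2_mult generated_power)

lemma eval2_of_nat_mult: "F \<in> R2 p \<Longrightarrow> eval2 p a b (of_nat n * F) = of_nat n * eval2 p a b F"
  by (induction n) (simp_all add: eval2_0 eval2_add generated_of_nat_mult distrib_right)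

lemma eval2_unique:
  assumes "F \<in> R2 p" "h 0 = 0" "h 1 = 1"
    "\<And>F G. F \<in> R2 p \<Longrightarrow> G \<in> R2 p \<Longrightarrow> h (F + G) = h F + h G"
    "\<And>F G. F \<in> R2 p \<Longrightarrow> G \<in> R2 p \<Longrightarrow> h (F * G) = h F * h G"
    "\<And>i j. h (left (d p i j)) = a i j" "\<And>i j. h (right (d p i j)) = b i j"
  shows "eval2 p a b F = h F"
  using assms(1)
proof (induction rule: generated.induct)
  case (gen k j)
  show ?case
    by (cases k) (auto simp: tgen_def eval2_left[unfolded One_nat_def] eval2_right[unfolded One_nat_def]
        assms(6,7)[unfolded One_nat_def])
qed (simp_all add: eval2_0 eval2_1 eval2_add eval2_mult assms)

end


section \<open>Witt vectors and their values on the generators\<close>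

lemma Lambda_p_symmetric: "prime p \<Longrightarrow> f \<in> Lambda_p p \<Longrightarrow> symmetric f"
  by (erule Lambda_p.induct)
    (auto intro: symmetric_0 symmetric_1 symmetric_d symmetric_add symmetric_mult)

lemma left_in_R2: "f \<in> Lambda_p p \<Longrightarrow> left f \<in> R2 p"
  by (induction rule: Lambda_p.induct)
    (simp_all only: msub_0 msub_1[OF admissible_left] msub_add msub_mult[OF admissible_left]
      left_d_in_R2 generated.intros)

lemma right_in_R2: "f \<in> Lambda_p p \<Longrightarrow> right f \<in> R2 p"
  by (induction rule: Lambda_p.induct)
    (simp_all only: msub_0 msub_1[OF admissible_right] msub_add msub_mult[OF admissible_right]
      right_d_in_R2 generated.intros)

lemma tensor_eq: "prime p \<Longrightarrow> f \<in> Lambda_p p \<Longrightarrow> g \<in> Lambda_p p \<Longrightarrow> tensor f g = left f * right g"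
  unfolding tensor_def
  by (simp only: subst_nat[OF admissible_left Lambda_p_symmetric] subst_nat[OF admissible_right Lambda_p_symmetric])

lemma W_iff:
  "a \<in> W p \<longleftrightarrow> a 0 = 0 \<and> a 1 = 1 \<and> (\<forall>f\<in>Lambda_p p. \<forall>g\<in>Lambda_p p. a (f + g) = a f + a g \<and> a (f * g) = a f * a g)
    \<and> a \<in> extensional (Lambda_p p)"
  by (auto simp: W_def semiring_hom_def ring_hom_def semiring_on_def)

lemma
  assumes "a \<in> W p"
  shows W_0: "a 0 = 0" and W_1: "a 1 = 1"
    and W_add: "f \<in> Lambda_p p \<Longrightarrow> g \<in> Lambda_p p \<Longrightarrow> a (f + g) = a f + a g"
    and W_mult: "f \<in> Lambda_p p \<Longrightarrow> g \<in> Lambda_p p \<Longrightarrow> a (f * g) = a f * a g"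
    and W_extensional: "a \<in> extensional (Lambda_p p)"
  using assms by (auto simp: W_iff)

lemma Lambda_p_power: "f \<in> Lambda_p p \<Longrightarrow> f ^ n \<in> Lambda_p p"
  by (induction n) (auto intro: Lambda_p.intros)

lemma Lambda_p_of_nat_mult: "f \<in> Lambda_p p \<Longrightarrow> of_nat n * f \<in> Lambda_p p"
  by (induction n) (auto simp: distrib_right intro: Lambda_p.intros)

lemma W_power: "a \<in> W p \<Longrightarrow> f \<in> Lambda_p p \<Longrightarrow> a (f ^ n) = a f ^ n"
  by (induction n) (auto simp: W_1 W_mult Lambda_p_power)

lemma W_of_nat_mult: "a \<in> W p \<Longrightarrow> f \<in> Lambda_p p \<Longrightarrow> a (of_nat n * f) = of_nat n * a f"
  by (induction n) (auto simp: W_0 W_add Lambda_p_of_nat_mult distrib_right)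

lemma W_eqI:
  assumes a: "a \<in> W p" and b: "b \<in> W p" and eq: "\<And>i j. a (d p i j) = b (d p i j)"
  shows "a = b"
proof (rule extensionalityI[OF W_extensional[OF a] W_extensional[OF b]])
  fix f assume "f \<in> Lambda_p p"
  then show "a f = b f"
    by (induction rule: Lambda_p.induct)
      (simp_all add: W_0[OF a] W_1[OF a] W_add[OF a] W_mult[OF a] W_0[OF b] W_1[OF b] W_add[OF b] W_mult[OF b] eq)
qed

definition coords :: "nat \<Rightarrow> (nat pseries \<Rightarrow> 'a) \<Rightarrow> nat \<Rightarrow> nat \<Rightarrow> 'a" where
  "coords p a i j = a (d p i j)"

lemma relations_coords:
  assumes p: "prime p" and a: "a \<in> W p"
  shows "relations p Suc (coords p a)"
  unfolding relations_def coords_def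
proof (intro allI)
  fix i j
  have "a (d p i j ^ p) = a (of_nat p * d p (Suc i) j + d p i (Suc j))" by (simp only: d_rel[OF p])
  then show "a (d p i j) ^ p = of_nat p * a (d p (Suc i) j) + a (d p i (Suc j))"
    by (simp add: W_power[OF a] W_add[OF a] W_of_nat_mult[OF a] Lambda_p.gen Lambda_p_of_nat_mult)
qed

text \<open>
The semiring of the \<open>d\<^sub>i\<^sub>,\<^sub>j\<close> embeds in its tensor square as the left factor, so that the homomorphisms
constructed there can be restricted to it.
\<close>

lemma witt_vector_exists:
  assumes p: "prime p" and s: "relations p Suc s"
  shows "\<exists>a\<in>W p. \<forall>i j. a (d p i j) = s i j"
proof (intro bexI allI)
  let ?a = "\<lambda>f\<in>Lambda_p p. eval2 p s s (left f)"
  show "?a (d p i j) = s i j" for i j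
    using eval2_left[OF p s s, of i j] by (simp add: Lambda_p.gen)
  have "?a (f + g) = ?a f + ?a g \<and> ?a (f * g) = ?a f * ?a g" if "f \<in> Lambda_p p" "g \<in> Lambda_p p" for f g
    using that left_in_R2[of f p] left_in_R2[of g p]
    by (simp only: restrict_apply' Lambda_p.add Lambda_p.mult msub_add msub_mult[OF admissible_left]
        eval2_add[OF p s s] eval2_mult[OF p s s])
  moreover have "?a 0 = 0" "?a 1 = 1"
    by (simp_all only: restrict_apply' Lambda_p.zero Lambda_p.one msub_0 msub_1[OF admissible_left]
        eval2_0[OF p s s] eval2_1[OF p s s])
  ultimately show "?a \<in> W p" unfolding W_iff by auto
qed

context
  fixes p :: nat and a b :: "nat pseries \<Rightarrow> 'a::comm_semiring_1"
  assumes p: "prime p" and a: "a \<in> W p" and b: "b \<in> W p"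
begin

abbreviation "conv \<equiv> eval2 p (coords p a) (coords p b)"

lemmas ca = relations_coords[OF p a] and cb = relations_coords[OF p b]

lemma eval2_left_Lambda: "f \<in> Lambda_p p \<Longrightarrow> conv (left f) = a f"
proof (induction rule: Lambda_p.induct)
  case (gen i j)
  show ?case by (subst eval2_left[OF p ca cb]) (rule coords_def)
qed (simp_all only: msub_0 msub_1[OF admissible_left] msub_add msub_mult[OF admissible_left] left_in_R2
    eval2_0[OF p ca cb] eval2_1[OF p ca cb] eval2_add[OF p ca cb] eval2_mult[OF p ca cb]
    W_0[OF a] W_1[OF a] W_add[OF a] W_mult[OF a])

lemma eval2_right_Lambda: "f \<in> Lambda_p p \<Longrightarrow> conv (right f) = b f"
proof (induction rule: Lambda_p.induct)
  case (gen i j)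
  show ?case by (subst eval2_right[OF p ca cb]) (rule coords_def)
qed (simp_all only: msub_0 msub_1[OF admissible_right] msub_add msub_mult[OF admissible_right] right_in_R2
    eval2_0[OF p ca cb] eval2_1[OF p ca cb] eval2_add[OF p ca cb] eval2_mult[OF p ca cb]
    W_0[OF b] W_1[OF b] W_add[OF b] W_mult[OF b])

lemma tensor_sum_in_R2:
  assumes "set fgs \<subseteq> Lambda_p p \<times> Lambda_p p"
  shows "(\<Sum>(f, g)\<leftarrow>fgs. tensor f g) \<in> R2 p \<and> conv (\<Sum>(f, g)\<leftarrow>fgs. tensor f g) = (\<Sum>(f, g)\<leftarrow>fgs. a f * b g)"
  using assms
proof (induction fgs)
  case (Cons x fgs)
  obtain f g where x: "x = (f, g)" "f \<in> Lambda_p p" "g \<in> Lambda_p p" using Cons.prems by auto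
  have "tensor f g \<in> R2 p" "conv (tensor f g) = a f * b g"
    using x tensor_eq[OF p x(2,3)] left_in_R2[OF x(2)] right_in_R2[OF x(3)]
    by (simp_all only: generated.mult eval2_mult[OF p ca cb] eval2_left_Lambda eval2_right_Lambda)
  then show ?case
    using Cons x by (auto simp: eval2_add[OF p ca cb] intro: generated.add)
qed (simp add: generated.zero eval2_0[OF p ca cb])

lemma tensor_representation:
  assumes "F \<in> R2 p"
  shows "\<exists>fgs. set fgs \<subseteq> Lambda_p p \<times> Lambda_p p \<and> F = (\<Sum>(f, g)\<leftarrow>fgs. tensor f g)"
  using assms
proof (induction rule: generated.induct)
  case zero
  show ?case by (intro exI[of _ "[]"]) simp
next
  case one
  show ?case
    using tensor_eq[OF p Lambda_p.one Lambda_p.one]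
    by (intro exI[of _ "[(1, 1)]"])
      (simp add: Lambda_p.one msub_1[OF admissible_left, unfolded One_nat_def] msub_1[OF admissible_right, unfolded One_nat_def])
next
  case (gen k j)
  show ?case
  proof (cases k)
    case (Inl i)
    show ?thesis
      using tensor_eq[OF p Lambda_p.gen Lambda_p.one, of i j] Inl
      by (intro exI[of _ "[(d p i j, 1)]"])
        (simp add: tgen_def Lambda_p.one Lambda_p.gen msub_1[OF admissible_right, unfolded One_nat_def])
  next
    case (Inr i)
    show ?thesis
      using tensor_eq[OF p Lambda_p.one Lambda_p.gen, of i j] Inr
      by (intro exI[of _ "[(1, d p i j)]"])
        (simp add: tgen_def Lambda_p.one Lambda_p.gen msub_1[OF admissible_left, unfolded One_nat_def])
  qed
next
  case (add x y)
  then obtain fs gs where "set fs \<subseteq> Lambda_p p \<times> Lambda_p p" "x = (\<Sum>(f, g)\<leftarrow>fs. tensor f g)"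
    "set gs \<subseteq> Lambda_p p \<times> Lambda_p p" "y = (\<Sum>(f, g)\<leftarrow>gs. tensor f g)" by blast
  then show ?case by (intro exI[of _ "fs @ gs"]) auto
next
  case (mult x y)
  then obtain fs gs where fs: "set fs \<subseteq> Lambda_p p \<times> Lambda_p p" "x = (\<Sum>(f, g)\<leftarrow>fs. tensor f g)"
    and gs: "set gs \<subseteq> Lambda_p p \<times> Lambda_p p" "y = (\<Sum>(f, g)\<leftarrow>gs. tensor f g)" by blast
  have tensor_mult: "tensor f g * tensor f' g' = tensor (f * f') (g * g')"
    if "f \<in> Lambda_p p" "g \<in> Lambda_p p" "f' \<in> Lambda_p p" "g' \<in> Lambda_p p" for f g f' g'
    using that by (simp only: tensor_eq[OF p] Lambda_p.mult msub_mult[OF admissible_left]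
        msub_mult[OF admissible_right] mult_ac)
  have one: "\<exists>hs. set hs \<subseteq> Lambda_p p \<times> Lambda_p p \<and> tensor f g * y = (\<Sum>(f, g)\<leftarrow>hs. tensor f g)"
    if "f \<in> Lambda_p p" "g \<in> Lambda_p p" for f g
  proof (intro exI conjI)
    let ?hs = "map (\<lambda>(f', g'). (f * f', g * g')) gs"
    show "set ?hs \<subseteq> Lambda_p p \<times> Lambda_p p" using that gs(1) by (auto intro: Lambda_p.mult)
    show "tensor f g * y = (\<Sum>(f, g)\<leftarrow>?hs. tensor f g)"
      unfolding gs(2) using gs(1) that
      by (induction gs) (auto simp: distrib_left tensor_mult)
  qed
  show ?case
    unfolding fs(2) using fs(1)
  proof (induction fs)
    case Nil
    show ?case by (intro exI[of _ "[]"]) simp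
  next
    case (Cons z fs)
    obtain f g where z: "z = (f, g)" "f \<in> Lambda_p p" "g \<in> Lambda_p p" using Cons.prems by auto
    obtain hs where "set hs \<subseteq> Lambda_p p \<times> Lambda_p p" "(\<Sum>(f, g)\<leftarrow>fs. tensor f g) * y = (\<Sum>(f, g)\<leftarrow>hs. tensor f g)"
      using Cons by auto
    moreover obtain hs' where "set hs' \<subseteq> Lambda_p p \<times> Lambda_p p" "tensor f g * y = (\<Sum>(f, g)\<leftarrow>hs'. tensor f g)"
      using one z by blast
    ultimately show ?case by (intro exI[of _ "hs' @ hs"]) (auto simp: z distrib_right)
  qed
qed

text \<open>
The value does not depend on the representation of \<open>F\<close> as a sum of tensors, because on each of them it is
the value of one homomorphism at \<open>F\<close>.
\<close>

lemma tensor_eval_eq: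
  assumes "F \<in> R2 p"
  shows "tensor_eval p a b F = conv F"
  unfolding tensor_eval_def
proof (rule the_equality)
  obtain fgs where "set fgs \<subseteq> Lambda_p p \<times> Lambda_p p" "F = (\<Sum>(f, g)\<leftarrow>fgs. tensor f g)"
    using tensor_representation[OF assms] by blast
  then show "\<exists>fgs. set fgs \<subseteq> Lambda_p p \<times> Lambda_p p \<and> F = (\<Sum>(f, g)\<leftarrow>fgs. tensor f g)
      \<and> conv F = (\<Sum>(f, g)\<leftarrow>fgs. a f * b g)"
    using tensor_sum_in_R2 by blast
  fix c
  assume "\<exists>fgs. set fgs \<subseteq> Lambda_p p \<times> Lambda_p p \<and> F = (\<Sum>(f, g)\<leftarrow>fgs. tensor f g)
      \<and> c = (\<Sum>(f, g)\<leftarrow>fgs. a f * b g)"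
  then show "c = conv F" using tensor_sum_in_R2 by auto
qed

end


section \<open>The delta operation on the tensor square\<close>

text \<open>
The relation \<open>G = (F\<^sup>p - \<psi> F) / p\<close>, stated without division.
\<close>

definition delta_of :: "nat \<Rightarrow> 'v pseries \<Rightarrow> 'v pseries \<Rightarrow> bool" where
  "delta_of p F G \<longleftrightarrow> of_nat p * G + Psi p F = F ^ p"

lemma delta_of_unique:
  assumes "p > 0" "delta_of p F G" "delta_of p F G'"
  shows "G = G'"
proof -
  have "of_nat p * G = of_nat p * G'"
    using assms(2,3) unfolding delta_of_def by (metis add_right_cancel)
  then show ?thesis using assms(1) by (rule of_nat_mult_left_cancel_pseries)
qed

lemma delta_of_0: "p > 0 \<Longrightarrow> delta_of p 0 0"
  by (simp add: delta_of_def zero_power)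

lemma delta_of_1: "p > 0 \<Longrightarrow> delta_of p 1 0"
  by (simp add: delta_of_def msub_1 admissible_Psi)

lemma delta_of_add:
  assumes p: "prime p" and "delta_of p F G" "delta_of p F' G'"
  shows "delta_of p (F + F')
    (G + G' + (\<Sum>k\<in>{0<..<p}. of_nat ((p choose k) div p) * F ^ k * F' ^ (p - k)))"
  unfolding delta_of_def freshman[OF p] assms(2,3)[unfolded delta_of_def, symmetric] msub_add distrib_left
  by (simp only: ac_simps)

text \<open>
This form of the product rule of a delta ring is free of signs, unlike the symmetric form
\<open>\<delta>(F F') = F\<^sup>p \<delta> F' + F'\<^sup>p \<delta> F - p \<delta> F \<delta> F'\<close>.  It shows that the
tensor square of the semiring, not only that of the ring, is closed under \<open>\<delta>\<close>.
\<close>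

lemma delta_of_mult:
  assumes p: "prime p" and F: "delta_of p F G" and F': "delta_of p F' G'"
  shows "delta_of p (F * F') (F ^ p * G' + G * Psi p F')"
proof -
  have "(F * F') ^ p = F ^ p * (of_nat p * G' + Psi p F')"
    using F' by (simp add: delta_of_def power_mult_distrib)
  also have "\<dots> = of_nat p * (F ^ p * G') + (of_nat p * G + Psi p F) * Psi p F'"
    using F by (simp only: delta_of_def distrib_left mult.left_commute)
  also have "\<dots> = of_nat p * (F ^ p * G' + G * Psi p F') + Psi p (F * F')"
    by (simp only: msub_mult[OF admissible_Psi[OF p_pos[OF p]]] distrib_left distrib_right mult.assoc add.assoc)
  finally show ?thesis by (simp only: delta_of_def)
qed

lemma Psi_tgen: "prime p \<Longrightarrow> Psi p (tgen p k j) = tgen p k (Suc j)"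
  unfolding tgen_def
  by (cases k) (simp_all only: pair_simps Psi_left[OF p_pos] Psi_right[OF p_pos] Psi_d)

lemma delta_of_tgen: "prime p \<Longrightarrow> delta_of p (tgen p k j) (tgen p (map_sum Suc Suc k) j)"
  using relations_tgen[of p] by (simp add: delta_of_def Psi_tgen relations_def)

lemma Psi_in_R2:
  assumes p: "prime p" and "F \<in> R2 p"
  shows "Psi p F \<in> R2 p"
  using assms(2)
proof (induction rule: generated.induct)
  case (gen k j)
  show ?case by (simp add: Psi_tgen[OF p] generated.gen)
qed (simp_all add: msub_1 msub_add msub_mult admissible_Psi p_pos[OF p] generated.intros)

lemma R2_delta:
  assumes p: "prime p" and "F \<in> R2 p"
  shows "\<exists>G\<in>R2 p. delta_of p F G"
  using assms(2)
proof (induction rule: generated.induct)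
  case zero
  show ?case using delta_of_0[OF p_pos[OF p]] generated.zero by blast
next
  case one
  show ?case using delta_of_1[OF p_pos[OF p]] generated.zero by blast
next
  case (gen k j)
  show ?case
    by (rule bexI, rule delta_of_tgen[OF p], rule generated.gen)
next
  case (add x y)
  from add.IH(1) obtain x' where x': "x' \<in> R2 p" "delta_of p x x'" ..
  from add.IH(2) obtain y' where y': "y' \<in> R2 p" "delta_of p y y'" ..
  have terms: "of_nat c * x ^ k * y ^ l \<in> R2 p" for c k l
    by (rule generated.mult[OF generated.mult[OF generated_of_nat generated_power[OF add.hyps(1)]]
          generated_power[OF add.hyps(2)]])
  show ?case
    by (rule bexI, rule delta_of_add[OF p x'(2) y'(2)])
      (intro generated.add x'(1) y'(1) generated_sum terms)
next
  case (mult x y)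
  from mult.IH(1) obtain x' where x': "x' \<in> R2 p" "delta_of p x x'" ..
  from mult.IH(2) obtain y' where y': "y' \<in> R2 p" "delta_of p y y'" ..
  show ?case
    by (rule bexI, rule delta_of_mult[OF p x'(2) y'(2)])
      (intro generated.add generated.mult generated_power mult.hyps x'(1) y'(1) Psi_in_R2[OF p])
qed

text \<open>
In the torsion free ring of series a solution of the relations is determined by its row \<open>i = 0\<close>, whose
entries are power sums for the generators, and sums or products of two power sums for their images.
\<close>

lemma relations_unique:
  fixes X Y :: "nat \<Rightarrow> nat \<Rightarrow> 'v pseries"
  assumes "p > 0" "relations p Suc X" "relations p Suc Y" "\<And>j. X 0 j = Y 0 j"
  shows "X i j = Y i j"
proof (induction i arbitrary: j)
  case (Suc i)
  have "of_nat p * X (Suc i) j + X i (Suc j) = of_nat p * Y (Suc i) j + Y i (Suc j)"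
    using assms(2,3) Suc[of j] unfolding relations_def by metis
  then have "of_nat p * X (Suc i) j = of_nat p * Y (Suc i) j" by (simp only: Suc add_right_cancel)
  then show ?case using assms(1) by (rule of_nat_mult_left_cancel_pseries)
qed (rule assms(4))


section \<open>The coproducts of the generators\<close>

lemma Delta_plus_admissible: "admissible (UNIV :: (nat + nat) set) (\<lambda>v. single v 1)"
  using admissible_single[of "\<lambda>v. v" 1] by simp

lemma Delta_times_admissible: "admissible UNIV (\<lambda>(i :: nat, j :: nat). single (Inl i) 1 + single (Inr j) 1)"
proof (rule admissibleI)
  have "single (Inl i) 1 \<noteq> (0 :: (nat + nat) \<Rightarrow>\<^sub>0 nat)" for i :: nat
    using lookup_single_eq[of "Inl i :: nat + nat" "1 :: nat"] by (metis lookup_zero zero_neq_one)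
  then show "(case x of (i, j) \<Rightarrow> single (Inl i) 1 + single (Inr j) 1) \<noteq> (0 :: (nat + nat) \<Rightarrow>\<^sub>0 nat)" for x :: "nat \<times> nat"
    by (cases x) (simp only: prod.case add_eq_0_monomial simp_thms)
  fix m :: "(nat + nat) \<Rightarrow>\<^sub>0 nat"
  have "{x \<in> UNIV. \<exists>v. (case x of (i, j) \<Rightarrow> single (Inl i) 1 + single (Inr j) 1) + v = m}
      \<subseteq> Inl -` keys m \<times> Inr -` keys m"
    by (auto simp: in_keys_iff lookup_add)
  moreover have "finite (Inl -` keys m \<times> Inr -` keys m)"
    by (intro finite_cartesian_product finite_vimageI) auto
  ultimately show "finite {x \<in> UNIV. \<exists>v. (case x of (i, j) \<Rightarrow> single (Inl i) 1 + single (Inr j) 1) + v = m}"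
    by (rule finite_subset)
qed

lemma left_power_sum: "n > 0 \<Longrightarrow> left (power_sum n) = ind (range (\<lambda>i. single (Inl i) n))"
  using subst_single_power_sum[of "Inl :: nat \<Rightarrow> nat + nat" 1 n]
    subst_nat[OF admissible_left symmetric_power_sum[of n]] by simp

lemma right_power_sum: "n > 0 \<Longrightarrow> right (power_sum n) = ind (range (\<lambda>i. single (Inr i) n))"
  using subst_single_power_sum[of "Inr :: nat \<Rightarrow> nat + nat" 1 n]
    subst_nat[OF admissible_right symmetric_power_sum[of n]] by simp

lemma Delta_plus_power_sum:
  assumes n: "n > 0"
  shows "Delta_plus (power_sum n) = left (power_sum n) + right (power_sum n)"
proof -
  have "Delta_plus (power_sum n) = ind (range (\<lambda>v. single v n))"
    unfolding Delta_plus_def using subst_single_power_sum[of "\<lambda>v :: nat + nat. v" 1 n] n by simp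
  also have "range (\<lambda>v. single v n) = range (\<lambda>i. single (Inl i) n) \<union> range (\<lambda>i. single (Inr i :: nat + nat) n)"
    by (auto simp: image_iff) (metis sum.exhaust)
  also have "ind \<dots> = left (power_sum n) + right (power_sum n)"
    unfolding left_power_sum[OF n] right_power_sum[OF n]
    by (rule ind_disjoint_Un) (auto simp: single_eq_iff n)
  finally show ?thesis .
qed

lemma Delta_times_power_sum:
  assumes n: "n > 0"
  shows "Delta_times (power_sum n) = left (power_sum n) * right (power_sum n)"
proof -
  let ?m = "\<lambda>(i, j). single (Inl i) n + single (Inr j) n :: (nat + nat) \<Rightarrow>\<^sub>0 nat"
  have inj: "i = i' \<and> j = j'" if eq: "single (Inl i) n + single (Inr j) n
      = (single (Inl i') n + single (Inr j') n :: (nat + nat) \<Rightarrow>\<^sub>0 nat)" for i j i' j'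
    using n arg_cong[OF eq, of "\<lambda>m. lookup m (Inl i)"] arg_cong[OF eq, of "\<lambda>m. lookup m (Inr j)"]
    by (auto simp: lookup_add lookup_single when_def split: if_splits)
  have comb: "combine (\<lambda>(i, j). single (Inl i) 1 + single (Inr j) 1) (single x n) = ?m x" for x
    by (cases x) (auto simp: poly_mapping_eq_iff fun_eq_iff lookup_add lookup_single when_def)
  have "Delta_times (power_sum n) = ind (range ?m)"
  proof (rule pseries_eqI)
    fix m
    have "card {x. ?m x = m} = (if m \<in> range ?m then 1 else 0)"
    proof (cases "m \<in> range ?m")
      case True
      then obtain i j where m: "m = ?m (i, j)" by auto
      have "{x. ?m x = m} = {(i, j)}" using inj[of _ _ i j] unfolding m by auto
      then show ?thesis using True by simp
    next
      case False
      then have "{x. ?m x = m} = {}" by blast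
      then show ?thesis using False by (simp only: card.empty if_False)
    qed
    then show "pcoeff (Delta_times (power_sum n)) m = pcoeff (ind (range ?m)) m"
      unfolding Delta_times_def pcoeff_subst_power_sum[OF Delta_times_admissible n] comb
      by (simp add: pcoeff_ind)
  qed
  also have "range ?m = (\<lambda>(a, b). a + b) ` (range (\<lambda>i. single (Inl i) n) \<times> range (\<lambda>i. single (Inr i) n))"
    by (auto simp: image_iff)
  also have "ind \<dots> = left (power_sum n) * right (power_sum n)"
    unfolding left_power_sum[OF n] right_power_sum[OF n]
    by (rule ind_mult[symmetric]) (auto simp: inj_on_def dest!: inj)
  finally show ?thesis .
qed

text \<open>
What addition and multiplication of Witt vectors have in common.
\<close>

locale coproduct =
  fixes p :: nat and \<Phi> :: "nat pseries \<Rightarrow> (nat + nat) pseries"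
  assumes p: "prime p"
    and \<Phi>_0: "\<Phi> 0 = 0" and \<Phi>_1: "\<Phi> 1 = 1"
    and \<Phi>_add: "\<Phi> (f + g) = \<Phi> f + \<Phi> g"
    and \<Phi>_mult: "symmetric f \<Longrightarrow> symmetric g \<Longrightarrow> \<Phi> (f * g) = \<Phi> f * \<Phi> g"
    and \<Phi>_row_0: "\<Phi> (d p 0 j) \<in> R2 p"
    and Psi_\<Phi>_row_0: "Psi p (\<Phi> (d p 0 j)) = \<Phi> (d p 0 (Suc j))"
begin

lemma \<Phi>_relations: "relations p Suc (\<lambda>i j. \<Phi> (d p i j))"
  unfolding relations_def
proof (intro allI)
  fix i j
  have pow: "\<Phi> (f ^ n) = \<Phi> f ^ n" if "symmetric f" for f n
    by (induction n) (simp_all add: \<Phi>_1 \<Phi>_mult that symmetric_power)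
  have of_nat: "\<Phi> (of_nat n * f) = of_nat n * \<Phi> f" for n f
    by (induction n) (simp_all add: \<Phi>_0 \<Phi>_add distrib_right)
  show "\<Phi> (d p i j) ^ p = of_nat p * \<Phi> (d p (Suc i) j) + \<Phi> (d p i (Suc j))"
    by (simp only: pow[OF symmetric_d[OF p], symmetric] d_rel[OF p] \<Phi>_add of_nat)
qed

lemma Psi_\<Phi>_d: "Psi p (\<Phi> (d p i j)) = \<Phi> (d p i (Suc j))"
proof (rule relations_unique[OF p_pos[OF p], where X = "\<lambda>i j. Psi p (\<Phi> (d p i j))"
      and Y = "\<lambda>i j. \<Phi> (d p i (Suc j))"])
  note rel = \<Phi>_relations[unfolded relations_def, rule_format]
  show "relations p Suc (\<lambda>i j. Psi p (\<Phi> (d p i j)))"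
    unfolding relations_def
    by (simp only: msub_power[OF admissible_Psi[OF p_pos[OF p]], symmetric] rel msub_add msub_of_nat_mult) simp
  show "relations p Suc (\<lambda>i j. \<Phi> (d p i (Suc j)))"
    unfolding relations_def by (simp only: rel) simp
qed (rule Psi_\<Phi>_row_0)

lemma delta_of_\<Phi>_d: "delta_of p (\<Phi> (d p i j)) (\<Phi> (d p (Suc i) j))"
  using \<Phi>_relations by (simp add: delta_of_def Psi_\<Phi>_d relations_def)

text \<open>
The image of \<open>d\<^sub>i\<^sub>+\<^sub>1\<^sub>,\<^sub>j\<close> is the delta of the image of \<open>d\<^sub>i\<^sub>,\<^sub>j\<close>, and the tensor square is closed under delta.
\<close>

lemma \<Phi>_d_in_R2: "\<Phi> (d p i j) \<in> R2 p"
proof (induction i)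
  case (Suc i)
  then show ?case
    using R2_delta[OF p] delta_of_unique[OF p_pos[OF p] delta_of_\<Phi>_d] by blast
qed (rule \<Phi>_row_0)

lemma \<Phi>_in_R2: "f \<in> Lambda_p p \<Longrightarrow> \<Phi> f \<in> R2 p"
  by (induction rule: Lambda_p.induct)
    (simp_all add: \<Phi>_0 \<Phi>_1 \<Phi>_add \<Phi>_mult Lambda_p_symmetric[OF p] \<Phi>_d_in_R2 generated.intros)

lemma Psi_iterate_\<Phi>_d: "\<Phi> (d p i j) = (Psi p ^^ j) (\<Phi> (d p i 0))"
  by (induction j) (simp_all flip: Psi_\<Phi>_d)

lemma convolution:
  assumes a: "a \<in> W p" and b: "b \<in> W p"
  shows "(\<lambda>f\<in>Lambda_p p. tensor_eval p a b (\<Phi> f)) \<in> W p"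
    and "(\<lambda>f\<in>Lambda_p p. tensor_eval p a b (\<Phi> f)) (d p i j)
      = eval2 p (coords p a) (coords p b) (\<Phi> (d p i j))"
proof -
  note ca = relations_coords[OF p a] and cb = relations_coords[OF p b]
  have eq: "(\<lambda>f\<in>Lambda_p p. tensor_eval p a b (\<Phi> f))
      = (\<lambda>f\<in>Lambda_p p. eval2 p (coords p a) (coords p b) (\<Phi> f))"
    by (rule restrict_ext) (rule tensor_eval_eq[OF p a b \<Phi>_in_R2])
  show "(\<lambda>f\<in>Lambda_p p. tensor_eval p a b (\<Phi> f)) \<in> W p"
    unfolding W_iff eq
    by (auto simp: Lambda_p.intros \<Phi>_0 \<Phi>_1 \<Phi>_add \<Phi>_mult Lambda_p_symmetric[OF p] \<Phi>_in_R2
        eval2_0[OF p ca cb] eval2_1[OF p ca cb] eval2_add[OF p ca cb] eval2_mult[OF p ca cb])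
  show "(\<lambda>f\<in>Lambda_p p. tensor_eval p a b (\<Phi> f)) (d p i j)
      = eval2 p (coords p a) (coords p b) (\<Phi> (d p i j))"
    unfolding eq by (simp add: Lambda_p.gen)
qed

text \<open>
The Frobenius substitution \<open>\<psi>\<^sup>j\<close> acts on solutions by deleting the first \<open>j\<close> columns.
\<close>

lemma eval2_shift:
  fixes a b :: "nat \<Rightarrow> nat \<Rightarrow> 'a::comm_semiring_1"
  assumes a: "relations p Suc a" and b: "relations p Suc b"
  shows "eval2 p a b (\<Phi> (d p i j)) = eval2 p (\<lambda>i k. a i (k + j)) (\<lambda>i k. b i (k + j)) (\<Phi> (d p i 0))"
proof -
  have a': "relations p Suc (\<lambda>i k. a i (k + j))" and b': "relations p Suc (\<lambda>i k. b i (k + j))"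
    using a b by (simp_all add: relations_def)
  have Psi_R2: "(Psi p ^^ j) F \<in> R2 p" if "F \<in> R2 p" for F
    using that by (induction j) (simp_all add: Psi_in_R2[OF p])
  have Psi_add: "(Psi p ^^ j) (F + G) = (Psi p ^^ j) F + (Psi p ^^ j) G"
    and Psi_mult: "(Psi p ^^ j) (F * G) = (Psi p ^^ j) F * (Psi p ^^ j) G"
    and Psi_const: "(Psi p ^^ j) 0 = 0" "(Psi p ^^ j) 1 = 1" for F G :: "(nat + nat) pseries"
    by (induction j) (simp_all add: msub_add msub_mult msub_1 admissible_Psi p_pos[OF p])
  have Psi_gen: "(Psi p ^^ j) (left (d p i k)) = left (d p i (k + j))"
    "(Psi p ^^ j) (right (d p i k)) = right (d p i (k + j))" for i k
    by (induction j) (simp_all only: funpow_0 funpow.simps o_apply add_Suc_right add_0_right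
        Psi_left[OF p_pos[OF p]] Psi_right[OF p_pos[OF p]] Psi_d[OF p] id_apply)
  have "eval2 p (\<lambda>i k. a i (k + j)) (\<lambda>i k. b i (k + j)) F = eval2 p a b ((Psi p ^^ j) F)" if "F \<in> R2 p" for F
    by (rule eval2_unique[OF p a' b' that])
      (simp_all only: Psi_add Psi_mult Psi_const Psi_gen Psi_R2 eval2_0[OF p a b] eval2_1[OF p a b]
        eval2_add[OF p a b] eval2_mult[OF p a b] eval2_left[OF p a b] eval2_right[OF p a b])
  from this[OF \<Phi>_d_in_R2] show ?thesis by (simp only: Psi_iterate_\<Phi>_d[of i j])
qed

text \<open>
The general form of a unit law.  If the factors of the tensor square can be mapped back to series in a
way that sends the coproduct of every power sum to that power sum, the coproduct of every
generator goes to that generator.  Composition with \<open>w\<close> transports this to any semiring, and the shift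
allows the hypothesis to hold from column \<open>j\<close> on only.
\<close>

lemma eval2_unit:
  fixes w :: "nat pseries \<Rightarrow> 'a::comm_semiring_1"
  assumes e: "relations p Suc e" "relations p Suc e'"
    and \<Lambda>: "\<And>i j. e i j \<in> Lambda_p p" "\<And>i j. e' i j \<in> Lambda_p p"
    and row: "\<And>j. eval2 p e e' (\<Phi> (d p 0 j)) = d p 0 j"
    and w: "w \<in> W p"
    and a: "relations p Suc a" "\<And>i k. a i (k + j) = w (e i k)"
    and b: "relations p Suc b" "\<And>i k. b i (k + j) = w (e' i k)"
  shows "eval2 p a b (\<Phi> (d p i j)) = w (d p i 0)"
proof -
  have rel: "relations p Suc (\<lambda>i j. w (f i j))" if "relations p Suc f" "\<And>i j. f i j \<in> Lambda_p p" for f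
    unfolding relations_def
  proof (intro allI)
    fix i j
    have "w (f i j ^ p) = w (of_nat p * f (Suc i) j + f i (Suc j))"
      using that(1) by (simp add: relations_def)
    then show "w (f i j) ^ p = of_nat p * w (f (Suc i) j) + w (f i (Suc j))"
      by (simp add: W_power[OF w] W_add[OF w] W_of_nat_mult[OF w] that(2) Lambda_p_of_nat_mult)
  qed
  have in_\<Lambda>: "eval2 p e e' F \<in> Lambda_p p" if "F \<in> R2 p" for F
    using that
  proof (induction rule: generated.induct)
    case (gen k j)
    show ?case using \<Lambda> by (cases k) (simp_all add: eval2_tgen[OF p e])
  qed (simp_all add: eval2_0[OF p e] eval2_1[OF p e] eval2_add[OF p e] eval2_mult[OF p e] Lambda_p.intros)
  have d: "eval2 p e e' (\<Phi> (d p i 0)) = d p i 0"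
  proof (rule relations_unique[OF p_pos[OF p], where X = "\<lambda>i j. eval2 p e e' (\<Phi> (d p i j))"])
    show "relations p Suc (\<lambda>i j. eval2 p e e' (\<Phi> (d p i j)))"
      unfolding relations_def
    proof (intro allI)
      fix i j
      have "eval2 p e e' (\<Phi> (d p i j) ^ p)
          = eval2 p e e' (of_nat p * \<Phi> (d p (Suc i) j) + \<Phi> (d p i (Suc j)))"
        using \<Phi>_relations by (simp add: relations_def)
      then show "eval2 p e e' (\<Phi> (d p i j)) ^ p
          = of_nat p * eval2 p e e' (\<Phi> (d p (Suc i) j)) + eval2 p e e' (\<Phi> (d p i (Suc j)))"
        by (simp add: eval2_power[OF p e] eval2_add[OF p e] eval2_of_nat_mult[OF p e] \<Phi>_d_in_R2
            generated_of_nat_mult)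
    qed
  qed (rule relations_d[OF p], rule row)
  have "eval2 p (\<lambda>i j. w (e i j)) (\<lambda>i j. w (e' i j)) F = w (eval2 p e e' F)" if "F \<in> R2 p" for F
    by (rule eval2_unique[OF p rel[OF e(1) \<Lambda>(1)] rel[OF e(2) \<Lambda>(2)] that])
      (simp_all only: eval2_0[OF p e] eval2_1[OF p e] eval2_add[OF p e] eval2_mult[OF p e]
        eval2_left[OF p e] eval2_right[OF p e] W_0[OF w] W_1[OF w] W_add[OF w] W_mult[OF w] in_\<Lambda>)
  from this[OF \<Phi>_d_in_R2] show ?thesis
    by (simp only: d eval2_shift[OF a(1) b(1)] a(2) b(2))
qed

end

lemma left_right_row_0:
  assumes "prime p"
  shows "Delta_plus (d p 0 j) = left (d p 0 j) + right (d p 0 j)"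
    and "Delta_times (d p 0 j) = left (d p 0 j) * right (d p 0 j)"
  unfolding d_0[OF assms]
  using p_pos[OF assms] by (intro Delta_plus_power_sum Delta_times_power_sum; simp)+

lemma coproduct_Delta_plus:
  assumes p: "prime p"
  shows "coproduct p Delta_plus"
proof
  note adm = Delta_plus_admissible
  show "Delta_plus 0 = 0" "Delta_plus 1 = 1" unfolding Delta_plus_def
    by (rule subst_0[OF adm] subst_1[OF adm])+
  show "Delta_plus (f + g) = Delta_plus f + Delta_plus g" for f g
    unfolding Delta_plus_def by (rule subst_add[OF adm])
  show "symmetric f \<Longrightarrow> symmetric g \<Longrightarrow> Delta_plus (f * g) = Delta_plus f * Delta_plus g" for f g
    unfolding Delta_plus_def by (rule subst_mult[OF adm])
  show "Delta_plus (d p 0 j) \<in> R2 p" for j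
    unfolding left_right_row_0[OF p] by (intro generated.add left_d_in_R2 right_d_in_R2)
  show "Psi p (Delta_plus (d p 0 j)) = Delta_plus (d p 0 (Suc j))" for j
    unfolding left_right_row_0[OF p]
    by (simp only: msub_add Psi_left[OF p_pos[OF p]] Psi_right[OF p_pos[OF p]] Psi_d[OF p])
qed (rule p)

lemma coproduct_Delta_times:
  assumes p: "prime p"
  shows "coproduct p Delta_times"
proof
  note adm = Delta_times_admissible
  show "Delta_times 0 = 0" "Delta_times 1 = 1" unfolding Delta_times_def
    by (rule subst_0[OF adm] subst_1[OF adm])+
  show "Delta_times (f + g) = Delta_times f + Delta_times g" for f g
    unfolding Delta_times_def by (rule subst_add[OF adm])
  show "symmetric f \<Longrightarrow> symmetric g \<Longrightarrow> Delta_times (f * g) = Delta_times f * Delta_times g" for f g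
    unfolding Delta_times_def by (rule subst_mult[OF adm])
  show "Delta_times (d p 0 j) \<in> R2 p" for j
    unfolding left_right_row_0[OF p] by (intro generated.mult left_d_in_R2 right_d_in_R2)
  show "Psi p (Delta_times (d p 0 j)) = Delta_times (d p 0 (Suc j))" for j
    unfolding left_right_row_0[OF p]
    by (simp only: msub_mult[OF admissible_Psi[OF p_pos[OF p]]] Psi_left[OF p_pos[OF p]]
        Psi_right[OF p_pos[OF p]] Psi_d[OF p])
qed (rule p)


section \<open>Boolean solutions of the relations\<close>

lemma boolean_0_1: "(x :: boolean) = 0 \<or> x = 1"
  by (cases x) (simp_all add: zero_boolean_def one_boolean_def)

lemma boolean_add_eq_0 [simp]: "(x :: boolean) + y = 0 \<longleftrightarrow> x = 0 \<and> y = 0"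
  by (cases x; cases y) (simp_all add: zero_boolean_def)

lemma boolean_mult_eq_0 [simp]: "(x :: boolean) * y = 0 \<longleftrightarrow> x = 0 \<or> y = 0"
  by (cases x; cases y) (simp_all add: zero_boolean_def)

lemma boolean_power_eq_0 [simp]: "(x :: boolean) ^ n = 0 \<longleftrightarrow> n > 0 \<and> x = 0"
  by (induction n) auto

lemma boolean_of_nat_eq_0 [simp]: "(of_nat n :: boolean) = 0 \<longleftrightarrow> n = 0"
  by (cases n) simp_all

lemma boolean_eqI: "(x = 0 \<longleftrightarrow> y = 0) \<Longrightarrow> x = (y :: boolean)"
  using boolean_0_1[of x] boolean_0_1[of y] by auto

lemma relations_boolean:
  fixes a :: "nat \<Rightarrow> nat \<Rightarrow> boolean"
  assumes "p > 0"
  shows "relations p Suc a \<longleftrightarrow> (\<forall>i j. a i j = 0 \<longleftrightarrow> a (Suc i) j = 0 \<and> a i (Suc j) = 0)"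
proof
  assume *: "relations p Suc a"
  show "\<forall>i j. a i j = 0 \<longleftrightarrow> a (Suc i) j = 0 \<and> a i (Suc j) = 0"
  proof (intro allI)
    fix i j
    have "a i j ^ p = of_nat p * a (Suc i) j + a i (Suc j)" using * by (simp add: relations_def)
    then have "a i j ^ p = 0 \<longleftrightarrow> of_nat p * a (Suc i) j + a i (Suc j) = 0" by simp
    then show "a i j = 0 \<longleftrightarrow> a (Suc i) j = 0 \<and> a i (Suc j) = 0" using assms by simp
  qed
next
  assume *: "\<forall>i j. a i j = 0 \<longleftrightarrow> a (Suc i) j = 0 \<and> a i (Suc j) = 0"
  show "relations p Suc a"
    unfolding relations_def
  proof (intro allI boolean_eqI)
    fix i j
    show "a i j ^ p = 0 \<longleftrightarrow> of_nat p * a (Suc i) j + a i (Suc j) = 0"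
      using *[rule_format, of i j] assms by simp
  qed
qed

lemma boolean_solution_step:
  fixes a :: "nat \<Rightarrow> nat \<Rightarrow> boolean"
  assumes "relations p Suc a" "p > 0"
  shows "a i j = 0 \<longleftrightarrow> a (Suc i) j = 0 \<and> a i (Suc j) = 0"
  using assms(1) unfolding relations_boolean[OF assms(2)] by blast

primrec pattern :: "coord \<Rightarrow> nat \<Rightarrow> nat \<Rightarrow> boolean" where
  "pattern (Pt x y) = (\<lambda>i j. if x \<le> i \<and> y \<le> j then 0 else 1)"
| "pattern Infty = (\<lambda>i j. 1)"

lemma pattern_eq_0: "pattern (Pt x y) i j = 0 \<longleftrightarrow> x \<le> i \<and> y \<le> j"
  by simp

declare pattern.simps(1) [simp del]

lemma relations_pattern: "p > 0 \<Longrightarrow> relations p Suc (pattern u)"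
  by (cases u) (auto simp: relations_boolean pattern_eq_0)

lemma pattern_inj: "pattern u = pattern v \<Longrightarrow> u = v"
proof (cases u; cases v)
  fix x y x' y' assume eq: "pattern u = pattern v" and [simp]: "u = Pt x y" "v = Pt x' y'"
  have *: "x \<le> i \<and> y \<le> j \<longleftrightarrow> x' \<le> i \<and> y' \<le> j" for i j
    using fun_cong[OF fun_cong[OF eq], of i j] pattern_eq_0[of x y i j] pattern_eq_0[of x' y' i j] by simp
  show "u = v" using *[of x y] *[of x' y'] by simp
next
  fix x y assume eq: "pattern u = pattern v" and [simp]: "u = Pt x y" "v = Infty"
  then show "u = v" using pattern_eq_0[of x y x y] by simp
next
  fix x y assume eq: "pattern u = pattern v" and [simp]: "u = Infty" "v = Pt x y"
  then show "u = v" using pattern_eq_0[of x y x y] by (metis order_refl pattern.simps(2) zero_neq_one)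
qed simp

lemma boolean_solution_mono:
  fixes a :: "nat \<Rightarrow> nat \<Rightarrow> boolean"
  assumes "relations p Suc a" "p > 0" "a i j = 0" "i \<le> i'" "j \<le> j'"
  shows "a i' j' = 0"
proof -
  have "a i' j = 0"
    using assms(4)
  proof (induction rule: dec_induct)
    case (step n)
    then show ?case using boolean_solution_step[OF assms(1,2), of n j] by blast
  qed (rule assms(3))
  with assms(5) show ?thesis
  proof (induction rule: dec_induct)
    case (step n)
    then show ?case using boolean_solution_step[OF assms(1,2), of i' n] by blast
  qed
qed

text \<open>
Zeros spread to larger indices.  Conversely the corner of a hook of zeros is zero, since each of its
two neighbours is the corner of a smaller hook.
\<close>

lemma boolean_solution_corner:
  fixes a :: "nat \<Rightarrow> nat \<Rightarrow> boolean"
  assumes rel: "relations p Suc a" "p > 0" and "a (x + m) y = 0" "a x (y + n) = 0"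
  shows "a x y = 0"
  using assms(3,4)
proof (induction "m + n" arbitrary: m n x y rule: less_induct)
  case less
  show ?case
  proof (cases "m = 0 \<or> n = 0")
    case False
    then obtain m' n' where m: "m = Suc m'" and n: "n = Suc n'" by (metis not0_implies_Suc)
    have "a (Suc x) (y + n) = 0" "a (x + m) (Suc y) = 0"
      using boolean_solution_mono[OF rel less.prems(2), of "Suc x" "y + n"]
        boolean_solution_mono[OF rel less.prems(1), of "x + m" "Suc y"] by simp_all
    then have "a (Suc x) y = 0" "a x (Suc y) = 0"
      using less.hyps[of m' n "Suc x" y] less.hyps[of m n' x "Suc y"] less.prems by (auto simp: m n)
    then show ?thesis using boolean_solution_step[OF rel, of x y] by blast
  qed (use less.prems in auto)
qed

lemma boolean_solution_pattern:
  fixes a :: "nat \<Rightarrow> nat \<Rightarrow> boolean"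
  assumes rel: "relations p Suc a" "p > 0"
  shows "\<exists>u. a = pattern u"
proof (cases "\<exists>i j. a i j = 0")
  case False
  then have "a = pattern Infty" using boolean_0_1 by (simp add: fun_eq_iff) blast
  then show ?thesis ..
next
  case True
  define x where "x = (LEAST x. \<exists>j. a x j = 0)"
  define y where "y = (LEAST y. \<exists>i. a i y = 0)"
  obtain j0 where j0: "a x j0 = 0"
    using LeastI_ex[of "\<lambda>x. \<exists>j. a x j = 0"] True unfolding x_def by blast
  obtain i0 where i0: "a i0 y = 0"
    using LeastI_ex[of "\<lambda>y. \<exists>i. a i y = 0"] True unfolding y_def by blast
  have min: "x \<le> i" "y \<le> j" if "a i j = 0" for i j
    unfolding x_def y_def using that by (auto intro: Least_le)
  have "a (x + (i0 - x)) y = 0" "a x (y + (j0 - y)) = 0"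
    using min[OF i0] min[OF j0] i0 j0 by auto
  then have "a x y = 0" by (rule boolean_solution_corner[OF rel])
  then have "a i j = 0 \<longleftrightarrow> x \<le> i \<and> y \<le> j" for i j
    using min boolean_solution_mono[OF rel] by blast
  then have "a = pattern (Pt x y)" by (intro ext boolean_eqI) (simp add: pattern_eq_0)
  then show ?thesis ..
qed


section \<open>Positivity of iterated deltas\<close>

text \<open>
The mixed terms of \<open>((F + G)\<^sup>p - F\<^sup>p - G\<^sup>p) / p\<close>.
\<close>

definition cross :: "nat \<Rightarrow> 'v pseries \<Rightarrow> 'v pseries \<Rightarrow> 'v pseries" where
  "cross p F G = (\<Sum>k\<in>{0<..<p}. of_nat ((p choose k) div p) * F ^ k * G ^ (p - k))"

lemma cross_2: "cross 2 F G = F * G"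
proof -
  have "{0<..<2 :: nat} = {1}" by auto
  then show ?thesis by (simp add: cross_def)
qed

lemma cross_term_in_R2: "F \<in> R2 p \<Longrightarrow> G \<in> R2 p \<Longrightarrow> of_nat n * F ^ k * G ^ l \<in> R2 p"
  by (rule generated.mult[OF generated.mult[OF generated_of_nat generated_power] generated_power])

lemma cross_in_R2: "F \<in> R2 p \<Longrightarrow> G \<in> R2 p \<Longrightarrow> cross p F G \<in> R2 p"
  unfolding cross_def by (intro generated_sum cross_term_in_R2)

lemma cross_last_term:
  assumes p: "p \<ge> 2" and "F \<in> R2 p" "G \<in> R2 p"
  shows "\<exists>S\<in>R2 p. cross p F G = F ^ (p - 1) * G + S"
proof
  let ?t = "\<lambda>k. of_nat ((p choose k) div p) * F ^ k * G ^ (p - k)"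
  have "{0<..<p} = insert (p - 1) {0<..<p - 1}" using p by auto
  moreover have "p choose (p - 1) = p" using binomial_symmetric[of 1 p] p by simp
  ultimately show "cross p F G = F ^ (p - 1) * G + (\<Sum>k\<in>{0<..<p - 1}. ?t k)"
    using p by (simp add: cross_def)
  show "(\<Sum>k\<in>{0<..<p - 1}. ?t k) \<in> R2 p"
    using assms by (intro generated_sum cross_term_in_R2)
qed

lemma cross_outer_terms:
  assumes p: "p > 2" and "F \<in> R2 p" "G \<in> R2 p"
  shows "\<exists>S\<in>R2 p. cross p F G = F ^ (p - 1) * G + F * G ^ (p - 1) + S"
proof
  let ?t = "\<lambda>k. of_nat ((p choose k) div p) * F ^ k * G ^ (p - k)"
  have "{0<..<p} = insert (p - 1) (insert 1 {1<..<p - 1})" using p by auto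
  moreover have "p choose (p - 1) = p" using binomial_symmetric[of 1 p] p by simp
  ultimately show "cross p F G = F ^ (p - 1) * G + F * G ^ (p - 1) + (\<Sum>k\<in>{1<..<p - 1}. ?t k)"
    using p by (simp add: cross_def add.assoc)
  show "(\<Sum>k\<in>{1<..<p - 1}. ?t k) \<in> R2 p"
    using assms by (intro generated_sum cross_term_in_R2)
qed

context
  fixes p :: nat and a b :: "nat \<Rightarrow> nat \<Rightarrow> boolean"
  assumes p: "prime p" and a: "relations p Suc a" and b: "relations p Suc b"
begin

abbreviation bval :: "(nat + nat) pseries \<Rightarrow> boolean" where
  "bval \<equiv> eval2 p a b"

lemma bval_add [simp]: "F \<in> R2 p \<Longrightarrow> G \<in> R2 p \<Longrightarrow> bval (F + G) = 0 \<longleftrightarrow> bval F = 0 \<and> bval G = 0"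
  by (simp add: eval2_add[OF p a b])

lemma bval_mult [simp]: "F \<in> R2 p \<Longrightarrow> G \<in> R2 p \<Longrightarrow> bval (F * G) = 0 \<longleftrightarrow> bval F = 0 \<or> bval G = 0"
  by (simp add: eval2_mult[OF p a b])

lemma bval_power [simp]: "F \<in> R2 p \<Longrightarrow> bval (F ^ n) = 0 \<longleftrightarrow> n > 0 \<and> bval F = 0"
  by (simp add: eval2_power[OF p a b])

text \<open>
The delta of \<open>u + v + w\<close> contains \<open>\<delta> v\<close> and the mixed term \<open>u\<^sup>p\<^sup>-\<^sup>1 v\<close>, and the delta of the latter
contains \<open>u\<^sup>(\<^sup>p\<^sup>-\<^sup>1\<^sup>)\<^sup>p \<delta> v\<close>.  So \<open>\<delta> v\<close> and \<open>u\<^sup>p\<^sup>-\<^sup>1 v\<close> can take the places of \<open>u\<close> and \<open>v\<close>, and all later iterates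
have nonzero values.
\<close>

lemma delta_sequence_positive:
  assumes X: "\<And>i. delta_of p (X i) (X (Suc i))"
    and X0: "X 0 = u + v + w" and R2: "u \<in> R2 p" "v \<in> R2 p" "v' \<in> R2 p" "w \<in> R2 p"
    and v': "delta_of p v v'" and pos: "bval u \<noteq> 0" "bval v \<noteq> 0" "bval v' \<noteq> 0"
  shows "bval (X i) \<noteq> 0"
proof -
  have p2: "p \<ge> 2" using p by (rule prime_ge_2_nat)
  have "\<exists>u\<in>R2 p. \<exists>v\<in>R2 p. \<exists>v'\<in>R2 p. \<exists>w\<in>R2 p. X i = u + v + w \<and> delta_of p v v'
      \<and> bval u \<noteq> 0 \<and> bval v \<noteq> 0 \<and> bval v' \<noteq> 0"
  proof (induction i)
    case 0
    show ?case using X0 R2 v' pos by blast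
  next
    case (Suc i)
    then obtain u v v' w where IH: "u \<in> R2 p" "v \<in> R2 p" "v' \<in> R2 p" "w \<in> R2 p"
      "X i = u + v + w" "delta_of p v v'" "bval u \<noteq> 0" "bval v \<noteq> 0" "bval v' \<noteq> 0" by blast
    obtain u' where u': "u' \<in> R2 p" "delta_of p u u'" using R2_delta[OF p IH(1)] by blast
    obtain w' where w': "w' \<in> R2 p" "delta_of p w w'" using R2_delta[OF p IH(4)] by blast
    obtain x where x: "x \<in> R2 p" "delta_of p (u ^ (p - 1)) x"
      using R2_delta[OF p generated_power[OF IH(1)]] by blast
    obtain S where S: "S \<in> R2 p" "cross p u v = u ^ (p - 1) * v + S"
      using cross_last_term[OF p2 IH(1,2)] by blast
    have uv: "u + v \<in> R2 p" using IH by (intro generated.add)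
    have "delta_of p (u + v + w) (u' + v' + cross p u v + w' + cross p (u + v) w)"
      unfolding cross_def by (intro delta_of_add[OF p] u' w' IH)
    then have "X (Suc i) = u' + v' + cross p u v + w' + cross p (u + v) w"
      using delta_of_unique[OF p_pos[OF p] X[of i]] IH(5) by simp
    then have "X (Suc i) = v' + u ^ (p - 1) * v + (u' + S + w' + cross p (u + v) w)"
      by (simp only: S(2) ac_simps)
    moreover have "delta_of p (u ^ (p - 1) * v) ((u ^ (p - 1)) ^ p * v' + x * Psi p v)"
      by (rule delta_of_mult[OF p x(2) IH(6)])
    moreover have "u ^ (p - 1) * v \<in> R2 p" "u' + S + w' + cross p (u + v) w \<in> R2 p"
      "(u ^ (p - 1)) ^ p * v' \<in> R2 p" "x * Psi p v \<in> R2 p"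
      using IH(1-4) u' w' x S(1) uv
      by (intro generated.add generated.mult generated_power cross_in_R2 Psi_in_R2[OF p]; simp)+
    moreover from this have "(u ^ (p - 1)) ^ p * v' + x * Psi p v \<in> R2 p" by (intro generated.add)
    moreover have "bval (u ^ (p - 1) * v) \<noteq> 0" "bval ((u ^ (p - 1)) ^ p * v') \<noteq> 0"
      using IH by (simp_all add: generated_power)
    ultimately show ?case
      using IH(3,9)
      by (intro bexI[of _ v'] bexI[of _ "u ^ (p - 1) * v"] bexI[of _ "(u ^ (p - 1)) ^ p * v' + x * Psi p v"]
          bexI[of _ "u' + S + w' + cross p (u + v) w"]) simp_all
  qed
  then obtain u v w where "u \<in> R2 p" "v \<in> R2 p" "w \<in> R2 p" "X i = u + v + w" "bval u \<noteq> 0" by blast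
  then show ?thesis by (simp add: generated.add)
qed

text \<open>
For \<open>p > 2\<close> the two mixed terms \<open>u\<^sup>p\<^sup>-\<^sup>1 v\<close> and \<open>u v\<^sup>p\<^sup>-\<^sup>1\<close> are distinct summands and can take the places
of \<open>u\<close> and \<open>v\<close>.
\<close>

lemma delta_sequence_positive_odd:
  assumes p2: "p > 2" and X: "\<And>i. delta_of p (X i) (X (Suc i))"
    and X0: "X 0 = u + v + w" and R2: "u \<in> R2 p" "v \<in> R2 p" "w \<in> R2 p"
    and pos: "bval u \<noteq> 0" "bval v \<noteq> 0"
  shows "bval (X i) \<noteq> 0"
proof -
  have "\<exists>u\<in>R2 p. \<exists>v\<in>R2 p. \<exists>w\<in>R2 p. X i = u + v + w \<and> bval u \<noteq> 0 \<and> bval v \<noteq> 0"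
  proof (induction i)
    case 0
    show ?case using X0 R2 pos by blast
  next
    case (Suc i)
    then obtain u v w where IH: "u \<in> R2 p" "v \<in> R2 p" "w \<in> R2 p"
      "X i = u + v + w" "bval u \<noteq> 0" "bval v \<noteq> 0" by blast
    obtain u' where u': "u' \<in> R2 p" "delta_of p u u'" using R2_delta[OF p IH(1)] by blast
    obtain v' where v': "v' \<in> R2 p" "delta_of p v v'" using R2_delta[OF p IH(2)] by blast
    obtain w' where w': "w' \<in> R2 p" "delta_of p w w'" using R2_delta[OF p IH(3)] by blast
    obtain S where S: "S \<in> R2 p" "cross p u v = u ^ (p - 1) * v + u * v ^ (p - 1) + S"
      using cross_outer_terms[OF p2 IH(1,2)] by blast
    have uv: "u + v \<in> R2 p" using IH by (intro generated.add)
    have "delta_of p (u + v + w) (u' + v' + cross p u v + w' + cross p (u + v) w)"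
      unfolding cross_def by (intro delta_of_add[OF p] u' v' w')
    then have "X (Suc i) = u' + v' + cross p u v + w' + cross p (u + v) w"
      using delta_of_unique[OF p_pos[OF p] X[of i]] IH(4) by simp
    then have "X (Suc i) = u ^ (p - 1) * v + u * v ^ (p - 1) + (u' + v' + S + w' + cross p (u + v) w)"
      by (simp only: S(2) ac_simps)
    moreover have "u ^ (p - 1) * v \<in> R2 p" "u * v ^ (p - 1) \<in> R2 p"
      "u' + v' + S + w' + cross p (u + v) w \<in> R2 p"
      using IH(1-3) u' v' w' S(1) uv
      by (intro generated.add generated.mult generated_power cross_in_R2; simp)+
    moreover have "bval (u ^ (p - 1) * v) \<noteq> 0" "bval (u * v ^ (p - 1)) \<noteq> 0"
      using IH by (simp_all add: generated_power)
    ultimately show ?case by blast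
  qed
  then obtain u v w where "u \<in> R2 p" "v \<in> R2 p" "w \<in> R2 p" "X i = u + v + w" "bval u \<noteq> 0" by blast
  then show ?thesis by (simp add: generated.add)
qed

end


section \<open>Bounds for sums and products of Witt vectors\<close>

lemma relations_const_0: "p > 0 \<Longrightarrow> relations p Suc (\<lambda>i j. 0)"
  by (simp add: relations_def zero_power)

lemma relations_one: "p > 0 \<Longrightarrow> relations p Suc (\<lambda>i j. if i = 0 then 1 else 0)"
  by (simp add: relations_def zero_power)

context
  fixes p :: nat and a b :: "nat \<Rightarrow> nat \<Rightarrow> 'a::comm_semiring_1"
  assumes p: "prime p" and a: "relations p Suc a" and b: "relations p Suc b"
begin

lemma solution_witt_vector:
  assumes "relations p Suc c"
  obtains w where "w \<in> W p" "\<And>i k. w (d p i k) = c i (k + j)"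
proof -
  have "relations p Suc (\<lambda>i k. c i (k + j))" using assms by (simp add: relations_def)
  from witt_vector_exists[OF p this] that show ?thesis by blast
qed

lemma plus_zero_right:
  assumes "\<And>i k. b i (k + j) = 0"
  shows "eval2 p a b (Delta_plus (d p i j)) = a i j"
proof -
  obtain w where w: "w \<in> W p" "\<And>i k. w (d p i k) = a i (k + j)"
    using solution_witt_vector[OF a] by blast
  note e = relations_d[OF p] relations_const_0[OF p_pos[OF p]]
  have "eval2 p a b (Delta_plus (d p i j)) = w (d p i 0)"
  proof (rule coproduct.eval2_unit[OF coproduct_Delta_plus[OF p] e _ _ _ w(1) a _ b])
    show "eval2 p (d p) (\<lambda>i j. 0) (Delta_plus (d p 0 k)) = d p 0 k" for k
      by (simp only: left_right_row_0[OF p] eval2_add[OF p e left_d_in_R2 right_d_in_R2]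
          eval2_left[OF p e] eval2_right[OF p e] add_0_right)
  qed (simp_all add: w W_0[OF w(1)] assms Lambda_p.intros)
  then show ?thesis by (simp add: w(2))
qed

lemma plus_zero_left:
  assumes "\<And>i k. a i (k + j) = 0"
  shows "eval2 p a b (Delta_plus (d p i j)) = b i j"
proof -
  obtain w where w: "w \<in> W p" "\<And>i k. w (d p i k) = b i (k + j)"
    using solution_witt_vector[OF b] by blast
  note e = relations_const_0[OF p_pos[OF p]] relations_d[OF p]
  have "eval2 p a b (Delta_plus (d p i j)) = w (d p i 0)"
  proof (rule coproduct.eval2_unit[OF coproduct_Delta_plus[OF p] e _ _ _ w(1) a _ b])
    show "eval2 p (\<lambda>i j. 0) (d p) (Delta_plus (d p 0 k)) = d p 0 k" for k
      by (simp only: left_right_row_0[OF p] eval2_add[OF p e left_d_in_R2 right_d_in_R2]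
          eval2_left[OF p e] eval2_right[OF p e] add_0_left)
  qed (simp_all add: w W_0[OF w(1)] assms Lambda_p.intros)
  then show ?thesis by (simp add: w(2))
qed

lemma times_one_right:
  assumes "\<And>i k. b i (k + j) = (if i = 0 then 1 else 0)"
  shows "eval2 p a b (Delta_times (d p i j)) = a i j"
proof -
  obtain w where w: "w \<in> W p" "\<And>i k. w (d p i k) = a i (k + j)"
    using solution_witt_vector[OF a] by blast
  note e = relations_d[OF p] relations_one[OF p_pos[OF p]]
  have "eval2 p a b (Delta_times (d p i j)) = w (d p i 0)"
  proof (rule coproduct.eval2_unit[OF coproduct_Delta_times[OF p] e _ _ _ w(1) a _ b])
    show "eval2 p (d p) (\<lambda>i j. if i = 0 then 1 else 0) (Delta_times (d p 0 k)) = d p 0 k" for k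
      by (simp only: left_right_row_0[OF p] eval2_mult[OF p e left_d_in_R2 right_d_in_R2]
          eval2_left[OF p e] eval2_right[OF p e] mult_1_right if_True simp_thms)
  qed (simp_all add: w W_0[OF w(1)] W_1[OF w(1)] assms Lambda_p.intros)
  then show ?thesis by (simp add: w(2))
qed

lemma times_one_left:
  assumes "\<And>i k. a i (k + j) = (if i = 0 then 1 else 0)"
  shows "eval2 p a b (Delta_times (d p i j)) = b i j"
proof -
  obtain w where w: "w \<in> W p" "\<And>i k. w (d p i k) = b i (k + j)"
    using solution_witt_vector[OF b] by blast
  note e = relations_one[OF p_pos[OF p]] relations_d[OF p]
  have "eval2 p a b (Delta_times (d p i j)) = w (d p i 0)"
  proof (rule coproduct.eval2_unit[OF coproduct_Delta_times[OF p] e _ _ _ w(1) a _ b])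
    show "eval2 p (\<lambda>i j. if i = 0 then 1 else 0) (d p) (Delta_times (d p 0 k)) = d p 0 k" for k
      by (simp only: left_right_row_0[OF p] eval2_mult[OF p e left_d_in_R2 right_d_in_R2]
          eval2_left[OF p e] eval2_right[OF p e] mult_1_left if_True simp_thms)
  qed (simp_all add: w W_0[OF w(1)] W_1[OF w(1)] assms Lambda_p.intros)
  then show ?thesis by (simp add: w(2))
qed

end

lemma delta_of_left_d: "prime p \<Longrightarrow> delta_of p (left (d p i j)) (left (d p (Suc i) j))"
  using delta_of_tgen[of p "Inl i" j] by (simp add: tgen_def)

lemma delta_of_right_d: "prime p \<Longrightarrow> delta_of p (right (d p i j)) (right (d p (Suc i) j))"
  using delta_of_tgen[of p "Inr i" j] by (simp add: tgen_def)

text \<open>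
The delta of a sum contains the deltas of the summands.
\<close>

lemma plus_lower_bound:
  assumes p: "prime p"
  shows "\<exists>w\<in>R2 p. Delta_plus (d p i j) = left (d p i j) + right (d p i j) + w"
proof -
  interpret coproduct p Delta_plus using p by (rule coproduct_Delta_plus)
  show ?thesis
  proof (induction i)
    case 0
    show ?case by (rule bexI[OF _ generated.zero]) (simp add: left_right_row_0[OF p])
  next
    case (Suc i)
    then obtain w where w: "w \<in> R2 p" "Delta_plus (d p i j) = left (d p i j) + right (d p i j) + w" by blast
    obtain w' where w': "w' \<in> R2 p" "delta_of p w w'" using R2_delta[OF p w(1)] by blast
    let ?u = "left (d p i j)" and ?v = "right (d p i j)"
    have "delta_of p (?u + ?v + w)
        (left (d p (Suc i) j) + right (d p (Suc i) j) + cross p ?u ?v + w' + cross p (?u + ?v) w)"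
      unfolding cross_def by (intro delta_of_add[OF p] delta_of_left_d delta_of_right_d w' p)
    then have "Delta_plus (d p (Suc i) j)
        = left (d p (Suc i) j) + right (d p (Suc i) j) + cross p ?u ?v + w' + cross p (?u + ?v) w"
      using delta_of_unique[OF p_pos[OF p] delta_of_\<Phi>_d[of i j]] w(2) by metis
    then have "Delta_plus (d p (Suc i) j)
        = left (d p (Suc i) j) + right (d p (Suc i) j) + (cross p ?u ?v + w' + cross p (?u + ?v) w)"
      by (simp only: add.assoc)
    moreover have "cross p ?u ?v + w' + cross p (?u + ?v) w \<in> R2 p"
      by (intro generated.add cross_in_R2 left_d_in_R2 right_d_in_R2 w w')
    ultimately show ?case by blast
  qed
qed

text \<open>
The delta of \<open>x y\<close> contains \<open>x\<^sup>p \<delta> y\<close>, so \<open>i\<close> deltas of \<open>x y\<close> contain \<open>x\<close> to the power \<open>p\<^sup>i\<close> times \<open>i\<close> deltas of \<open>y\<close>.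
\<close>

lemma times_lower_bound:
  assumes p: "prime p"
  shows "\<exists>w\<in>R2 p. Delta_times (d p i j) = right (d p 0 j) ^ (p ^ i) * left (d p i j) + w"
    and "\<exists>w\<in>R2 p. Delta_times (d p i j) = left (d p 0 j) ^ (p ^ i) * right (d p i j) + w"
proof -
  interpret coproduct p Delta_times using p by (rule coproduct_Delta_times)
  have step: "\<exists>w\<in>R2 p. Delta_times (d p (Suc i) j) = x ^ (p ^ Suc i) * y' + w"
    if IH: "\<exists>w\<in>R2 p. Delta_times (d p i j) = x ^ (p ^ i) * y + w"
      and x: "x \<in> R2 p" and y: "y \<in> R2 p" "y' \<in> R2 p" "delta_of p y y'" for i x y y'
  proof -
    obtain w where w: "w \<in> R2 p" "Delta_times (d p i j) = x ^ (p ^ i) * y + w" using IH by blast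
    obtain w' where w': "w' \<in> R2 p" "delta_of p w w'" using R2_delta[OF p w(1)] by blast
    have xi: "x ^ (p ^ i) \<in> R2 p" using x by (rule generated_power)
    obtain x' where x': "x' \<in> R2 p" "delta_of p (x ^ (p ^ i)) x'" using R2_delta[OF p xi] by blast
    let ?u = "x ^ (p ^ i) * y"
    have "delta_of p (?u + w) ((x ^ (p ^ i)) ^ p * y' + x' * Psi p y + w' + cross p ?u w)"
      unfolding cross_def by (intro delta_of_add[OF p] delta_of_mult[OF p] x' y w')
    then have "Delta_times (d p (Suc i) j) = (x ^ (p ^ i)) ^ p * y' + x' * Psi p y + w' + cross p ?u w"
      using delta_of_unique[OF p_pos[OF p] delta_of_\<Phi>_d[of i j]] w(2) by metis
    moreover have "(x ^ (p ^ i)) ^ p = x ^ (p ^ Suc i)" by (simp add: power_mult[symmetric] mult.commute)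
    ultimately have "Delta_times (d p (Suc i) j) = x ^ (p ^ Suc i) * y' + (x' * Psi p y + w' + cross p ?u w)"
      by (simp only: add.assoc)
    moreover have "x' * Psi p y + w' + cross p ?u w \<in> R2 p"
      by (intro generated.add generated.mult cross_in_R2 Psi_in_R2[OF p] xi x' y w w')
    ultimately show ?thesis by blast
  qed
  show "\<exists>w\<in>R2 p. Delta_times (d p i j) = right (d p 0 j) ^ (p ^ i) * left (d p i j) + w"
  proof (induction i)
    case 0
    show ?case by (rule bexI[OF _ generated.zero]) (simp add: left_right_row_0[OF p])
  next
    case (Suc i)
    show ?case by (rule step[OF Suc]) (intro left_d_in_R2 right_d_in_R2 delta_of_left_d[OF p])+
  qed
  show "\<exists>w\<in>R2 p. Delta_times (d p i j) = left (d p 0 j) ^ (p ^ i) * right (d p i j) + w"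
  proof (induction i)
    case 0
    show ?case by (rule bexI[OF _ generated.zero]) (simp add: left_right_row_0[OF p])
  next
    case (Suc i)
    show ?case by (rule step[OF Suc]) (intro left_d_in_R2 right_d_in_R2 delta_of_right_d[OF p])+
  qed
qed

context
  fixes p :: nat and a b :: "nat \<Rightarrow> nat \<Rightarrow> boolean"
  assumes p: "prime p" and a: "relations p Suc a" and b: "relations p Suc b"
begin

abbreviation witt_sum :: "nat \<Rightarrow> nat \<Rightarrow> boolean" where
  "witt_sum i j \<equiv> eval2 p a b (Delta_plus (d p i j))"

abbreviation witt_product :: "nat \<Rightarrow> nat \<Rightarrow> boolean" where
  "witt_product i j \<equiv> eval2 p a b (Delta_times (d p i j))"

lemmas bval_simps = bval_add[OF p a b] bval_mult[OF p a b] bval_power[OF p a b] eval2_left[OF p a b]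
  eval2_right[OF p a b] left_d_in_R2 right_d_in_R2 generated_power generated.add generated.mult

lemma eval2_relations:
  assumes "coproduct p \<Phi>"
  shows "relations p Suc (\<lambda>i j. eval2 p a b (\<Phi> (d p i j)))"
proof -
  interpret coproduct p \<Phi> by (rule assms)
  show ?thesis
    unfolding relations_def
  proof (intro allI)
    fix i j
    have "eval2 p a b (\<Phi> (d p i j) ^ p)
        = eval2 p a b (of_nat p * \<Phi> (d p (Suc i) j) + \<Phi> (d p i (Suc j)))"
      using \<Phi>_relations by (simp add: relations_def)
    then show "eval2 p a b (\<Phi> (d p i j)) ^ p
        = of_nat p * eval2 p a b (\<Phi> (d p (Suc i) j)) + eval2 p a b (\<Phi> (d p i (Suc j)))"
      by (simp add: eval2_power[OF p a b] eval2_add[OF p a b] eval2_of_nat_mult[OF p a b] \<Phi>_d_in_R2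
          generated_of_nat_mult)
  qed
qed

lemma plus_nonzero: "a i j \<noteq> 0 \<or> b i j \<noteq> 0 \<Longrightarrow> witt_sum i j \<noteq> 0"
proof -
  obtain w where w: "w \<in> R2 p" "Delta_plus (d p i j) = left (d p i j) + right (d p i j) + w"
    using plus_lower_bound[OF p] by blast
  show "a i j \<noteq> 0 \<or> b i j \<noteq> 0 \<Longrightarrow> witt_sum i j \<noteq> 0"
    unfolding w(2) by (simp only: bval_simps w(1)) auto
qed

lemma plus_everywhere_nonzero:
  assumes "a 0 j \<noteq> 0" "b 0 j \<noteq> 0" "p > 2 \<or> a 1 j \<noteq> 0 \<or> b 1 j \<noteq> 0"
  shows "witt_sum i j \<noteq> 0"
proof -
  interpret coproduct p Delta_plus using p by (rule coproduct_Delta_plus)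
  let ?u = "left (d p 0 j)" and ?v = "right (d p 0 j)"
  have X: "delta_of p (Delta_plus (d p i j)) (Delta_plus (d p (Suc i) j))" for i
    by (rule delta_of_\<Phi>_d)
  have X0: "Delta_plus (d p 0 j) = ?u + ?v + 0" "Delta_plus (d p 0 j) = ?v + ?u + 0"
    by (simp_all add: left_right_row_0[OF p] add.commute)
  note R2 = left_d_in_R2 right_d_in_R2 generated.zero
  have E: "eval2 p a b ?u \<noteq> 0" "eval2 p a b ?v \<noteq> 0"
    using assms(1,2) by (simp_all only: bval_simps) auto
  from assms(3) consider "p > 2" | "a 1 j \<noteq> 0" | "b 1 j \<noteq> 0" by blast
  then show ?thesis
  proof cases
    case 1
    show ?thesis
      by (rule delta_sequence_positive_odd[OF p a b 1, where X = "\<lambda>i. Delta_plus (d p i j)"])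
        (rule X X0(1) R2 E)+
  next
    case 2
    then have E': "eval2 p a b (left (d p 1 j)) \<noteq> 0" by (simp only: bval_simps) simp
    have v': "delta_of p ?u (left (d p 1 j))"
      using delta_of_left_d[OF p, of 0 j] by (simp only: One_nat_def)
    show ?thesis
      by (rule delta_sequence_positive[OF p a b, where X = "\<lambda>i. Delta_plus (d p i j)"])
        (rule X X0(2) R2 v' E E')+
  next
    case 3
    then have E': "eval2 p a b (right (d p 1 j)) \<noteq> 0" by (simp only: bval_simps) simp
    have v': "delta_of p ?v (right (d p 1 j))"
      using delta_of_right_d[OF p, of 0 j] by (simp only: One_nat_def)
    show ?thesis
      by (rule delta_sequence_positive[OF p a b, where X = "\<lambda>i. Delta_plus (d p i j)"])
        (rule X X0(1) R2 v' E E')+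
  qed
qed

text \<open>
For \<open>p = 2\<close> there is a single mixed term.  The first delta of \<open>z + w\<close> is \<open>\<delta> z + \<delta> w + z w\<close>, and in the next
one every term contains a delta of \<open>z\<close> or of \<open>w\<close>.  This is why \<open>1 + 1\<close> is finite in this case only.
\<close>

lemma one_plus_one:
  assumes p_2: "p = 2" and ab: "a 1 j = 0" "b 1 j = 0"
  shows "witt_sum 2 j = 0" and "a 0 j \<noteq> 0 \<Longrightarrow> b 0 j \<noteq> 0 \<Longrightarrow> witt_sum 1 j \<noteq> 0"
proof -
  interpret coproduct p Delta_plus using p by (rule coproduct_Delta_plus)
  let ?l = "\<lambda>i. left (d p i j)" and ?r = "\<lambda>i. right (d p i j)"
  note del = delta_of_left_d[OF p] delta_of_right_d[OF p]
  have "delta_of p (?l 0 + ?r 0) (?l (Suc 0) + ?r (Suc 0) + cross p (?l 0) (?r 0))"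
    unfolding cross_def by (intro delta_of_add[OF p] del)
  then have D1: "Delta_plus (d p (Suc 0) j) = ?l (Suc 0) + ?r (Suc 0) + ?l 0 * ?r 0"
    using delta_of_unique[OF p_pos[OF p] delta_of_\<Phi>_d[of 0 j]] left_right_row_0(1)[OF p, of j]
      cross_2[of "?l 0" "?r 0"] p_2 by metis
  have "delta_of p (?l (Suc 0) + ?r (Suc 0) + ?l 0 * ?r 0)
    (?l (Suc (Suc 0)) + ?r (Suc (Suc 0)) + cross p (?l (Suc 0)) (?r (Suc 0))
      + (?l 0 ^ p * ?r (Suc 0) + ?l (Suc 0) * Psi p (?r 0))
      + cross p (?l (Suc 0) + ?r (Suc 0)) (?l 0 * ?r 0))"
    unfolding cross_def by (intro delta_of_add[OF p] delta_of_mult[OF p] del)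
  then have D2: "Delta_plus (d p 2 j) = ?l 2 + ?r 2 + cross p (?l 1) (?r 1)
      + (?l 0 ^ p * ?r 1 + ?l 1 * Psi p (?r 0)) + cross p (?l 1 + ?r 1) (?l 0 * ?r 0)"
    using delta_of_unique[OF p_pos[OF p] delta_of_\<Phi>_d[of "Suc 0" j]] D1
    unfolding One_nat_def numeral_2_eq_2 by metis
  have D2: "Delta_plus (d p 2 j) = ?l 2 + ?r 2 + ?l 1 * ?r 1
      + (?l 0 ^ p * ?r 1 + ?l 1 * Psi p (?r 0)) + (?l 1 + ?r 1) * (?l 0 * ?r 0)"
    unfolding D2 using cross_2 p_2 by metis
  have "a 2 j = 0" "b 2 j = 0"
    using boolean_solution_mono[OF a p_pos[OF p] ab(1), of 2 j]
      boolean_solution_mono[OF b p_pos[OF p] ab(2), of 2 j] by simp_all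
  then show "witt_sum 2 j = 0"
    unfolding D2 using ab by (simp only: bval_simps Psi_in_R2[OF p]) simp
  have "a 0 j \<noteq> 0 \<Longrightarrow> b 0 j \<noteq> 0 \<Longrightarrow> witt_sum (Suc 0) j \<noteq> 0"
    unfolding D1 by (simp only: bval_simps) simp
  then show "a 0 j \<noteq> 0 \<Longrightarrow> b 0 j \<noteq> 0 \<Longrightarrow> witt_sum 1 j \<noteq> 0" by simp
qed

lemma times_nonzero: "a i j \<noteq> 0 \<Longrightarrow> b 0 j \<noteq> 0 \<Longrightarrow> witt_product i j \<noteq> 0"
  "a 0 j \<noteq> 0 \<Longrightarrow> b i j \<noteq> 0 \<Longrightarrow> witt_product i j \<noteq> 0"
proof -
  obtain w where w: "w \<in> R2 p" "Delta_times (d p i j) = right (d p 0 j) ^ (p ^ i) * left (d p i j) + w"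
    using times_lower_bound(1)[OF p] by blast
  show "a i j \<noteq> 0 \<Longrightarrow> b 0 j \<noteq> 0 \<Longrightarrow> witt_product i j \<noteq> 0"
    unfolding w(2) by (simp only: bval_simps w(1)) simp
  obtain w where w: "w \<in> R2 p" "Delta_times (d p i j) = left (d p 0 j) ^ (p ^ i) * right (d p i j) + w"
    using times_lower_bound(2)[OF p] by blast
  show "a 0 j \<noteq> 0 \<Longrightarrow> b i j \<noteq> 0 \<Longrightarrow> witt_product i j \<noteq> 0"
    unfolding w(2) by (simp only: bval_simps w(1)) simp
qed

lemma times_row_0: "witt_product 0 j = a 0 j * b 0 j"
  by (simp only: left_right_row_0[OF p] eval2_mult[OF p a b left_d_in_R2 right_d_in_R2]
      eval2_left[OF p a b] eval2_right[OF p a b])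

text \<open>
The first delta of \<open>z w\<close> is \<open>z\<^sup>p \<delta> w + \<delta> z \<psi> w\<close>, from where the positivity argument starts with
\<open>v = z\<^sup>p \<delta> w\<close>: the delta of \<open>v\<close> contains \<open>\<delta> (z\<^sup>p) \<psi> (\<delta> w)\<close>, and \<open>\<delta> (z\<^sup>p)\<close> contains \<open>z\<^sup>(\<^sup>p\<^sup>-\<^sup>1\<^sup>)\<^sup>p \<delta> z\<close>.
\<close>

lemma times_everywhere_nonzero:
  assumes pos: "\<And>j. a 0 j \<noteq> 0" "\<And>j. b 0 j \<noteq> 0" "\<And>j. a 1 j \<noteq> 0" "\<And>j. b 1 j \<noteq> 0"
  shows "witt_product i j \<noteq> 0"
proof (cases i)
  case 0
  then show ?thesis using pos times_row_0 by simp
next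
  case (Suc n)
  interpret coproduct p Delta_times using p by (rule coproduct_Delta_times)
  let ?z = "left (d p 0 j)" and ?z' = "left (d p 1 j)" and ?w = "right (d p 0 j)" and ?w' = "right (d p 1 j)"
  have z: "delta_of p ?z ?z'" and w: "delta_of p ?w ?w'"
    using delta_of_left_d[OF p, of 0 j] delta_of_right_d[OF p, of 0 j] by (simp_all only: One_nat_def)
  have Psi_w: "Psi p ?w = right (d p 0 (Suc j))" "Psi p ?w' = right (d p 1 (Suc j))"
    by (simp_all only: Psi_right[OF p_pos[OF p]] Psi_d[OF p])
  have Psi_z: "Psi p ?z = left (d p 0 (Suc j))"
    by (simp_all only: Psi_left[OF p_pos[OF p]] Psi_d[OF p])
  note R2 = left_d_in_R2 right_d_in_R2 generated.zero generated.mult generated.add generated_power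
  have X0: "Delta_times (d p (Suc 0) j) = ?z' * Psi p ?w + ?z ^ p * ?w' + 0"
    using delta_of_unique[OF p_pos[OF p] delta_of_\<Phi>_d[of 0 j], unfolded left_right_row_0[OF p],
        OF delta_of_mult[OF p z w]] by (simp add: add.commute)
  obtain y where y: "y \<in> R2 p" "delta_of p (?z ^ (p - 1)) y"
    using R2_delta[OF p generated_power[OF left_d_in_R2]] by blast
  have "?z ^ (p - 1) * ?z = ?z ^ p"
    using p_pos[OF p] by (simp add: power_eq_if mult.commute)
  then have zp: "delta_of p (?z ^ p) ((?z ^ (p - 1)) ^ p * ?z' + y * Psi p ?z)"
    using delta_of_mult[OF p y(2) z] by simp
  obtain w'' where w'': "w'' \<in> R2 p" "delta_of p ?w' w''" using R2_delta[OF p right_d_in_R2] by blast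
  let ?v' = "(?z ^ p) ^ p * w'' + ((?z ^ (p - 1)) ^ p * ?z' + y * Psi p ?z) * Psi p ?w'"
  have v': "delta_of p (?z ^ p * ?w') ?v'" by (rule delta_of_mult[OF p zp w''(2)])
  have v'_R2: "?v' \<in> R2 p" unfolding Psi_z Psi_w by (intro R2 y w'')
  have E: "eval2 p a b (?z' * Psi p ?w) \<noteq> 0" "eval2 p a b (?z ^ p * ?w') \<noteq> 0" "eval2 p a b ?v' \<noteq> 0"
    unfolding Psi_z Psi_w by (simp_all only: bval_simps y(1) w''(1)) (use pos in simp_all)
  have u: "?z' * Psi p ?w \<in> R2 p" "?z ^ p * ?w' \<in> R2 p"
    unfolding Psi_w by (intro R2)+
  show ?thesis
    unfolding Suc
    by (rule delta_sequence_positive[OF p a b, where X = "\<lambda>i. Delta_times (d p (Suc i) j)"])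
      (rule delta_of_\<Phi>_d X0 u v'_R2 generated.zero v' E)+
qed

end


section \<open>The operations in coordinates\<close>

fun coord_add :: "nat \<Rightarrow> coord \<Rightarrow> coord \<Rightarrow> coord" where
  "coord_add p Infty v = Infty"
| "coord_add p (Pt x y) Infty = Infty"
| "coord_add p (Pt x y) (Pt x' y') =
    (if x = 0 then Pt x' (max y y') else if x' = 0 then Pt x (max y y')
     else if p = 2 \<and> x = 1 \<and> x' = 1 then Pt 2 (max y y') else Infty)"

fun coord_mult :: "coord \<Rightarrow> coord \<Rightarrow> coord" where
  "coord_mult Infty Infty = Infty"
| "coord_mult Infty (Pt x y) = (if x = 0 then Pt 0 y else Infty)"
| "coord_mult (Pt x y) Infty = (if x = 0 then Pt 0 y else Infty)"
| "coord_mult (Pt x y) (Pt x' y') =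
    (if x = 0 \<and> x' = 0 then Pt 0 (min y y') else if x = 0 then Pt 0 y else if x' = 0 then Pt 0 y'
     else if x = 1 then Pt x' (max y y') else if x' = 1 then Pt x (max y y') else Infty)"

lemma pattern_Pt_0_of_row:
  assumes c: "relations p Suc c" "p > 0" and row: "\<And>j. c 0 j = 0 \<longleftrightarrow> y \<le> j"
  shows "c = pattern (Pt 0 y)"
proof -
  obtain u where u: "c = pattern u" using boolean_solution_pattern[OF c] by blast
  have "c 0 y = 0" using row by simp
  then obtain x y' where "u = Pt x y'" using u by (cases u) auto
  then have *: "x \<le> 0 \<and> y' \<le> j \<longleftrightarrow> y \<le> j" for j using row[of j] u by (simp add: pattern_eq_0)
  have "x = 0" "y' = y" using *[of y] *[of y'] by auto
  then show ?thesis using u \<open>u = Pt x y'\<close> by simp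
qed

text \<open>
In the columns \<open>j < max y y'\<close> one of the summands is nonzero, and so is the sum.  In the other columns the
summands look like \<open>(x, 0)\<close> and \<open>(x', 0)\<close>, and the unit law or the positivity argument applies.
\<close>

lemma plus_pattern:
  assumes p: "prime p"
  shows "eval2 p (pattern u) (pattern v) (Delta_plus (d p i j)) = pattern (coord_add p u v) i j"
proof -
  note rel = relations_pattern[OF p_pos[OF p]]
  let ?c = "\<lambda>i j. eval2 p (pattern u) (pattern v) (Delta_plus (d p i j))"
  have c: "relations p Suc ?c" by (rule eval2_relations[OF p rel rel coproduct_Delta_plus[OF p]])
  note mono = boolean_solution_mono[OF c p_pos[OF p]]
  note nonzero = plus_nonzero[OF p rel rel, of u _ _ v]
  show ?thesis
  proof (cases u; cases v)
    fix x y x' y' assume uv: "u = Pt x y" "v = Pt x' y'"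
    have low: "?c i j \<noteq> 0" if "j < max y y'" for i j
      using that by (intro nonzero) (auto simp: uv pattern_eq_0)
    consider "x = 0" | "x > 0" "x' = 0" | "x = 1" "x' = 1" "p = 2"
      | "x > 0" "x' > 0" "\<not> (p = 2 \<and> x = 1 \<and> x' = 1)" by fastforce
    then show ?thesis
    proof cases
      case 1
      have "?c i j = 0 \<longleftrightarrow> x' \<le> i \<and> max y y' \<le> j"
      proof (cases "j < max y y'")
        case False
        then have "?c i j = pattern v i j"
          by (intro plus_zero_left[OF p rel rel]) (simp add: uv pattern_eq_0 1)
        then show ?thesis using False by (auto simp: uv pattern_eq_0)
      qed (use low[of j i] in auto)
      then show ?thesis by (intro boolean_eqI) (simp add: uv pattern_eq_0 1)
    next
      case 2
      have "?c i j = 0 \<longleftrightarrow> x \<le> i \<and> max y y' \<le> j"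
      proof (cases "j < max y y'")
        case False
        then have "?c i j = pattern u i j"
          by (intro plus_zero_right[OF p rel rel]) (simp add: uv pattern_eq_0 2)
        then show ?thesis using False by (auto simp: uv pattern_eq_0)
      qed (use low[of j i] in auto)
      then show ?thesis using 2 by (intro boolean_eqI) (simp add: uv pattern_eq_0)
    next
      case 3
      have "?c i j = 0 \<longleftrightarrow> 2 \<le> i \<and> max y y' \<le> j"
      proof (cases "j < max y y'")
        case False
        then have ab: "pattern u 1 j = 0" "pattern v 1 j = 0" "pattern u 0 j \<noteq> 0" "pattern v 0 j \<noteq> 0"
          by (auto simp: uv pattern_eq_0 3)
        note two = one_plus_one[OF p rel rel 3(3) ab(1,2)]
        show ?thesis
        proof (cases "2 \<le> i")
          case True
          then show ?thesis using False mono[OF two(1), of i j] by auto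
        next
          case low_i: False
          then have "i = 0 \<or> i = 1" by auto
          then have "?c i j \<noteq> 0" using two(2)[OF ab(3,4)] nonzero[of 0 j] ab(3) by auto
          then show ?thesis using low_i by simp
        qed
      qed (use low[of j i] in auto)
      then show ?thesis using 3 by (intro boolean_eqI) (simp add: uv pattern_eq_0)
    next
      case 4
      have "p > 2 \<or> x > 1 \<or> x' > 1" using 4 prime_ge_2_nat[OF p] by auto
      then have "?c i j \<noteq> 0"
        using 4 by (intro plus_everywhere_nonzero[OF p rel rel]) (auto simp: uv pattern_eq_0)
      then show ?thesis using 4 boolean_0_1 by (auto simp: uv)
    qed
  qed (use nonzero boolean_0_1 in auto)
qed

text \<open>
If the product has a zero in row \<open>0\<close>, that row determines it.  Otherwise both factors are lower
bounds for the product, and the unit law or the positivity argument gives the rest.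
\<close>

lemma times_pattern:
  assumes p: "prime p"
  shows "eval2 p (pattern u) (pattern v) (Delta_times (d p i j)) = pattern (coord_mult u v) i j"
proof -
  note rel = relations_pattern[OF p_pos[OF p]]
  let ?c = "\<lambda>i j. eval2 p (pattern u) (pattern v) (Delta_times (d p i j))"
  have c: "relations p Suc ?c" by (rule eval2_relations[OF p rel rel coproduct_Delta_times[OF p]])
  have row: "?c 0 j = 0 \<longleftrightarrow> pattern u 0 j = 0 \<or> pattern v 0 j = 0" for j
    by (simp add: times_row_0[OF p rel rel])
  note nonzero = times_nonzero[OF p rel rel]
  have finite_row: ?thesis if "coord_mult u v = Pt 0 y" "\<And>j. pattern u 0 j = 0 \<or> pattern v 0 j = 0 \<longleftrightarrow> y \<le> j" for y
    using pattern_Pt_0_of_row[OF c p_pos[OF p], of y] row that by (metis (no_types, lifting))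
  have infinite: ?thesis if "coord_mult u v = Infty" "?c i j \<noteq> 0"
    using that boolean_0_1 by auto
  show ?thesis
  proof (cases u; cases v)
    assume "u = Infty" "v = Infty"
    then show ?thesis by (intro infinite nonzero(1)) auto
  next
    fix x y assume uv: "u = Infty" "v = Pt x y"
    show ?thesis
    proof (cases "x = 0")
      case True
      then show ?thesis by (intro finite_row[of y]) (auto simp: uv pattern_eq_0)
    next
      case False
      then show ?thesis by (intro infinite nonzero(1)) (auto simp: uv pattern_eq_0)
    qed
  next
    fix x y assume uv: "u = Pt x y" "v = Infty"
    show ?thesis
    proof (cases "x = 0")
      case True
      then show ?thesis by (intro finite_row[of y]) (auto simp: uv pattern_eq_0)
    next
      case False
      then show ?thesis by (intro infinite nonzero(2)) (auto simp: uv pattern_eq_0)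
    qed
  next
    fix x y x' y' assume uv: "u = Pt x y" "v = Pt x' y'"
    consider "x = 0" "x' = 0" | "x = 0" "x' > 0" | "x > 0" "x' = 0" | "x = 1" "x' > 0"
      | "x > 1" "x' = 1" | "x > 1" "x' > 1" by fastforce
    then show ?thesis
    proof cases
      case 1
      then show ?thesis by (intro finite_row[of "min y y'"]) (auto simp: uv pattern_eq_0)
    next
      case 2
      then show ?thesis by (intro finite_row[of y]) (auto simp: uv pattern_eq_0)
    next
      case 3
      then show ?thesis by (intro finite_row[of y']) (auto simp: uv pattern_eq_0)
    next
      case 4
      have "?c i j = 0 \<longleftrightarrow> x' \<le> i \<and> max y y' \<le> j"
      proof (cases "y \<le> j")
        case True
        then have "pattern u i (k + j) = (if i = 0 then 1 else 0)" for i k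
          using 4 by (intro boolean_eqI) (auto simp: uv pattern_eq_0)
        then have "?c i j = pattern v i j" by (rule times_one_left[OF p rel rel])
        then show ?thesis using True by (simp add: uv pattern_eq_0)
      next
        case False
        then have "?c i j \<noteq> 0" using 4 by (intro nonzero(1)) (auto simp: uv pattern_eq_0)
        then show ?thesis using False by simp
      qed
      then show ?thesis using 4 by (intro boolean_eqI) (simp add: uv pattern_eq_0)
    next
      case 5
      have "?c i j = 0 \<longleftrightarrow> x \<le> i \<and> max y y' \<le> j"
      proof (cases "y' \<le> j")
        case True
        then have "pattern v i (k + j) = (if i = 0 then 1 else 0)" for i k
          using 5 by (intro boolean_eqI) (auto simp: uv pattern_eq_0)
        then have "?c i j = pattern u i j" by (rule times_one_right[OF p rel rel])
        then show ?thesis using True by (simp add: uv pattern_eq_0)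
      next
        case False
        then have "?c i j \<noteq> 0" using 5 by (intro nonzero(2)) (auto simp: uv pattern_eq_0)
        then show ?thesis using False by simp
      qed
      then show ?thesis using 5 by (intro boolean_eqI) (simp add: uv pattern_eq_0)
    next
      case 6
      then have "?c i j \<noteq> 0"
        by (intro times_everywhere_nonzero[OF p rel rel]) (auto simp: uv pattern_eq_0)
      then show ?thesis using 6 by (intro infinite) (auto simp: uv)
    qed
  qed
qed

lemma witt_of_properties:
  assumes p: "prime p"
  shows "witt_of p u \<in> W p \<and> (\<forall>i j. witt_of p u (d p i j) = pattern u i j)"
proof -
  obtain a where a: "a \<in> W p" "\<And>i j. a (d p i j) = pattern u i j"
    using witt_vector_exists[OF p relations_pattern[OF p_pos[OF p]]] by blast
  have unique: "b = a" if "b \<in> W p" "\<And>i j. b (d p i j) = pattern u i j" for b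
    using that a by (intro W_eqI) auto
  have "witt_of p u = a"
  proof (cases u)
    case (Pt x y)
    have "b (d p i j) = pattern u i j" if "\<forall>i j. b (d p i j) = 0 \<longleftrightarrow> i \<ge> x \<and> j \<ge> y" for b i j
      using that by (intro boolean_eqI) (simp add: Pt pattern_eq_0)
    then show ?thesis
      unfolding Pt witt_of.simps
      by (intro the_equality conjI a unique) (auto simp: a Pt pattern_eq_0)
  next
    case Infty
    show ?thesis
      unfolding Infty witt_of.simps
      by (intro the_equality conjI a unique) (auto simp: a Infty)
  qed
  with a show ?thesis by simp
qed

lemma witt_of_eqI:
  assumes p: "prime p" and "a \<in> W p" "\<And>i j. a (d p i j) = pattern u i j"
  shows "a = witt_of p u"
  using assms witt_of_properties[OF p, of u] by (intro W_eqI) auto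

lemma bij_witt_of:
  assumes p: "prime p"
  shows "bij_betw (witt_of p) UNIV (W p)"
  unfolding bij_betw_def
proof
  show "inj (witt_of p)"
  proof (rule injI)
    fix u v assume "witt_of p u = witt_of p v"
    then have "pattern u = pattern v" using witt_of_properties[OF p] by (intro ext) metis
    then show "u = v" by (rule pattern_inj)
  qed
  show "range (witt_of p) = W p"
  proof
    show "range (witt_of p) \<subseteq> W p" using witt_of_properties[OF p] by blast
    show "W p \<subseteq> range (witt_of p)"
    proof
      fix a :: "nat pseries \<Rightarrow> boolean" assume a: "a \<in> W p"
      obtain u where u: "coords p a = pattern u"
        using boolean_solution_pattern[OF relations_coords[OF p a] p_pos[OF p]] by blast
      have "a (d p i j) = pattern u i j" for i j
        using fun_cong[OF fun_cong[OF u], of i j] by (simp add: coords_def)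
      then have "a = witt_of p u" by (rule witt_of_eqI[OF p a])
      then show "a \<in> range (witt_of p)" by blast
    qed
  qed
qed


section \<open>Zero and one\<close>

lemma Lambda_p_nonneg: "prime p \<Longrightarrow> f \<in> Lambda_p p \<Longrightarrow> nonneg f"
  by (erule Lambda_p.induct) (auto intro: nonneg_0 nonneg_1 nonneg_d nonneg_add nonneg_mult)

lemma witt_zero:
  assumes p: "prime p"
  shows "(\<lambda>f\<in>Lambda_p p. of_nat (nat (pcoeff f 0))) = witt_of p (Pt 0 0)"
proof (rule witt_of_eqI[OF p])
  have pos: "pcoeff f 0 \<ge> 0" if "f \<in> Lambda_p p" for f
    using Lambda_p_nonneg[OF p that] by (simp add: nonneg_def)
  show "(\<lambda>f\<in>Lambda_p p. of_nat (nat (pcoeff f 0))) \<in> W p"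
    unfolding W_iff
    by (auto simp: Lambda_p.intros pcoeff_one pcoeff_mult_0 nat_add_distrib nat_mult_distrib pos)
  show "(\<lambda>f\<in>Lambda_p p. of_nat (nat (pcoeff f 0))) (d p i j) = pattern (Pt 0 0) i j" for i j
    by (simp add: Lambda_p.gen pcoeff_d_0[OF p] pattern.simps(1))
qed

text \<open>
The polynomial \<open>q\<close> is \<open>f(x\<^sub>0, 0, 0, \<dots>)\<close>.  This is a relation because \<open>f(x\<^sub>0, 0, 0, \<dots>)\<close> is a polynomial for
symmetric functions of bounded degree, but not for all series.
\<close>

definition first_variable :: "nat pseries \<Rightarrow> int poly \<Rightarrow> bool" where
  "first_variable f q \<longleftrightarrow> (\<forall>k. poly.coeff q k = pcoeff f (single 0 k))"

definition at_one :: "nat pseries \<Rightarrow> int" where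
  "at_one f = (\<Sum>k | pcoeff f (single 0 k) \<noteq> 0. pcoeff f (single 0 k))"

lemma at_one_eq: "first_variable f q \<Longrightarrow> at_one f = poly q 1"
proof -
  assume q: "first_variable f q"
  have "at_one f = (\<Sum>k | poly.coeff q k \<noteq> 0. poly.coeff q k)"
    using q by (simp add: at_one_def first_variable_def)
  also have "\<dots> = (\<Sum>k\<le>degree q. poly.coeff q k)"
    by (rule sum.mono_neutral_left) (auto intro: le_degree)
  finally show ?thesis by (simp add: poly_altdef)
qed

lemma first_variable_add:
  "first_variable f q \<Longrightarrow> first_variable g r \<Longrightarrow> first_variable (f + g) (q + r)"
  by (simp add: first_variable_def)

lemma splits_single: "splits (single (0 :: nat) k) = (\<lambda>i. (single 0 i, single 0 (k - i))) ` {..k}"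
proof
  show "(\<lambda>i. (single 0 i, single 0 (k - i))) ` {..k} \<subseteq> splits (single (0 :: nat) k)"
    by (auto simp flip: single_add)
  show "splits (single (0 :: nat) k) \<subseteq> (\<lambda>i. (single 0 i, single 0 (k - i))) ` {..k}"
  proof
    fix x assume "x \<in> splits (single (0 :: nat) k)"
    then obtain u v where x: "x = (u, v)" and uv: "u + v = single 0 k" by auto
    have at: "lookup u n + lookup v n = (if n = 0 then k else 0)" for n
      using arg_cong[OF uv, of "\<lambda>m. lookup m n"] by (simp add: lookup_add lookup_single when_def)
    have "lookup u 0 + lookup v 0 = k" using at[of 0] by simp
    moreover have "lookup u n = 0" "lookup v n = 0" if "n \<noteq> 0" for n
      using at[of n] that by simp_all
    ultimately have "u = single 0 (lookup u 0)" "v = single 0 (k - lookup u 0)" "lookup u 0 \<le> k"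
      by (auto simp: poly_mapping_eq_iff fun_eq_iff lookup_single when_def)
    then show "x \<in> (\<lambda>i. (single 0 i, single 0 (k - i))) ` {..k}" unfolding x by blast
  qed
qed

lemma first_variable_mult:
  assumes "first_variable f q" "first_variable g r"
  shows "first_variable (f * g) (q * r)"
  unfolding first_variable_def
proof
  fix k :: nat
  have "inj_on (\<lambda>i. (single (0 :: nat) i, single (0 :: nat) (k - i))) {..k}"
    by (auto simp: inj_on_def dest: arg_cong[of _ _ "\<lambda>m. lookup m 0"])
  then show "poly.coeff (q * r) k = pcoeff (f * g) (single 0 k)"
    using assms
    by (simp add: coeff_mult pcoeff_mult splits_single sum.reindex first_variable_def)
qed

lemma first_variable_1: "first_variable 1 1"
  by (auto simp: first_variable_def pcoeff_one poly_mapping_eq_iff fun_eq_iff lookup_single when_def)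

lemma first_variable_power: "first_variable f q \<Longrightarrow> first_variable (f ^ n) (q ^ n)"
  by (induction n) (auto intro: first_variable_1 first_variable_mult)

lemma first_variable_of_nat_cancel: "first_variable (of_nat n * f) 0 \<Longrightarrow> n > 0 \<Longrightarrow> first_variable f 0"
  by (simp add: first_variable_def)

lemma first_variable_d:
  assumes p: "prime p"
  shows "first_variable (d p i j) (if i = 0 then monom 1 (p ^ j) else 0)"
proof (induction i arbitrary: j)
  case 0
  have "(\<exists>i. single (0 :: nat) k = single i (p ^ j)) \<longleftrightarrow> p ^ j = k" for k
  proof
    assume "\<exists>i. single (0 :: nat) k = single i (p ^ j)"
    then obtain i where "single (0 :: nat) k = single i (p ^ j)" ..
    from arg_cong[OF this, of "\<lambda>m. lookup m i"] show "p ^ j = k"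
      using p_pos[OF p] by (simp add: lookup_single when_def split: if_splits)
  qed auto
  then show ?case by (simp add: d_0[OF p] first_variable_def power_sum_def coeff_monom)
next
  case (Suc i)
  let ?q = "\<lambda>i j. if i = 0 then monom 1 (p ^ j) else 0 :: int poly"
  have "?q i j ^ p = ?q i (Suc j)"
    using p_pos[OF p] by (simp add: monom_power mult.commute zero_power)
  then have "first_variable (d p i j ^ p) (?q i (Suc j))"
    using first_variable_power[OF Suc[of j], of p] by simp
  then have "first_variable (of_nat p * d p (Suc i) j + d p i (Suc j)) (?q i (Suc j))"
    by (simp only: d_rel[OF p])
  with Suc[of "Suc j"] have "first_variable (of_nat p * d p (Suc i) j) 0"
    by (simp add: first_variable_def)
  then show ?case using first_variable_of_nat_cancel p_pos[OF p] by simp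
qed

lemma first_variable_exists: "prime p \<Longrightarrow> f \<in> Lambda_p p \<Longrightarrow> \<exists>q. first_variable f q"
proof (erule Lambda_p.induct)
  show "\<exists>q. first_variable 0 q" by (intro exI[of _ 0]) (simp add: first_variable_def)
qed (use first_variable_1 first_variable_d first_variable_add first_variable_mult in blast)+

lemma witt_one:
  assumes p: "prime p"
  shows "(\<lambda>f\<in>Lambda_p p. of_nat (nat (\<Sum>k | pcoeff f (single 0 k) \<noteq> 0. pcoeff f (single 0 k))))
    = witt_of p (Pt 1 0)"
  unfolding at_one_def[symmetric]
proof (rule witt_of_eqI[OF p])
  have pos: "at_one f \<ge> 0" if "f \<in> Lambda_p p" for f
    using Lambda_p_nonneg[OF p that] by (auto simp: nonneg_def at_one_def intro!: sum_nonneg)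
  have hom: "at_one (f + g) = at_one f + at_one g" "at_one (f * g) = at_one f * at_one g"
    if fg: "f \<in> Lambda_p p" "g \<in> Lambda_p p" for f g
  proof -
    obtain q r where "first_variable f q" "first_variable g r"
      using first_variable_exists[OF p] fg by blast
    then show "at_one (f + g) = at_one f + at_one g" "at_one (f * g) = at_one f * at_one g"
      using at_one_eq first_variable_add first_variable_mult by (metis poly_add, metis poly_mult)
  qed
  have "at_one 0 = 0" "at_one 1 = 1"
    using at_one_eq[OF first_variable_1] by (simp_all add: at_one_def)
  then show "(\<lambda>f\<in>Lambda_p p. of_nat (nat (at_one f))) \<in> W p"
    unfolding W_iff
    by (auto simp: Lambda_p.intros hom nat_add_distrib nat_mult_distrib pos)
  show "(\<lambda>f\<in>Lambda_p p. of_nat (nat (at_one f))) (d p i j) = pattern (Pt 1 0) i j" for i j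
    using at_one_eq[OF first_variable_d[OF p], of i j]
    by (simp add: Lambda_p.gen pattern.simps(1) poly_monom)
qed


section \<open>The semiring of coordinates\<close>

lemma coord_semiring_eq:
  assumes p: "prime p"
  shows "coord_semiring p = \<lparr>carrier = UNIV, monoid.mult = coord_mult, one = Pt 1 0, zero = Pt 0 0,
    add = coord_add p\<rparr>"
proof -
  let ?\<phi> = "witt_of p" and ?R = "witt_semiring p :: (nat pseries \<Rightarrow> boolean) ring"
  have inj: "inj ?\<phi>" using bij_witt_of[OF p] by (simp add: bij_betw_def)
  have inv: "the_inv_into UNIV ?\<phi> (?\<phi> u) = u" for u by (rule the_inv_into_f_f[OF inj]) simp
  have W: "?\<phi> u \<in> W p" and coords: "coords p (?\<phi> u) = pattern u" for u
    using witt_of_properties[OF p, of u] by (auto simp: coords_def intro!: ext)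
  have add: "?\<phi> u \<oplus>\<^bsub>?R\<^esub> ?\<phi> v = ?\<phi> (coord_add p u v)" for u v
    unfolding witt_semiring_def ring.simps
    by (rule witt_of_eqI[OF p coproduct.convolution(1)[OF coproduct_Delta_plus[OF p] W W]])
      (simp only: coproduct.convolution(2)[OF coproduct_Delta_plus[OF p] W W] coords plus_pattern[OF p])
  have mult: "?\<phi> u \<otimes>\<^bsub>?R\<^esub> ?\<phi> v = ?\<phi> (coord_mult u v)" for u v
    unfolding witt_semiring_def monoid.simps
    by (rule witt_of_eqI[OF p coproduct.convolution(1)[OF coproduct_Delta_times[OF p] W W]])
      (simp only: coproduct.convolution(2)[OF coproduct_Delta_times[OF p] W W] coords times_pattern[OF p])
  have zero: "\<zero>\<^bsub>?R\<^esub> = ?\<phi> (Pt 0 0)" using witt_zero[OF p] by (simp add: witt_semiring_def)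
  have one: "\<one>\<^bsub>?R\<^esub> = ?\<phi> (Pt 1 0)" unfolding witt_one[OF p, symmetric] by (simp add: witt_semiring_def)
  show ?thesis
    unfolding coord_semiring_def Let_def add mult zero one inv ..
qed

lemma coord_add_assoc: "coord_add p (coord_add p u v) w = coord_add p u (coord_add p v w)"
  by (cases u; cases v; cases w) (auto simp: max.assoc)

lemma coord_add_commute: "coord_add p u v = coord_add p v u"
  by (cases u; cases v) (auto simp: max.commute)

lemma coord_mult_assoc: "coord_mult (coord_mult u v) w = coord_mult u (coord_mult v w)"
  by (cases u; cases v; cases w) (auto simp: max.assoc min.assoc)

lemma coord_mult_commute: "coord_mult u v = coord_mult v u"
  by (cases u; cases v) (auto simp: max.commute min.commute)

lemma coord_distrib: "coord_mult (coord_add p u v) w = coord_add p (coord_mult u w) (coord_mult v w)"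
  by (cases u; cases v; cases w) (auto simp: max_def min_def)

lemma comm_semiring_coord_semiring:
  assumes p: "prime p"
  shows "comm_semiring (coord_semiring p)"
proof -
  have null: "coord_mult u (Pt 0 0) = Pt 0 0" "coord_mult (Pt 0 0) u = Pt 0 0"
    and unit: "coord_mult (Pt (Suc 0) 0) u = u" "coord_add p (Pt 0 0) u = u" for u
    by (cases u; auto)+
  have distrib: "coord_mult w (coord_add p u v) = coord_add p (coord_mult w u) (coord_mult w v)" for u v w
    using coord_distrib[of p u v w] by (simp only: coord_mult_commute)
  have "Group.comm_monoid (coord_semiring p)"
    unfolding coord_semiring_eq[OF p]
    by (rule comm_monoidI; simp add: unit) (rule coord_mult_assoc coord_mult_commute)+
  moreover have "abelian_monoid (coord_semiring p)"
    unfolding coord_semiring_eq[OF p]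
    by (rule abelian_monoidI; simp add: unit) (rule coord_add_assoc coord_add_commute)+
  ultimately show ?thesis
    unfolding comm_semiring_def Ring.semiring_def semiring_axioms_def coord_semiring_eq[OF p]
    by (simp add: comm_monoid.axioms coord_distrib distrib null)
qed

lemma nat_hom_coord_semiring:
  assumes p: "prime p"
  shows "h \<in> semiring_hom (semiring_on (UNIV :: nat set)) (coord_semiring p) \<longleftrightarrow>
    h = (\<lambda>n. if n \<le> 1 \<or> (p = 2 \<and> n \<le> 2) then Pt n 0 else Infty)" (is "_ \<longleftrightarrow> h = ?h")
proof
  assume "h \<in> semiring_hom (semiring_on (UNIV :: nat set)) (coord_semiring p)"
  then have hom: "h 0 = Pt 0 0" "h 1 = Pt 1 0" "\<And>m n. h (m + n) = coord_add p (h m) (h n)"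
    unfolding semiring_hom_def ring_hom_def semiring_on_def coord_semiring_eq[OF p] by auto
  show "h = ?h"
  proof
    fix n
    show "h n = ?h n"
    proof (induction n)
      case (Suc n)
      have "h (Suc n) = coord_add p (h n) (Pt 1 0)" using hom(3)[of n 1] hom(2) by simp
      then show ?case unfolding Suc.IH by auto
    qed (simp add: hom)
  qed
next
  assume h: "h = ?h"
  have "h (m + n) = coord_add p (h m) (h n)" "h (m * n) = coord_mult (h m) (h n)" for m n
  proof -
    consider "m = 0" | "m = 1" | "m = 2" | "m > 2" by linarith
    note m = this
    consider "n = 0" | "n = 1" | "n = 2" | "n > 2" by linarith
    note n = this
    show "h (m + n) = coord_add p (h m) (h n)"
      by (rule m; rule n) (auto simp: h)
    have "m * n > 2" if "m > 2 \<and> n > 0 \<or> n > 2 \<and> m > 0 \<or> m = 2 \<and> n = 2"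
      using that by (cases m; cases n) auto
    then show "h (m * n) = coord_mult (h m) (h n)"
      by (rule_tac m; rule_tac n) (auto simp: h)
  qed
  then show "h \<in> semiring_hom (semiring_on (UNIV :: nat set)) (coord_semiring p)"
    unfolding semiring_hom_def ring_hom_def semiring_on_def coord_semiring_eq[OF p] by (auto simp: h)
qed

theorem proposition8p3:
  fixes p :: nat
  assumes "prime p"
  shows
    "bij_betw (witt_of p) UNIV (W p) \<and>
     (\<forall>x y i j. witt_of p (Pt x y) (d p i j) = 0 \<longleftrightarrow> i \<ge> x \<and> j \<ge> y) \<and>
     (\<forall>i j. witt_of p Infty (d p i j) = 1) \<and>
     comm_semiring (coord_semiring p) \<and>
     (\<exists>!h. h \<in> semiring_hom (semiring_on (UNIV :: nat set)) (coord_semiring p)) \<and>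
     (\<forall>h \<in> semiring_hom (semiring_on (UNIV :: nat set)) (coord_semiring p).
        \<forall>n. h n = (if n \<le> 1 \<or> (p = 2 \<and> n \<le> 2) then Pt n 0 else Infty)) \<and>
     (\<forall>x x'. x \<ge> 2 \<and> x' \<ge> 2 \<longrightarrow> Pt x 0 \<oplus>\<^bsub>coord_semiring p\<^esub> Pt x' 0 = Infty) \<and>
     (\<forall>y y'. Pt 0 y \<oplus>\<^bsub>coord_semiring p\<^esub> Pt 0 y' = Pt 0 (max y y')) \<and>
     (\<forall>x y. Pt x 0 \<oplus>\<^bsub>coord_semiring p\<^esub> Pt 0 y = Pt x y) \<and>
     (\<forall>z. Infty \<oplus>\<^bsub>coord_semiring p\<^esub> z = Infty) \<and>
     (\<forall>x x'. x \<ge> 2 \<and> x' \<ge> 2 \<longrightarrow> Pt x 0 \<otimes>\<^bsub>coord_semiring p\<^esub> Pt x' 0 = Infty) \<and>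
     (\<forall>y y'. Pt 0 y \<otimes>\<^bsub>coord_semiring p\<^esub> Pt 0 y' = Pt 0 (min y y')) \<and>
     (\<forall>x y. x \<ge> 1 \<longrightarrow> Pt x 0 \<otimes>\<^bsub>coord_semiring p\<^esub> Pt 0 y = Pt 0 y) \<and>
     (\<forall>y. Infty \<otimes>\<^bsub>coord_semiring p\<^esub> Pt 0 y = Pt 0 y) \<and>
     (\<forall>x. x \<ge> 1 \<longrightarrow> Infty \<otimes>\<^bsub>coord_semiring p\<^esub> Pt x 0 = Infty)"
proof (intro conjI)
  note p = assms
  have at_d: "witt_of p u (d p i j) = pattern u i j" for u i j
    using witt_of_properties[OF p] by blast
  show "bij_betw (witt_of p) UNIV (W p)" by (rule bij_witt_of[OF p])
  show "\<forall>x y i j. witt_of p (Pt x y) (d p i j) = 0 \<longleftrightarrow> i \<ge> x \<and> j \<ge> y"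
    by (simp only: at_d pattern_eq_0 simp_thms)
  show "\<forall>i j. witt_of p Infty (d p i j) = 1"
    by (simp only: at_d pattern.simps simp_thms)
  show "comm_semiring (coord_semiring p)" by (rule comm_semiring_coord_semiring[OF p])
  show "\<exists>!h. h \<in> semiring_hom (semiring_on (UNIV :: nat set)) (coord_semiring p)"
    unfolding nat_hom_coord_semiring[OF p] by simp
  show "\<forall>h \<in> semiring_hom (semiring_on (UNIV :: nat set)) (coord_semiring p).
      \<forall>n. h n = (if n \<le> 1 \<or> (p = 2 \<and> n \<le> 2) then Pt n 0 else Infty)"
    unfolding Ball_def nat_hom_coord_semiring[OF p] by simp
qed (auto simp: coord_semiring_eq[OF assms])

end
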